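(* For every integer $n\ge 0$ there is a bijection $\mathbf{I}_{\mathcal M}:\mathcal{M}_n\to\mathcal{I}_{n+1}$ between the set $\mathcal{M}_n$ of rooted bipartite planar maps with $n$ edges and the set $\mathcal{I}_{n+1}$ of new intervals of size $n+1$, with inverse denoted $\mathbf{M}_{\mathcal I}$, such that, for every $M\in\mathcal{M}_n$ and $I=\mathbf{I}_{\mathcal M}(M)$, $$\mathbf{white}(M)=\mathbf{c}_{00}(I),\qquad \mathbf{black}(M)=\mathbf{c}_{01}(I),$$ $$\mathbf{face}(M)=1+\mathbf{c}_{11}(I),\qquad \mathbf{outdeg}(M)=\mathbf{rcont}(I)-1.$$
   Context: Dyck paths. A Dyck path is a lattice path with steps $u=(1,1)$ and $d=(1,-1)$, starting at the origin, ending on the $x$-axis and never going below it; its size is half its length. It is also seen as a word in $\{u,d\}$. A rising contact is an up step starting on the $x$-axis. The $i$-th up step $u_i$ of a Dyck path $P$ matches the unique down step $d_j$ after it such that the factor $P_i$ of $P$ strictly between $u_i$ and $d_j$ is a (possibly empty) Dyck path. The bracket vector $V_P$ of $P$ is defined by $V_P(i)=$ size of $P_i$. New intervals. For Dyck paths $P,Q$ of the same size $m$, put $P\preceq Q$ (Tamari order) iff $V_P(i)\le V_Q(i)$ for all $1\le i\le m$. A Tamari interval of size $m$ is a pair $[P,Q]$ of Dyck paths of size $m$ with $P\preceq Q$. It is a new interval if (i) $V_Q(1)=m-1$; and (ii) for all $1\le i\le m$, if $V_Q(i)>0$ then $V_P(i)\le V_Q(i+1)$. $\mathcal{I}_m$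 is the set of new intervals of size $m\ge1$. Statistics on new intervals. For a Dyck path $P$ of size $m$, $\mathrm{Type}(P)$ is the word $w_1\cdots w_m$ with $w_i=1$ if the $i$-th up step of $P$ is immediately followed by an up step, and $w_i=0$ otherwise. For $I=[P,Q]\in\mathcal{I}_m$, $\mathbf{c}_{00}(I)$, $\mathbf{c}_{01}(I)$, $\mathbf{c}_{11}(I)$ are the numbers of indices $i$ such that $(\mathrm{Type}(P)_i,\mathrm{Type}(Q)_i)$ equals $(0,0)$, $(0,1)$, $(1,1)$ respectively (the value $(1,0)$ never occurs). $\mathbf{rcont}(I)$ is the number of rising contacts of the lower path $P$. Maps. A bipartite planar map is a drawing in the plane of a connected bipartite graph (multiple edges allowed; vertices coloured black and white, each edge joining a black and a white vertex), with edges meeting only at their ends, up to continuous deformation of the plane. The edges cut the plane into faces; the outer face is the unbounded one. Maps are rooted: a corner of the outer face at a black vertex is distinguished (the root corner; its vertex is the root vertex). The size is the number of edges; $\mathcal{M}_n$ is the set of rooted bipartite planar maps of size $n$; the only map of size $0$ is a single black vertex. $\mathbf{black}(M)$, $\mathbf{white}(M)$, $\mathbf{face}(M)$ are the numbers of black vertices, white vertices and faces (including the outer face). $\mathbf{outdeg}(M)$ is half the number of corners of the outer face (with value $0$ for the one-vertex map).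
   Formalization: The equalities white(M) = c00(I) and black(M) = c01(I) are asserted only for n ≥ 1, since at n = 0 they fail: the one-vertex map has white 0, black 1, while the only new interval [ud, ud] has c00 = 1, c01 = 0. *)

theory Defs
  imports "HOL-Combinatorics.Combinatorics"
begin

section \<open>Dyck paths\<close>

datatype step = U | D

fun rise :: "step \<Rightarrow> int" where
  "rise U = 1"
| "rise D = -1"

definition height :: "step list \<Rightarrow> nat \<Rightarrow> int" where
  "height P k = sum_list (map rise (take k P))"

definition dyck :: "step list \<Rightarrow> bool" where
  "dyck P \<longleftrightarrow> (\<forall>k\<le>length P. height P k \<ge> 0) \<and> height P (length P) = 0"

definition semilength :: "step list \<Rightarrow> nat" where
  "semilength P = length P div 2"

text \<open>Steps of a word are addressed by 0-based list positions, whereas up steps (and hence bracket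
  vectors) are numbered from 1.\<close>

definition up_positions :: "step list \<Rightarrow> nat list" where
  "up_positions P = filter (\<lambda>k. P ! k = U) [0..<length P]"

definition up_pos :: "step list \<Rightarrow> nat \<Rightarrow> nat" where
  "up_pos P i = up_positions P ! (i - 1)"

definition factor_between :: "step list \<Rightarrow> nat \<Rightarrow> nat \<Rightarrow> step list" where
  "factor_between P k j = take (j - Suc k) (drop (Suc k) P)"

definition matching_down :: "step list \<Rightarrow> nat \<Rightarrow> nat" where
  "matching_down P k =
     (THE j. k < j \<and> j < length P \<and> P ! j = D \<and> dyck (factor_between P k j))"

definition bracket :: "step list \<Rightarrow> nat \<Rightarrow> nat" where
  "bracket P i =
     (let k = up_pos P i in semilength (factor_between P k (matching_down P k)))"

definition rising_contacts :: "step list \<Rightarrow> nat" where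
  "rising_contacts P = card {k. k < length P \<and> P ! k = U \<and> height P k = 0}"

definition type_word :: "step list \<Rightarrow> nat list" where
  "type_word P =
     map (\<lambda>k. if Suc k < length P \<and> P ! Suc k = U then 1 else 0) (up_positions P)"


section \<open>New intervals\<close>

definition dyck_paths :: "nat \<Rightarrow> step list set" where
  "dyck_paths m = {P. dyck P \<and> semilength P = m}"

definition tamari_le :: "step list \<Rightarrow> step list \<Rightarrow> bool" where
  "tamari_le P Q \<longleftrightarrow> semilength P = semilength Q \<and>
     (\<forall>i\<in>{1..semilength P}. bracket P i \<le> bracket Q i)"

definition tamari_intervals :: "nat \<Rightarrow> (step list \<times> step list) set" where
  "tamari_intervals m = {(P, Q). P \<in> dyck_paths m \<and> Q \<in> dyck_paths m \<and> tamari_le P Q}"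

text \<open>Only meaningful for \<open>m \<ge> 1\<close>. In the second condition \<open>i + 1 \<le> m\<close> holds automatically, since
  the bracket vector vanishes at the last up step.\<close>

definition new_intervals :: "nat \<Rightarrow> (step list \<times> step list) set" where
  "new_intervals m = {(P, Q) \<in> tamari_intervals m.
     bracket Q 1 = m - 1 \<and>
     (\<forall>i\<in>{1..m}. bracket Q i > 0 \<longrightarrow> bracket P i \<le> bracket Q (i + 1))}"

definition type_count :: "nat \<Rightarrow> nat \<Rightarrow> step list \<times> step list \<Rightarrow> nat" where
  "type_count a b I = (case I of (P, Q) \<Rightarrow>
     card {i. i < semilength P \<and> type_word P ! i = a \<and> type_word Q ! i = b})"

definition c00 :: "step list \<times> step list \<Rightarrow> nat" where
  "c00 = type_count 0 0"

definition c01 :: "step list \<times> step list \<Rightarrow> nat" where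
  "c01 = type_count 0 1"

definition c11 :: "step list \<times> step list \<Rightarrow> nat" where
  "c11 = type_count 1 1"

definition rcont :: "step list \<times> step list \<Rightarrow> nat" where
  "rcont I = rising_contacts (fst I)"


section \<open>Rooted bipartite planar maps\<close>

text \<open>
  A map with \<open>n \<ge> 1\<close> edges is encoded by its rotation system (combinatorial map). The edges are
  labelled \<open>0, \<dots>, n - 1\<close>; each edge \<open>e\<close> consists of a half-edge \<open>(e, Black)\<close> at its black end and a
  half-edge \<open>(e, White)\<close> at its white end. The permutation \<open>rot\<close> sends a half-edge to the next
  one in counterclockwise order around the same vertex, so the vertices are the orbits of \<open>rot\<close>,
  and bipartiteness says that \<open>rot\<close> preserves colours.

  Every half-edge \<open>h\<close> stands for one corner, namely the one just before \<open>h\<close> in the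
  counterclockwise order around its vertex. Following the edge of \<open>h\<close> to its other end and
  turning to the next half-edge leads to the next corner of the same face. Hence the
  faces are the orbits of \<open>rot \<circ> flip\<close>, and the number of corners of a face is the size of
  its orbit.

  The root is given by the edge \<open>r\<close> such that \<open>(r, Black)\<close> is the root corner. The outer face is the
  face containing the root corner: deforming a map in the plane amounts to deforming it on
  the sphere with this face marked. Planarity (genus 0) is Euler's relation for a connected map.

  The map of size 0 has no half-edges and is a separate constructor.
\<close>

datatype colour = Black | White

type_synonym half_edge = "nat \<times> colour"

fun flip :: "half_edge \<Rightarrow> half_edge" where
  "flip (e, Black) = (e, White)"
| "flip (e, White) = (e, Black)"

datatype bip_map =
    Vertex_Map
  | Edge_Map nat "half_edge \<Rightarrow> half_edge" nat

definition half_edges :: "nat \<Rightarrow> half_edge set" where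
  "half_edges n = {..<n} \<times> UNIV"

definition vertices :: "nat \<Rightarrow> (half_edge \<Rightarrow> half_edge) \<Rightarrow> half_edge set set" where
  "vertices n rot = orbit rot ` half_edges n"

definition vertices_of :: "colour \<Rightarrow> nat \<Rightarrow> (half_edge \<Rightarrow> half_edge) \<Rightarrow> half_edge set set" where
  "vertices_of c n rot = orbit rot ` ({..<n} \<times> {c})"

definition faces :: "nat \<Rightarrow> (half_edge \<Rightarrow> half_edge) \<Rightarrow> half_edge set set" where
  "faces n rot = orbit (rot \<circ> flip) ` half_edges n"

definition connected_map :: "nat \<Rightarrow> (half_edge \<Rightarrow> half_edge) \<Rightarrow> bool" where
  "connected_map n rot \<longleftrightarrow> (\<forall>h\<in>half_edges n. \<forall>h'\<in>half_edges n.
     (h, h') \<in> ({(x, rot x) | x. x \<in> half_edges n} \<union> {(x, flip x) | x. x \<in> half_edges n})\<^sup>*)"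

definition planar_map :: "nat \<Rightarrow> (half_edge \<Rightarrow> half_edge) \<Rightarrow> bool" where
  "planar_map n rot \<longleftrightarrow> int (card (vertices n rot)) - int n + int (card (faces n rot)) = 2"

fun map_size :: "bip_map \<Rightarrow> nat" where
  "map_size Vertex_Map = 0"
| "map_size (Edge_Map n rot r) = n"

fun is_bip_planar_map :: "bip_map \<Rightarrow> bool" where
  "is_bip_planar_map Vertex_Map \<longleftrightarrow> True"
| "is_bip_planar_map (Edge_Map n rot r) \<longleftrightarrow>
     rot permutes half_edges n \<and> (\<forall>h. snd (rot h) = snd h) \<and>
     connected_map n rot \<and> planar_map n rot \<and> r < n"

text \<open>Two encodings describe the same rooted map iff they differ by a relabelling of the edges.\<close>

fun same_map :: "bip_map \<Rightarrow> bip_map \<Rightarrow> bool" where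
  "same_map Vertex_Map Vertex_Map \<longleftrightarrow> True"
| "same_map (Edge_Map n rot r) (Edge_Map n' rot' r') \<longleftrightarrow> n = n' \<and>
     (\<exists>\<pi>. \<pi> permutes {..<n} \<and> \<pi> r = r' \<and>
          (\<forall>h\<in>half_edges n. rot' (map_prod \<pi> id h) = map_prod \<pi> id (rot h)))"
| "same_map _ _ \<longleftrightarrow> False"

definition labelled_maps :: "nat \<Rightarrow> bip_map set" where
  "labelled_maps n = {M. is_bip_planar_map M \<and> map_size M = n}"

definition rooted_maps :: "nat \<Rightarrow> bip_map set set" where
  "rooted_maps n = labelled_maps n //
     {(M, M'). M \<in> labelled_maps n \<and> M' \<in> labelled_maps n \<and> same_map M M'}"

text \<open>
  The statistics are defined on representatives. The single vertex of the map of size 0 is black,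
  while the unique new interval of size 1, namely \<open>([U, D], [U, D])\<close>, has \<open>c00 = 1\<close> and \<open>c01 = 0\<close>.
  So the numbers of white and black vertices can match \<open>c00\<close> and \<open>c01\<close> only for maps with at least
  one edge.
\<close>

fun black :: "bip_map \<Rightarrow> nat" where
  "black Vertex_Map = 1"
| "black (Edge_Map n rot r) = card (vertices_of Black n rot)"

fun white :: "bip_map \<Rightarrow> nat" where
  "white Vertex_Map = 0"
| "white (Edge_Map n rot r) = card (vertices_of White n rot)"

fun face :: "bip_map \<Rightarrow> nat" where
  "face Vertex_Map = 1"
| "face (Edge_Map n rot r) = card (faces n rot)"

fun outdeg :: "bip_map \<Rightarrow> nat" where
  "outdeg Vertex_Map = 0"
| "outdeg (Edge_Map n rot r) = card (orbit (rot \<circ> flip) (r, Black)) div 2"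

end

theory Submission
  imports Defs
begin

text \<open>
  Maps and new intervals are both encoded by one kind of tree. A map is a pair of permutations of
  its edges, \<open>\<sigma>\<close> turning around black and \<open>\<alpha>\<close> around white vertices, and its faces are the cycles of
  \<open>\<sigma> \<circ> \<alpha>\<close>. Deleting the root edge multiplies \<open>\<sigma>\<close> and \<open>\<alpha>\<close> by one transposition each. If the edge has
  the same face on both sides, it is a bridge because the genus is not negative, and the map falls
  apart into two (possibly empty) planar maps. Otherwise two faces merge, the map stays connected, and
  the edge is recovered from the number of the corner of the new outer face at which it ended.

  In an interval \<open>[P, Q]\<close> the path \<open>Q = U Q' D\<close> is a plane tree. If its root has several children, or
  \<open>P\<close> starts with \<open>U D\<close>, the last subtree splits off from \<open>Q\<close>, and since the interval is new \<open>P\<close> splits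
  at the same place. Otherwise \<open>Q = U U Q'' D D\<close>, and erasing the first up step of \<open>P\<close> with its match
  leaves a smaller interval, from which \<open>P\<close> is recovered by the number of prime factors that were
  enclosed; newness says that at least one factor is not enclosed.
\<close>


section \<open>Transpositions and cycles\<close>

text \<open>The two encodings agree because of one number. A map of outer half-degree
  \<open>d\<close> has \<open>d\<close> white corners in its outer face, and a new root edge that is
  not a bridge may end in any of them. The lower path of the matching interval has
  \<open>d + 1\<close> prime factors, and an erased up step enclosed at least one of them but not
  all, which again leaves \<open>d\<close> choices. Vertices come from empty parts: an empty part at
  the black end creates a black vertex, and on the side of intervals its only pair of types (0,0)
  becomes (0,1), because the root of \<open>Q\<close> now has a child. An empty part at the white
  end creates a white vertex and keeps its pair (0,0). Two obstacles shape the map side. Planarity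
  is given only as Euler's relation, so every effect of deleting an edge has to be counted through
  cycles of permutations. And a rooted map is a class of labelled maps; no canonical labelling is
  chosen, but the tree is tied to labelled hypermaps by a relation that turns out to be a complete
  invariant of the class.\<close>

definition cyc :: "('a \<Rightarrow> 'a) \<Rightarrow> 'a set \<Rightarrow> nat" where
  "cyc p E = card (orbit p ` E)"

lemma orbit_eq_iff:
  assumes "permutation p"
  shows "orbit p x = orbit p y \<longleftrightarrow> x \<in> orbit p y"
  using assms by (metis orbit_swap orbit_trans permutation_self_in_orbit subsetI subset_antisym)

lemma orbit_commute:
  assumes "permutation p"
  shows "x \<in> orbit p y \<longleftrightarrow> y \<in> orbit p x"
  using orbit_eq_iff[OF assms] by metis

lemma orbit_step_iff:
  assumes "permutation p"
  shows "p x \<in> orbit p (p y) \<longleftrightarrow> x \<in> orbit p y"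
  using assms by (simp add: orbit_eq_iff[symmetric] permutation_orbit_step)

lemma permutation_transpose_comp:
  "permutation p \<Longrightarrow> permutation (transpose a b \<circ> p)"
  by (simp add: permutation_compose permutation_swap_id)

lemma funpow_agree:
  assumes "\<And>i. i < k \<Longrightarrow> q ((p ^^ i) x) = (p ^^ Suc i) x" and "i \<le> k"
  shows "(q ^^ i) x = (p ^^ i) x"
  using assms(2)
proof (induction i)
  case (Suc i)
  then show ?case using assms(1)[of i] by simp
qed simp

text \<open>The cycle of \<open>b\<close> closes early: the new permutation follows \<open>p\<close>
  until the step that would reach \<open>a\<close>, which is redirected to \<open>b\<close>.\<close>

lemma orbit_transpose_split:
  assumes k: "0 < k" "(p ^^ k) b = a" and ne: "\<And>i. 0 < i \<Longrightarrow> i < k \<Longrightarrow> (p ^^ i) b \<noteq> a \<and> (p ^^ i) b \<noteq> b"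
  shows "orbit (transpose a b \<circ> p) b = (\<lambda>i. (p ^^ i) b) ` {..<k}"
proof -
  let ?q = "transpose a b \<circ> p"
  have step: "?q ((p ^^ i) b) = (p ^^ Suc i) b" if "i < k - 1" for i
    using ne[of "Suc i"] that by simp
  have agree: "(?q ^^ i) b = (p ^^ i) b" if "i \<le> k - 1" for i
    by (rule funpow_agree[OF _ that]) (use step in auto)
  have "(?q ^^ k) b = ?q ((?q ^^ (k - 1)) b)"
    using k(1) by (cases k) auto
  also have "\<dots> = transpose a b ((p ^^ k) b)"
    using k(1) by (subst agree) (cases k; simp)+
  also have "\<dots> = b" using k by simp
  finally have "orbit ?q b = {(?q ^^ m) b | m. m < k}"
    using k(1) by (rule orbit_altdef_bounded)
  also have "\<dots> = {(p ^^ m) b | m. m < k}"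
    using agree by (metis (no_types, lifting) One_nat_def Suc_pred k(1) less_Suc_eq_le)
  finally show ?thesis by auto
qed

text \<open>Under the new permutation \<open>a\<close> runs once through its old cycle; at the
  moment of its return it is sent to \<open>b\<close> instead.\<close>

lemma orbit_transpose_reach:
  assumes p: "permutation p" and ab: "b \<notin> orbit p a"
  shows "insert b (orbit p a) \<subseteq> orbit (transpose a b \<circ> p) a"
proof -
  let ?q = "transpose a b \<circ> p"
  have q: "permutation ?q" using p by (rule permutation_transpose_comp)
  have self: "a \<in> orbit p a" using p by (rule permutation_self_in_orbit)
  define k where "k = funpow_dist1 p a a"
  have k: "0 < k" "(p ^^ k) a = a" unfolding k_def using funpow_dist1_prop[OF self] by blast+
  have ne: "(p ^^ i) a \<noteq> a" if "0 < i" "i < k" for i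
    using funpow_dist1_least[OF that(1), of p a a] that(2) unfolding k_def by blast
  have neb: "(p ^^ i) a \<noteq> b" for i
    using ab funpow_in_orbit[OF self, of i] by auto
  have step: "?q ((p ^^ i) a) = (p ^^ Suc i) a" if "i < k - 1" for i
    using ne[of "Suc i"] neb[of "Suc i"] that by simp
  have agree: "(?q ^^ i) a = (p ^^ i) a" if "i \<le> k - 1" for i
    by (rule funpow_agree[OF _ that]) (use step in auto)
  have "(?q ^^ k) a = ?q ((?q ^^ (k - 1)) a)"
    using k(1) by (cases k) auto
  also have "\<dots> = transpose a b ((p ^^ k) a)"
    using k(1) by (subst agree) (cases k; simp)+
  also have "\<dots> = b" using k by simp
  finally have "b = (?q ^^ k) a" ..
  then have "b \<in> orbit ?q a" using k(1) unfolding orbit_altdef by blast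
  moreover have "orbit p a \<subseteq> orbit ?q a"
  proof -
    have "orbit p a = {(p ^^ m) a | m. m < k}"
      using k(2,1) by (rule orbit_altdef_bounded)
    also have "\<dots> \<subseteq> {(?q ^^ m) a | m. True}"
    proof
      fix y assume "y \<in> {(p ^^ m) a | m. m < k}"
      then obtain m where "m < k" "y = (p ^^ m) a" by blast
      then have "y = (?q ^^ m) a" using agree[of m] by simp
      then show "y \<in> {(?q ^^ m) a | m. True}" by blast
    qed
    also have "\<dots> = orbit ?q a" using q by (simp add: orbit_altdef_permutation)
    finally show ?thesis .
  qed
  ultimately show ?thesis by blast
qed

text \<open>Reachability in both directions puts each old cycle inside the new one, and the union of
  the two is closed under the new permutation. Elsewhere nothing changes.\<close>

lemma orbit_transpose_merge:
  assumes p: "permutation p" and ab: "b \<notin> orbit p a"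
  shows "orbit (transpose a b \<circ> p) x =
    (if x \<in> orbit p a \<union> orbit p b then orbit p a \<union> orbit p b else orbit p x)"
proof -
  let ?q = "transpose a b \<circ> p" and ?U = "orbit p a \<union> orbit p b"
  have q: "permutation ?q" using p by (rule permutation_transpose_comp)
  have self: "y \<in> orbit p y" for y using p by (rule permutation_self_in_orbit)
  have ab': "a \<notin> orbit p b" using ab orbit_commute[OF p] by metis
  have 1: "insert b (orbit p a) \<subseteq> orbit ?q a"
    using orbit_transpose_reach[OF p ab] .
  have 2: "insert a (orbit p b) \<subseteq> orbit ?q b"
    using orbit_transpose_reach[OF p ab'] by (simp add: transpose_commute)
  have 3: "orbit ?q a = orbit ?q b"
    using 2 orbit_eq_iff[OF q] by blast
  have sub: "?U \<subseteq> orbit ?q a" using 1 2 3 by blast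
  have "y \<in> ?U" if "y \<in> orbit ?q x" "x \<in> ?U" for x y
    using that
  proof induction
    case base
    then show ?case using self by (auto simp: transpose_def intro: orbit.step)
  next
    case (step y)
    then show ?case using self by (auto simp: transpose_def intro: orbit.step)
  qed
  then have "orbit ?q a = ?U" using sub self by blast
  then have in_case: "orbit ?q x = ?U" if "x \<in> ?U"
    using that orbit_eq_iff[OF q] by blast
  have out_case: "orbit ?q x = orbit p x" if x: "x \<notin> ?U"
  proof (rule orbit_cong[OF self])
    fix s assume "s \<in> orbit p x"
    then have "p s \<in> orbit p x" by (rule orbit.step)
    then have "p s \<noteq> a" "p s \<noteq> b" using x orbit_commute[OF p] by blast+
    then show "?q s = p s" by simp
  qed
  show ?thesis using in_case out_case by auto
qed

lemma orbit_transpose_notin: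
  assumes p: "permutation p" and ab: "a \<in> orbit p b" "a \<noteq> b"
  shows "a \<notin> orbit (transpose a b \<circ> p) b"
proof -
  define k where "k = funpow_dist1 p b a"
  have k: "0 < k" "(p ^^ k) b = a" unfolding k_def using funpow_dist1_prop[OF ab(1)] by blast+
  have nea: "(p ^^ i) b \<noteq> a" if "0 < i" "i < k" for i
    using funpow_dist1_least[OF that(1), of p b a] that(2) unfolding k_def by blast
  \<comment> \<open>If \<open>b\<close> returned before meeting \<open>a\<close>, its cycle would
    have closed without \<open>a\<close>, contrary to \<open>ab\<close>.\<close>
  have neb: "(p ^^ i) b \<noteq> b" if "0 < i" "i < k" for i
  proof
    assume "(p ^^ i) b = b"
    then have "orbit p b = {(p ^^ m) b | m. m < i}"
      using that(1) by (rule orbit_altdef_bounded)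
    then obtain m where "m < i" "a = (p ^^ m) b" using ab(1) by blast
    then show False using nea[of m] ab(2) that(2) by (cases m) auto
  qed
  have "orbit (transpose a b \<circ> p) b = (\<lambda>i. (p ^^ i) b) ` {..<k}"
    using k nea neb by (intro orbit_transpose_split) auto
  moreover have "a \<noteq> (p ^^ i) b" if "i < k" for i
    using nea[of i] ab(2) that by (cases i) auto
  ultimately show ?thesis by auto
qed

lemma permutes_transpose_comp:
  "p permutes E \<Longrightarrow> a \<in> E \<Longrightarrow> b \<in> E \<Longrightarrow> transpose a b \<circ> p permutes E"
  by (simp add: permutes_compose permutes_swap_id)

lemma permutes_comp_transpose:
  "p permutes E \<Longrightarrow> a \<in> E \<Longrightarrow> b \<in> E \<Longrightarrow> p \<circ> transpose a b permutes E"
  by (simp add: permutes_compose permutes_swap_id)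

lemma cyc_transpose_merge:
  assumes E: "finite E" "p permutes E" "a \<in> E" "b \<in> E" and ab: "b \<notin> orbit p a"
  shows "cyc p E = Suc (cyc (transpose a b \<circ> p) E)"
proof -
  have p: "permutation p" using E permutation_permutes by blast
  let ?A = "orbit p a" and ?B = "orbit p b"
  have self: "y \<in> orbit p y" for y using p by (rule permutation_self_in_orbit)
  define R where "R = orbit p ` E - {?A, ?B}"
  have "?A \<noteq> ?B" using self ab by blast
  have 1: "orbit p ` E = insert ?A (insert ?B R)" unfolding R_def using E by blast
  have R: "orbit p ` E - {?A, ?B} = orbit p ` (E - (?A \<union> ?B))"
    using orbit_eq_iff[OF p] by blast
  have "E = (E \<inter> (?A \<union> ?B)) \<union> (E - (?A \<union> ?B))" by blast
  then have "orbit (transpose a b \<circ> p) ` E = orbit (transpose a b \<circ> p) ` (E \<inter> (?A \<union> ?B)) \<union>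
     orbit (transpose a b \<circ> p) ` (E - (?A \<union> ?B))" by blast
  also have "orbit (transpose a b \<circ> p) ` (E \<inter> (?A \<union> ?B)) = {?A \<union> ?B}"
    using orbit_transpose_merge[OF p ab] self E by fastforce
  also have "orbit (transpose a b \<circ> p) ` (E - (?A \<union> ?B)) = orbit p ` (E - (?A \<union> ?B))"
    using orbit_transpose_merge[OF p ab] by simp
  finally have 2: "orbit (transpose a b \<circ> p) ` E = insert (?A \<union> ?B) R"
    unfolding R_def R by (simp only: insert_is_Un[symmetric])
  have "finite R" unfolding R_def using E by simp
  have "?A \<union> ?B \<notin> R"
  proof
    assume "?A \<union> ?B \<in> R"
    then obtain x where x: "x \<notin> ?A \<union> ?B" "orbit p x = ?A \<union> ?B"
      unfolding R_def R by blast
    then have "x \<in> ?A \<union> ?B" using self[of x] by simp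
    with x(1) show False ..
  qed
  moreover have "?A \<notin> insert ?B R" "?B \<notin> R" using \<open>?A \<noteq> ?B\<close> unfolding R_def by blast+
  ultimately show ?thesis unfolding cyc_def 1 2 using \<open>finite R\<close> by simp
qed

text \<open>A transposition is an involution, so a split is a merge read backwards.\<close>

lemma cyc_transpose_split:
  assumes E: "finite E" "p permutes E" "a \<in> E" "b \<in> E" and ab: "b \<in> orbit p a" "a \<noteq> b"
  shows "cyc (transpose a b \<circ> p) E = Suc (cyc p E)"
proof -
  let ?q = "transpose a b \<circ> p"
  have p: "permutation p" using E permutation_permutes by blast
  have q: "?q permutes E" using E by (simp add: permutes_transpose_comp)
  have q': "permutation ?q" using p by (rule permutation_transpose_comp)
  have "a \<notin> orbit ?q b" using orbit_transpose_notin[OF p] ab orbit_commute[OF p] by metis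
  then have "b \<notin> orbit ?q a" using orbit_commute[OF q'] by metis
  moreover have "transpose a b \<circ> ?q = p" by (simp add: comp_assoc[symmetric])
  ultimately show ?thesis using cyc_transpose_merge[OF E(1) q E(3,4)] by simp
qed

text \<open>White rotations are multiplied on the right; this moves the transposition to the left,
  where the cycles have been counted.\<close>

lemma comp_transpose_eq:
  assumes "bij p"
  shows "p \<circ> transpose a b = transpose (p a) (p b) \<circ> p"
proof
  fix x
  show "(p \<circ> transpose a b) x = (transpose (p a) (p b) \<circ> p) x"
    using bij_is_inj[OF assms, THEN inj_eq, of x] unfolding transpose_def o_def by presburger
qed

lemma cyc_comp_transpose_merge:
  assumes E: "finite E" "p permutes E" "a \<in> E" "b \<in> E" and ab: "b \<notin> orbit p a"
  shows "cyc p E = Suc (cyc (p \<circ> transpose a b) E)"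
proof -
  have p: "permutation p" using E permutation_permutes by blast
  have "p b \<notin> orbit p (p a)"
    using ab p by (simp add: orbit_step_iff)
  then show ?thesis
    using cyc_transpose_merge[of E p "p a" "p b"] E
    by (simp add: comp_transpose_eq[OF permutes_bij[OF E(2)]] permutes_in_image[OF E(2)])
qed

text \<open>The fixed point \<open>a\<close> is threaded into the cycle of \<open>b\<close>,
  directly after \<open>b\<close>. This is how a new edge, isolated so far, enters a face.\<close>

lemma orbit_comp_transpose_fixpoint:
  assumes p: "permutation p" and a: "p a = a" and ab: "b \<noteq> a"
  shows "orbit (p \<circ> transpose a b) x =
    (if x \<in> insert a (orbit p b) then insert a (orbit p b) else orbit p x)"
proof -
  have b: "bij p" using p by (simp add: permutation_bijective)
  have "orbit p a = {a}" using a by (simp add: orbit_eq_singleton_iff)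
  moreover have "p b \<noteq> a" using a ab b by (metis bij_def injD)
  moreover have "orbit p (p b) = orbit p b" using p by (rule permutation_orbit_step)
  ultimately show ?thesis
    using orbit_transpose_merge[OF p, of "p b" a x] a by (simp add: comp_transpose_eq[OF b])
qed

lemma cyc_insert_fixpoint:
  assumes "finite E" "p permutes E" "r \<notin> E"
  shows "cyc p (insert r E) = Suc (cyc p E)"
proof -
  have r: "orbit p r = {r}" using assms by (simp add: orbit_eq_singleton_iff permutes_not_in)
  have "{r} \<notin> orbit p ` E"
    using permutes_orbit_subset[OF assms(2)] assms(3) by blast
  then show ?thesis using assms(1) by (simp add: cyc_def r)
qed

section \<open>Products of permutations of disjoint sets\<close>

lemma orbit_comp_disjoint:
  assumes p: "p permutes A" and q: "q permutes B" and AB: "A \<inter> B = {}"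
  shows "x \<in> A \<Longrightarrow> orbit (p \<circ> q) x = orbit p x" and "x \<in> B \<Longrightarrow> orbit (p \<circ> q) x = orbit q x"
proof -
  have 1: "(p \<circ> q) y = p y" if "y \<in> A" for y
    using that AB q by (simp add: permutes_not_in disjoint_iff)
  have 2: "(p \<circ> q) y = q y" if "y \<in> B" for y
    using that AB permutes_not_in[OF p, of "q y"] permutes_in_image[OF q, of y] by auto
  show "orbit (p \<circ> q) x = orbit p x" if "x \<in> A"
    using permutes_in_image[OF p] that 1 by (intro orbit_cong0[of x A]) auto
  show "orbit (p \<circ> q) x = orbit q x" if "x \<in> B"
    using permutes_in_image[OF q] that 2 by (intro orbit_cong0[of x B]) auto
qed

lemma cyc_comp_disjoint:
  assumes fin: "finite A" "finite B" and p: "p permutes A" and q: "q permutes B" and AB: "A \<inter> B = {}"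
  shows "cyc (p \<circ> q) (A \<union> B) = cyc p A + cyc q B"
proof -
  have "orbit (p \<circ> q) ` (A \<union> B) = orbit p ` A \<union> orbit q ` B"
    unfolding image_Un using orbit_comp_disjoint[OF p q AB] by (metis (no_types, lifting) image_cong)
  moreover have "orbit p ` A \<inter> orbit q ` B = {}"
  proof (rule ccontr)
    assume "orbit p ` A \<inter> orbit q ` B \<noteq> {}"
    then obtain x y where xy: "x \<in> A" "y \<in> B" "orbit p x = orbit q y" by blast
    have "orbit p x \<subseteq> A \<inter> B"
      using permutes_orbit_subset[OF p xy(1)] permutes_orbit_subset[OF q xy(2)] xy(3) by simp
    then show False using AB orbit_nonempty[of p x] by simp
  qed
  ultimately show ?thesis using fin by (simp add: cyc_def card_Un_disjoint)
qed

section \<open>Hypermaps and the insertion of an edge\<close>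

text \<open>Transitivity is stated through invariant sets, which makes it easy to follow when \<open>\<sigma>\<close> and \<open>\<alpha>\<close>
  are multiplied by transpositions. The empty hypermap is allowed.\<close>

definition hypermap :: "'a set \<Rightarrow> ('a \<Rightarrow> 'a) \<Rightarrow> ('a \<Rightarrow> 'a) \<Rightarrow> bool" where
  "hypermap E \<sigma> \<alpha> \<longleftrightarrow> finite E \<and> \<sigma> permutes E \<and> \<alpha> permutes E \<and>
     (\<forall>A\<subseteq>E. A \<noteq> {} \<longrightarrow> (\<forall>x. \<sigma> x \<in> A \<longleftrightarrow> x \<in> A) \<longrightarrow> (\<forall>x. \<alpha> x \<in> A \<longleftrightarrow> x \<in> A) \<longrightarrow> A = E)"

lemma hypermapI:
  assumes "finite E" "\<sigma> permutes E" "\<alpha> permutes E"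
    and "\<And>A. A \<subseteq> E \<Longrightarrow> A \<noteq> {} \<Longrightarrow> (\<And>x. \<sigma> x \<in> A \<longleftrightarrow> x \<in> A) \<Longrightarrow> (\<And>x. \<alpha> x \<in> A \<longleftrightarrow> x \<in> A) \<Longrightarrow> A = E"
  shows "hypermap E \<sigma> \<alpha>"
  using assms unfolding hypermap_def by blast

lemma hypermapD:
  assumes "hypermap E \<sigma> \<alpha>"
  shows "finite E" "\<sigma> permutes E" "\<alpha> permutes E" "permutation \<sigma>" "permutation \<alpha>"
proof -
  show *: "finite E" "\<sigma> permutes E" "\<alpha> permutes E" using assms unfolding hypermap_def by simp_all
  show "permutation \<sigma>" "permutation \<alpha>" using * permutation_permutes by blast+
qed

lemma hypermap_conn:
  assumes "hypermap E \<sigma> \<alpha>" "A \<subseteq> E" "A \<noteq> {}" "\<And>x. \<sigma> x \<in> A \<longleftrightarrow> x \<in> A" "\<And>x. \<alpha> x \<in> A \<longleftrightarrow> x \<in> A"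
  shows "A = E"
  using assms unfolding hypermap_def by blast

text \<open>Connectedness in the form used below: \<open>A\<close> may stick out of
  \<open>E\<close>, since it is a stable set of a larger map of which \<open>E\<close> is one
  part.\<close>

lemma hypermap_stable:
  assumes "hypermap E \<sigma> \<alpha>" "\<And>x. \<sigma> x \<in> A \<longleftrightarrow> x \<in> A" "\<And>x. \<alpha> x \<in> A \<longleftrightarrow> x \<in> A"
  shows "A \<inter> E = {} \<or> A \<inter> E = E"
proof (cases "A \<inter> E = {}")
  case False
  have "A \<inter> E = E"
    by (rule hypermap_conn[OF assms(1) _ False])
      (simp_all add: assms(2,3) permutes_in_image[OF hypermapD(2)[OF assms(1)]]
        permutes_in_image[OF hypermapD(3)[OF assms(1)]])
  then show ?thesis ..
qed simp

lemma transpose_comp_stable: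
  "r \<in> A \<longleftrightarrow> s \<in> A \<Longrightarrow> (transpose r s \<circ> p) x \<in> A \<longleftrightarrow> p x \<in> A"
  by (auto simp: transpose_def)

lemma comp_transpose_stable:
  "r \<in> A \<longleftrightarrow> s \<in> A \<Longrightarrow> (\<And>x. p x \<in> A \<longleftrightarrow> x \<in> A) \<Longrightarrow> (p \<circ> transpose r s) x \<in> A \<longleftrightarrow> x \<in> A"
  by (auto simp: transpose_def)

text \<open>The new edge \<open>r\<close> enters the black vertex of \<open>s\<close> just before \<open>s\<close>, and the white vertex of \<open>b\<close> just
  after \<open>b\<close>. If one of the two parts is empty, \<open>r\<close> itself plays the role of its root, so that the
  corresponding transposition is trivial and \<open>r\<close> ends in a leaf.\<close>

locale bridge =
  fixes E1 E2 :: "'a set" and \<sigma>1 \<alpha>1 \<sigma>2 \<alpha>2 :: "'a \<Rightarrow> 'a" and r s b :: 'a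
  assumes fin: "finite E1" "finite E2"
    and perm1: "\<sigma>1 permutes E1" "\<alpha>1 permutes E1"
    and perm2: "\<sigma>2 permutes E2" "\<alpha>2 permutes E2"
    and disj: "E1 \<inter> E2 = {}" and r: "r \<notin> E1 \<union> E2"
    and s: "if s = r then E1 = {} else s \<in> E1"
    and b: "if b = r then E2 = {} else b \<in> E2"
begin

definition "E = insert r (E1 \<union> E2)"
definition "\<sigma> = transpose r s \<circ> (\<sigma>1 \<circ> \<sigma>2)"
definition "\<alpha> = (\<alpha>1 \<circ> \<alpha>2) \<circ> transpose r b"

lemma fin_E: "finite E" and in_E: "r \<in> E" "s \<in> E" "b \<in> E"
  using fin s b by (auto simp: E_def split: if_splits)

lemma sub: "E1 \<union> E2 \<subseteq> E" by (auto simp: E_def)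

lemma comp_permutes:
  assumes "p permutes E1" "q permutes E2"
  shows "p \<circ> q permutes E1 \<union> E2"
  using assms by (intro permutes_compose) (auto intro: permutes_subset)

lemma comp_permutes_E:
  assumes "p permutes E1" "q permutes E2"
  shows "p \<circ> q permutes E"
  using comp_permutes[OF assms] sub by (rule permutes_subset)

lemma comp_r:
  assumes "p permutes E1" "q permutes E2"
  shows "(p \<circ> q) r = r"
  using comp_permutes[OF assms] r by (rule permutes_not_in)

lemma cyc_comp:
  assumes "p permutes E1" "q permutes E2"
  shows "cyc (p \<circ> q) E = Suc (cyc p E1 + cyc q E2)"
  unfolding E_def using cyc_insert_fixpoint[OF _ comp_permutes[OF assms] r] fin
    cyc_comp_disjoint[OF fin assms disj] by simp

lemma permutes: "\<sigma> permutes E" "\<alpha> permutes E"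
  unfolding \<sigma>_def \<alpha>_def
  using permutes_transpose_comp[OF comp_permutes_E[OF perm1(1) perm2(1)] in_E(1,2)]
    permutes_comp_transpose[OF comp_permutes_E[OF perm1(2) perm2(2)] in_E(1,3)] .

text \<open>\<open>\<sigma>2\<close> and \<open>\<alpha>1\<close> move disjoint sets and commute, so
  the face permutation regroups into those of the two parts, flanked by the two
  transpositions.\<close>

lemma face_perm: "\<sigma> \<circ> \<alpha> = transpose r s \<circ> (((\<sigma>1 \<circ> \<alpha>1) \<circ> (\<sigma>2 \<circ> \<alpha>2)) \<circ> transpose r b)"
proof -
  have "\<sigma>2 (\<alpha>1 x) = \<alpha>1 (\<sigma>2 x)" for x
  proof (cases "x \<in> E1")
    case True
    then have "\<alpha>1 x \<in> E1" using perm1 by (simp add: permutes_in_image)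
    then have "\<alpha>1 x \<notin> E2" "x \<notin> E2" using True disj by auto
    then show ?thesis using permutes_not_in[OF perm2(1)] by simp
  next
    case False
    moreover have "\<sigma>2 x \<notin> E1" if "x \<in> E2" using that perm2 disj by (auto simp: permutes_in_image)
    ultimately show ?thesis using permutes_not_in[OF perm2(1)] permutes_not_in[OF perm1(2)]
      by (cases "x \<in> E2") auto
  qed
  then show ?thesis unfolding \<sigma>_def \<alpha>_def by (auto simp: fun_eq_iff)
qed

lemma orbit_r:
  assumes "p permutes E1" "q permutes E2"
  shows "orbit (p \<circ> q) r = {r}"
  using comp_r[OF assms] by (simp add: orbit_eq_singleton_iff)

text \<open>Before the transposition \<open>r\<close> is a cycle of its own. It is absorbed into the
  cycle of \<open>s\<close>, unless \<open>s = r\<close> and it remains as a new black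
  vertex.\<close>

lemma cyc_\<sigma>: "cyc \<sigma> E + (if s = r then 0 else 1) = Suc (cyc \<sigma>1 E1 + cyc \<sigma>2 E2)"
  using cyc_transpose_merge[OF fin_E comp_permutes_E[OF perm1(1) perm2(1)] in_E(1,2)]
    cyc_comp[OF perm1(1) perm2(1)] orbit_r[OF perm1(1) perm2(1)]
  by (auto simp: \<sigma>_def)

lemma cyc_\<alpha>: "cyc \<alpha> E + (if b = r then 0 else 1) = Suc (cyc \<alpha>1 E1 + cyc \<alpha>2 E2)"
  using cyc_comp_transpose_merge[OF fin_E comp_permutes_E[OF perm1(2) perm2(2)] in_E(1,3)]
    cyc_comp[OF perm1(2) perm2(2)] orbit_r[OF perm1(2) perm2(2)]
  by (auto simp: \<alpha>_def)

lemma face_permutes: "\<sigma>1 \<circ> \<alpha>1 permutes E1" "\<sigma>2 \<circ> \<alpha>2 permutes E2"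
  using perm1 perm2 by (auto intro: permutes_compose)

abbreviation "\<phi>' \<equiv> (\<sigma>1 \<circ> \<alpha>1) \<circ> (\<sigma>2 \<circ> \<alpha>2)"
abbreviation "\<phi>'' \<equiv> \<phi>' \<circ> transpose r b"

lemma perm_face: "\<phi>' permutes E" "permutation \<phi>'" "\<phi>'' permutes E" "permutation \<phi>''"
proof -
  show 1: "\<phi>' permutes E" using comp_permutes_E[OF face_permutes] .
  show 2: "\<phi>'' permutes E" using 1 in_E by (intro permutes_comp_transpose)
  show "permutation \<phi>'" "permutation \<phi>''" using 1 2 fin_E permutation_permutes by blast+
qed

lemma orbit_b: "b \<noteq> r \<Longrightarrow> orbit \<phi>' b = orbit (\<sigma>2 \<circ> \<alpha>2) b"
  using orbit_comp_disjoint(2)[OF face_permutes disj, of b] b by (simp split: if_splits)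

lemma orbit_s: "s \<noteq> r \<Longrightarrow> orbit \<phi>' s = orbit (\<sigma>1 \<circ> \<alpha>1) s"
  using orbit_comp_disjoint(1)[OF face_permutes disj, of s] s by (simp split: if_splits)

lemma orbit_\<phi>''_r: "orbit \<phi>'' r = insert r (if b = r then {} else orbit (\<sigma>2 \<circ> \<alpha>2) b)"
proof (cases "b = r")
  case True
  then show ?thesis using orbit_r[OF face_permutes] by simp
next
  case False
  then show ?thesis
    unfolding orbit_comp_transpose_fixpoint[OF perm_face(2) comp_r[OF face_permutes] False, of r] orbit_b[OF False]
    by simp
qed

lemma s_notin: assumes "s \<noteq> r" shows "s \<notin> orbit \<phi>'' r"
proof -
  have "s \<in> E1" using s assms by simp
  moreover have "orbit (\<sigma>2 \<circ> \<alpha>2) b \<subseteq> E2" if "b \<noteq> r"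
    using permutes_orbit_subset[OF face_permutes(2)] b that by simp
  ultimately show ?thesis using disj assms unfolding orbit_\<phi>''_r by auto
qed

lemma orbit_\<phi>''_s: assumes "s \<noteq> r" shows "orbit \<phi>'' s = orbit (\<sigma>1 \<circ> \<alpha>1) s"
proof (cases "b = r")
  case True
  then show ?thesis using orbit_s[OF assms] by simp
next
  case False
  have "s \<notin> insert r (orbit \<phi>' b)"
    using s_notin[OF assms] False orbit_b unfolding orbit_\<phi>''_r by simp
  then show ?thesis
    unfolding orbit_comp_transpose_fixpoint[OF perm_face(2) comp_r[OF face_permutes] False, of s] orbit_s[OF assms]
    by (simp only: if_False)
qed

text \<open>Every nontrivial transposition merges two cycles here, never splits one: the outer faces
  of both parts and \<open>r\<close> become a single face.\<close>

lemma cyc_face: "cyc (\<sigma> \<circ> \<alpha>) E + (if s = r then 0 else 1) + (if b = r then 0 else 1) =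
    Suc (cyc (\<sigma>1 \<circ> \<alpha>1) E1 + cyc (\<sigma>2 \<circ> \<alpha>2) E2)"
proof -
  have 1: "cyc \<phi>'' E + (if b = r then 0 else 1) = cyc \<phi>' E"
    using cyc_comp_transpose_merge[OF fin_E perm_face(1) in_E(1,3)] orbit_r[OF face_permutes]
    by auto
  have 2: "cyc (\<sigma> \<circ> \<alpha>) E + (if s = r then 0 else 1) = cyc \<phi>'' E"
    using cyc_transpose_merge[OF fin_E perm_face(3) in_E(1,2)] s_notin unfolding face_perm by auto
  show ?thesis using 1 2 cyc_comp[OF face_permutes] by simp
qed

lemma orbit_face: "orbit (\<sigma> \<circ> \<alpha>) r =
   insert r ((if s = r then {} else orbit (\<sigma>1 \<circ> \<alpha>1) s) \<union> (if b = r then {} else orbit (\<sigma>2 \<circ> \<alpha>2) b))"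
proof (cases "s = r")
  case True
  then show ?thesis unfolding face_perm using orbit_\<phi>''_r by simp
next
  case False
  then show ?thesis unfolding face_perm
    using orbit_transpose_merge[OF perm_face(4) s_notin[OF False], of r] orbit_\<phi>''_r orbit_\<phi>''_s
    by auto
qed

lemma card_orbit_face: "card (orbit (\<sigma> \<circ> \<alpha>) r) =
   Suc ((if s = r then 0 else card (orbit (\<sigma>1 \<circ> \<alpha>1) s)) + (if b = r then 0 else card (orbit (\<sigma>2 \<circ> \<alpha>2) b)))"
proof -
  define A where "A = (if s = r then {} else orbit (\<sigma>1 \<circ> \<alpha>1) s)"
  define B where "B = (if b = r then {} else orbit (\<sigma>2 \<circ> \<alpha>2) b)"
  have A: "A \<subseteq> E1" using permutes_orbit_subset[OF face_permutes(1)] s by (simp add: A_def)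
  have B: "B \<subseteq> E2" using permutes_orbit_subset[OF face_permutes(2)] b by (simp add: B_def)
  have "card (insert r (A \<union> B)) = Suc (card A + card B)"
    using A B fin disj r by (subst card_insert_disjoint card_Un_disjoint; auto intro: finite_subset)+
  then show ?thesis unfolding orbit_face A_def B_def by (simp split: if_splits)
qed

lemma card_E: "card E = Suc (card E1 + card E2)"
  using r fin disj by (simp add: E_def card_Un_disjoint)

text \<open>Each factor moves only its own part, so stability under the glued permutation can be
  tested on the parts separately, for arbitrary \<open>A\<close>.\<close>

lemma stable_parts:
  assumes "p permutes E1" "q permutes E2"
  shows "(\<forall>x. (p \<circ> q) x \<in> A \<longleftrightarrow> x \<in> A) \<longleftrightarrow> (\<forall>x. p x \<in> A \<longleftrightarrow> x \<in> A) \<and> (\<forall>x. q x \<in> A \<longleftrightarrow> x \<in> A)"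
proof -
  have 1: "(p \<circ> q) x = p x" if "x \<in> E1" for x
    using that disj permutes_not_in[OF assms(2), of x] by (simp add: disjoint_iff)
  have 2: "(p \<circ> q) x = q x" if "x \<in> E2" for x
    using that disj permutes_not_in[OF assms(1), of "q x"] permutes_in_image[OF assms(2), of x]
    by (auto simp: disjoint_iff)
  show ?thesis
  proof
    assume *: "\<forall>x. (p \<circ> q) x \<in> A \<longleftrightarrow> x \<in> A"
    have "p x \<in> A \<longleftrightarrow> x \<in> A" for x
      using *[rule_format, of x] 1[of x] permutes_not_in[OF assms(1), of x] by (cases "x \<in> E1"; simp)
    moreover have "q x \<in> A \<longleftrightarrow> x \<in> A" for x
      using *[rule_format, of x] 2[of x] permutes_not_in[OF assms(2), of x] by (cases "x \<in> E2"; simp)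
    ultimately show "(\<forall>x. p x \<in> A \<longleftrightarrow> x \<in> A) \<and> (\<forall>x. q x \<in> A \<longleftrightarrow> x \<in> A)" by blast
  qed simp
qed

text \<open>Since \<open>\<sigma> r = s\<close> and \<open>\<alpha> b = r\<close>, a stable set
  contains all of \<open>r\<close>, \<open>s\<close>, \<open>b\<close> or none of them; each
  connected part then follows its root \<open>s\<close> or \<open>b\<close>.\<close>

lemma hypermap:
  assumes conn1: "hypermap E1 \<sigma>1 \<alpha>1" and conn2: "hypermap E2 \<sigma>2 \<alpha>2"
  shows "hypermap E \<sigma> \<alpha>"
proof (rule hypermapI[OF fin_E permutes])
  fix A assume A: "A \<subseteq> E" "A \<noteq> {}" and inv: "\<And>x. \<sigma> x \<in> A \<longleftrightarrow> x \<in> A" "\<And>x. \<alpha> x \<in> A \<longleftrightarrow> x \<in> A"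
  have "\<sigma> r = s" using comp_r[OF perm1(1) perm2(1)] by (simp add: \<sigma>_def)
  then have rs: "r \<in> A \<longleftrightarrow> s \<in> A" using inv(1) by metis
  have "\<alpha> b = r" using comp_r[OF perm1(2) perm2(2)] by (simp add: \<alpha>_def)
  then have rb: "r \<in> A \<longleftrightarrow> b \<in> A" using inv(2) by metis
  have "(\<sigma>1 \<circ> \<sigma>2) x \<in> A \<longleftrightarrow> x \<in> A" for x
    using inv(1)[of x] unfolding \<sigma>_def transpose_comp_stable[OF rs] .
  then have inv_\<sigma>: "\<sigma>1 x \<in> A \<longleftrightarrow> x \<in> A" "\<sigma>2 x \<in> A \<longleftrightarrow> x \<in> A" for x
    using stable_parts[OF perm1(1) perm2(1), of A] by blast+
  have "(\<alpha> \<circ> transpose r b) x \<in> A \<longleftrightarrow> x \<in> A" for x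
    using comp_transpose_stable[OF rb inv(2)] .
  then have "(\<alpha>1 \<circ> \<alpha>2) x \<in> A \<longleftrightarrow> x \<in> A" for x
    by (simp add: \<alpha>_def)
  then have inv_\<alpha>: "\<alpha>1 x \<in> A \<longleftrightarrow> x \<in> A" "\<alpha>2 x \<in> A \<longleftrightarrow> x \<in> A" for x
    using stable_parts[OF perm1(2) perm2(2), of A] by blast+
  have 1: "A \<inter> E1 = {} \<or> A \<inter> E1 = E1"
    using conn1 inv_\<sigma>(1) inv_\<alpha>(1) by (rule hypermap_stable)
  have 2: "A \<inter> E2 = {} \<or> A \<inter> E2 = E2"
    using conn2 inv_\<sigma>(2) inv_\<alpha>(2) by (rule hypermap_stable)
  have 3: "E1 = {} \<or> s \<in> E1" "E2 = {} \<or> b \<in> E2" using s b by (auto split: if_splits)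
  show "A = E"
  proof (cases "r \<in> A")
    case True
    then have "E1 \<subseteq> A" "E2 \<subseteq> A" using 1 2 3 rs rb by blast+
    then have "E \<subseteq> A" using True unfolding E_def by simp
    then show ?thesis using A(1) by (rule subset_antisym[rotated])
  next
    case False
    then have "A \<inter> E1 = {}" "A \<inter> E2 = {}" using 1 2 3 rs rb by blast+
    then have "A \<inter> E = {}" using False unfolding E_def by (simp add: Int_Un_distrib)
    then show ?thesis using A by (simp add: Int_absorb2)
  qed
qed

end

text \<open>\<open>b\<close> may be any edge of \<open>E'\<close>, so the new edge splits a face or
  joins two. Both cases are kept, because the Euler bound, which later excludes the second, has to
  be proved for maps of arbitrary genus.\<close>

locale loop =
  fixes E' :: "'a set" and \<sigma>' \<alpha>' :: "'a \<Rightarrow> 'a" and r s b :: 'a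
  assumes fin: "finite E'" and perm: "\<sigma>' permutes E'" "\<alpha>' permutes E'"
    and r: "r \<notin> E'" and s: "s \<in> E'" and b: "b \<in> E'"
begin

definition "E = insert r E'"
definition "\<sigma> = transpose r s \<circ> \<sigma>'"
definition "\<alpha> = \<alpha>' \<circ> transpose r b"

lemma fin_E: "finite E" and in_E: "r \<in> E" "s \<in> E" "b \<in> E"
  using fin s b by (auto simp: E_def split: if_splits)

lemma perm_E: "p permutes E' \<Longrightarrow> p permutes E"
  unfolding E_def by (rule permutes_subset) auto

lemma perm_r: "p permutes E' \<Longrightarrow> p r = r"
  using r by (simp add: permutes_not_in)

lemma orbit_r: "p permutes E' \<Longrightarrow> orbit p r = {r}"
  using perm_r by (simp add: orbit_eq_singleton_iff)

lemma neq: "s \<noteq> r" "b \<noteq> r" using r s b by auto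

lemma permutes: "\<sigma> permutes E" "\<alpha> permutes E"
  unfolding \<sigma>_def \<alpha>_def
  using permutes_transpose_comp[OF perm_E[OF perm(1)] in_E(1,2)]
    permutes_comp_transpose[OF perm_E[OF perm(2)] in_E(1,3)] .

lemma cyc_\<sigma>: "cyc \<sigma> E = cyc \<sigma>' E'"
  using cyc_transpose_merge[OF fin_E perm_E[OF perm(1)] in_E(1,2)] orbit_r[OF perm(1)] neq
    cyc_insert_fixpoint[OF fin perm(1) r]
  by (simp add: \<sigma>_def E_def)

lemma cyc_\<alpha>: "cyc \<alpha> E = cyc \<alpha>' E'"
  using cyc_comp_transpose_merge[OF fin_E perm_E[OF perm(2)] in_E(1,3)] orbit_r[OF perm(2)] neq
    cyc_insert_fixpoint[OF fin perm(2) r]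
  by (simp add: \<alpha>_def E_def)

abbreviation "\<phi>' \<equiv> \<sigma>' \<circ> \<alpha>'"
abbreviation "\<phi>'' \<equiv> \<phi>' \<circ> transpose r b"

lemma face_perm: "\<sigma> \<circ> \<alpha> = transpose r s \<circ> \<phi>''"
  by (simp add: \<sigma>_def \<alpha>_def comp_assoc)

lemma face_permutes: "\<phi>' permutes E'" "permutation \<phi>'" "\<phi>'' permutes E" "permutation \<phi>''"
proof -
  show 1: "\<phi>' permutes E'" using perm by (intro permutes_compose)
  show 2: "\<phi>'' permutes E" using perm_E[OF 1] in_E by (intro permutes_comp_transpose)
  show "permutation \<phi>'" "permutation \<phi>''" using 1 2 fin fin_E permutation_permutes by blast+
qed

lemma orbit_\<phi>''_r: "orbit \<phi>'' r = insert r (orbit \<phi>' b)"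
  unfolding orbit_comp_transpose_fixpoint[OF face_permutes(2) perm_r[OF face_permutes(1)] neq(2), of r]
  by simp

lemma cyc_\<phi>'': "cyc \<phi>'' E = cyc \<phi>' E'"
  using cyc_comp_transpose_merge[OF fin_E perm_E[OF face_permutes(1)] in_E(1,3)] orbit_r[OF face_permutes(1)] neq
    cyc_insert_fixpoint[OF fin face_permutes(1) r]
  by (simp add: E_def)

lemma cyc_face_split:
  assumes "b \<in> orbit \<phi>' s"
  shows "cyc (\<sigma> \<circ> \<alpha>) E = Suc (cyc (\<sigma>' \<circ> \<alpha>') E')"
proof -
  have "s \<in> orbit \<phi>'' r" using assms orbit_commute[OF face_permutes(2)] unfolding orbit_\<phi>''_r by blast
  then show ?thesis
    unfolding face_perm using cyc_transpose_split[OF fin_E face_permutes(3) in_E(1,2)] neq cyc_\<phi>'' by simp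
qed

text \<open>One edge more and one face less with the same vertices: Euler's characteristic drops by
  two, which means an additional handle.\<close>

lemma cyc_face_merge:
  assumes "b \<notin> orbit \<phi>' s"
  shows "Suc (cyc (\<sigma> \<circ> \<alpha>) E) = cyc (\<sigma>' \<circ> \<alpha>') E'"
proof -
  have "s \<notin> orbit \<phi>'' r" using neq assms orbit_commute[OF face_permutes(2)] unfolding orbit_\<phi>''_r by blast
  then show ?thesis
    unfolding face_perm using cyc_transpose_merge[OF fin_E face_permutes(3) in_E(1,2)] neq cyc_\<phi>'' by simp
qed

text \<open>Let the old face of \<open>s\<close> have \<open>n\<close> edges. The cycle of
  \<open>s\<close> under \<open>\<phi>''\<close> takes \<open>j\<close> steps to \<open>b\<close>,
  then goes to \<open>r\<close> and on through the rest of that face, so it has \<open>n + 1\<close>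
  elements. The last transposition cuts off the \<open>j + 1\<close> edges from \<open>s\<close> to
  \<open>b\<close>, and \<open>n - j\<close> stay with \<open>r\<close>.\<close>

lemma card_orbit_face:
  assumes j: "j < card (orbit \<phi>' s)" "b = (\<phi>' ^^ j) s"
  shows "card (orbit (\<sigma> \<circ> \<alpha>) r) = card (orbit \<phi>' s) - j"
proof -
  have self: "s \<in> orbit \<phi>' s" using face_permutes(2) by (rule permutation_self_in_orbit)
  define n where "n = funpow_dist1 \<phi>' s s"
  have inj: "inj_on (\<lambda>i. (\<phi>' ^^ i) s) {0..<n}" unfolding n_def by (rule inj_on_funpow_dist1[OF self])
  have orb: "orbit \<phi>' s = (\<lambda>i. (\<phi>' ^^ i) s) ` {0..<n}" unfolding n_def by (rule orbit_conv_funpow_dist1[OF self])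
  have n: "card (orbit \<phi>' s) = n" unfolding orb using inj by (simp add: card_image)
  have ne: "(\<phi>' ^^ i) s \<noteq> (\<phi>' ^^ k) s" if "i < n" "k < n" "i \<noteq> k" for i k
    using inj that by (auto dest: inj_onD)
  have b_orb: "b \<in> orbit \<phi>' s" unfolding j(2) by (rule funpow_in_orbit[OF self])
  have E': "(\<phi>' ^^ i) s \<in> E'" for i
    using permutes_orbit_subset[OF face_permutes(1) s] funpow_in_orbit[OF self, of i] by blast
  have step: "\<phi>'' ((\<phi>' ^^ i) s) = (\<phi>' ^^ Suc i) s" if "i < j" for i
  proof -
    have "(\<phi>' ^^ i) s \<noteq> b" unfolding j(2) using ne that j(1) n by simp
    moreover have "(\<phi>' ^^ i) s \<noteq> r" using E'[of i] r by auto
    ultimately show ?thesis by simp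
  qed
  have agree: "(\<phi>'' ^^ i) s = (\<phi>' ^^ i) s" if "i \<le> j" for i
    by (rule funpow_agree[OF step that])
  have last: "(\<phi>'' ^^ Suc j) s = r"
    using agree[of j] j(2) perm_r[OF face_permutes(1)] by simp
  have "orbit (\<sigma> \<circ> \<alpha>) s = (\<lambda>i. (\<phi>'' ^^ i) s) ` {..<Suc j}"
    unfolding face_perm
  proof (rule orbit_transpose_split[OF _ last])
    fix i assume i: "0 < i" "i < Suc j"
    then have "(\<phi>'' ^^ i) s = (\<phi>' ^^ i) s" by (intro agree) simp
    then show "(\<phi>'' ^^ i) s \<noteq> r \<and> (\<phi>'' ^^ i) s \<noteq> s"
      using E'[of i] r ne[of i 0] i j(1) n by auto
  qed simp
  also have "\<dots> = (\<lambda>i. (\<phi>' ^^ i) s) ` {..<Suc j}"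
    using agree by (intro image_cong) auto
  finally have "card (orbit (\<sigma> \<circ> \<alpha>) s) = Suc j"
    using inj_on_subset[OF inj, of "{..<Suc j}"] j(1) n by (auto simp: card_image subset_eq)
  moreover have perm_face: "permutation (\<sigma> \<circ> \<alpha>)"
    unfolding face_perm using face_permutes(4) by (rule permutation_transpose_comp)
  have "r \<notin> orbit (\<sigma> \<circ> \<alpha>) s"
    unfolding face_perm
  proof (rule orbit_transpose_notin[OF face_permutes(4)])
    show "r \<in> orbit \<phi>'' s" using last unfolding orbit_altdef by (intro CollectI exI[of _ "Suc j"]) auto
  qed (use neq in simp)
  then have sr: "s \<notin> orbit (\<sigma> \<circ> \<alpha>) r" using orbit_commute[OF perm_face] by metis
  \<comment> \<open>Undoing the transposition joins the two faces again, so the size of the face of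
    \<open>r\<close> is obtained as a difference.\<close>
  have "transpose r s \<circ> (\<sigma> \<circ> \<alpha>) = \<phi>''" unfolding face_perm by (simp add: comp_assoc[symmetric])
  then have union: "orbit \<phi>'' r = orbit (\<sigma> \<circ> \<alpha>) r \<union> orbit (\<sigma> \<circ> \<alpha>) s"
    using orbit_transpose_merge[OF perm_face sr, of r] permutation_self_in_orbit[OF perm_face] by simp
  have "orbit \<phi>' b = orbit \<phi>' s" using b_orb orbit_eq_iff[OF face_permutes(2)] by blast
  moreover have "r \<notin> orbit \<phi>' s" using permutes_orbit_subset[OF face_permutes(1) s] r by blast
  moreover have "finite (orbit \<phi>' s)" unfolding orb by simp
  ultimately have total: "card (orbit \<phi>'' r) = Suc n"
    unfolding orbit_\<phi>''_r using n by simp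
  have "orbit (\<sigma> \<circ> \<alpha>) r \<inter> orbit (\<sigma> \<circ> \<alpha>) s = {}"
    using sr orbit_eq_iff[OF perm_face] by blast
  moreover have "finite (orbit (\<sigma> \<circ> \<alpha>) x)" for x
    using permutation_self_in_orbit[OF perm_face] by (rule finite_orbit)
  ultimately have "card (orbit (\<sigma> \<circ> \<alpha>) r) + card (orbit (\<sigma> \<circ> \<alpha>) s) = Suc n"
    using total card_Un_disjoint unfolding union by metis
  with \<open>card (orbit (\<sigma> \<circ> \<alpha>) s) = Suc j\<close> show ?thesis using n by simp
qed

lemma hypermap:
  assumes conn: "hypermap E' \<sigma>' \<alpha>'"
  shows "hypermap E \<sigma> \<alpha>"
proof (rule hypermapI[OF fin_E permutes])
  fix A assume A: "A \<subseteq> E" "A \<noteq> {}" and inv: "\<And>x. \<sigma> x \<in> A \<longleftrightarrow> x \<in> A" "\<And>x. \<alpha> x \<in> A \<longleftrightarrow> x \<in> A"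
  have "\<sigma> r = s" using perm_r[OF perm(1)] by (simp add: \<sigma>_def)
  then have rs: "r \<in> A \<longleftrightarrow> s \<in> A" using inv(1) by metis
  have "\<alpha> b = r" using perm_r[OF perm(2)] by (simp add: \<alpha>_def)
  then have rb: "r \<in> A \<longleftrightarrow> b \<in> A" using inv(2) by metis
  have inv_\<sigma>: "\<sigma>' x \<in> A \<longleftrightarrow> x \<in> A" for x
    using inv(1)[of x] unfolding \<sigma>_def transpose_comp_stable[OF rs] .
  have "(\<alpha> \<circ> transpose r b) x \<in> A \<longleftrightarrow> x \<in> A" for x
    using comp_transpose_stable[OF rb inv(2)] .
  then have inv_\<alpha>: "\<alpha>' x \<in> A \<longleftrightarrow> x \<in> A" for x
    by (simp add: \<alpha>_def comp_assoc)
  have 1: "A \<inter> E' = {} \<or> A \<inter> E' = E'"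
    using conn inv_\<sigma> inv_\<alpha> by (rule hypermap_stable)
  from 1 show "A = E"
  proof
    assume "A \<inter> E' = {}"
    then have "r \<notin> A" using rs s by blast
    then have "A \<inter> E = {}" using \<open>A \<inter> E' = {}\<close> unfolding E_def by simp
    then show ?thesis using A by (simp add: Int_absorb2)
  next
    assume "A \<inter> E' = E'"
    then have "E' \<subseteq> A" "r \<in> A" using rs s by blast+
    then have "E \<subseteq> A" unfolding E_def by simp
    then show ?thesis using A(1) by (rule subset_antisym[rotated])
  qed
qed

lemma card_E: "card E = Suc (card E')"
  using r fin by (simp add: E_def)

end

section \<open>Deleting the root edge\<close>

text \<open>Numbers the elements of a cycle without repetition. Existence and uniqueness of the
  corner number stored in a \<open>Loop\<close> both rest on this.\<close>

lemma orbit_funpow_bij: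
  assumes "permutation p"
  shows "bij_betw (\<lambda>i. (p ^^ i) x) {..<card (orbit p x)} (orbit p x)"
proof -
  have self: "x \<in> orbit p x" using assms by (rule permutation_self_in_orbit)
  define n where "n = funpow_dist1 p x x"
  have inj: "inj_on (\<lambda>i. (p ^^ i) x) {..<n}"
    unfolding n_def lessThan_atLeast0 by (rule inj_on_funpow_dist1[OF self])
  have orb: "orbit p x = (\<lambda>i. (p ^^ i) x) ` {..<n}"
    unfolding n_def lessThan_atLeast0 by (rule orbit_conv_funpow_dist1[OF self])
  have n: "card (orbit p x) = n" unfolding orb using inj by (simp add: card_image)
  show ?thesis unfolding n unfolding bij_betw_def using inj orb by simp
qed

lemma perm_restrict_permutes:
  assumes p: "p permutes E" and S: "\<And>x. p x \<in> S \<longleftrightarrow> x \<in> S"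
  shows "perm_restrict p S permutes S"
proof (rule bij_imp_permutes)
  have "p ` S = S"
  proof
    show "p ` S \<subseteq> S" using S by auto
    show "S \<subseteq> p ` S"
    proof
      fix y assume y: "y \<in> S"
      have "p (inv p y) = y" using permutes_inverses(1)[OF p] .
      then show "y \<in> p ` S" using S[of "inv p y"] y by (metis imageI)
    qed
  qed
  then have "bij_betw p S S" using permutes_inj_on[OF p] by (simp add: bij_betw_def)
  then show "bij_betw (perm_restrict p S) S S"
    by (simp add: perm_restrict_def cong: bij_betw_cong)
qed (simp add: perm_restrict_def)

section \<open>Components under a pair of permutations\<close>

context
  fixes \<sigma> \<alpha> :: "'a \<Rightarrow> 'a"
begin

definition stable :: "'a set \<Rightarrow> bool" where
  "stable A \<longleftrightarrow> (\<forall>x. \<sigma> x \<in> A \<longleftrightarrow> x \<in> A) \<and> (\<forall>x. \<alpha> x \<in> A \<longleftrightarrow> x \<in> A)"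

definition component :: "'a \<Rightarrow> 'a set" where
  "component x = \<Inter>{A. x \<in> A \<and> stable A}"

lemma stable_Int: "stable A \<Longrightarrow> stable B \<Longrightarrow> stable (A \<inter> B)"
  and stable_Un: "stable A \<Longrightarrow> stable B \<Longrightarrow> stable (A \<union> B)"
  and stable_Compl: "stable A \<Longrightarrow> stable (- A)"
  by (simp_all add: stable_def)

lemma stable_component: "stable (component x)"
  by (auto simp: stable_def component_def)

lemma component_self: "x \<in> component x"
  by (auto simp: component_def)

lemma component_subset: "stable A \<Longrightarrow> x \<in> A \<Longrightarrow> component x \<subseteq> A"
  by (auto simp: component_def)

text \<open>Complements of stable sets are stable: if \<open>A\<close> missed \<open>x\<close>, the
  whole component would lie in \<open>- A\<close>.\<close>

lemma component_minimal:
  assumes "stable A" "A \<subseteq> component x" "A \<noteq> {}"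
  shows "A = component x"
proof (cases "x \<in> A")
  case True
  then show ?thesis using component_subset[OF assms(1)] assms(2) by blast
next
  case False
  then have "component x \<subseteq> - A" using component_subset[OF stable_Compl[OF assms(1)]] by simp
  then show ?thesis using assms(2,3) by blast
qed

end

lemma hypermap_component:
  assumes perm: "\<sigma> permutes E" "\<alpha> permutes E" and E: "finite E" "component \<sigma> \<alpha> x \<subseteq> E"
  shows "hypermap (component \<sigma> \<alpha> x) (perm_restrict \<sigma> (component \<sigma> \<alpha> x)) (perm_restrict \<alpha> (component \<sigma> \<alpha> x))"
proof -
  let ?C = "component \<sigma> \<alpha> x"
  have C: "\<sigma> y \<in> ?C \<longleftrightarrow> y \<in> ?C" "\<alpha> y \<in> ?C \<longleftrightarrow> y \<in> ?C" for y
    using stable_component[of \<sigma> \<alpha> x] unfolding stable_def by simp_all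
  show ?thesis
  proof (rule hypermapI)
    show "finite ?C" using E by (rule finite_subset[rotated])
    show "perm_restrict \<sigma> ?C permutes ?C" "perm_restrict \<alpha> ?C permutes ?C"
      using perm_restrict_permutes[OF perm(1) C(1)] perm_restrict_permutes[OF perm(2) C(2)] .
    fix A assume A: "A \<subseteq> ?C" "A \<noteq> {}"
      and st: "\<And>y. perm_restrict \<sigma> ?C y \<in> A \<longleftrightarrow> y \<in> A" "\<And>y. perm_restrict \<alpha> ?C y \<in> A \<longleftrightarrow> y \<in> A"
    have "\<sigma> y \<in> A \<longleftrightarrow> y \<in> A" "\<alpha> y \<in> A \<longleftrightarrow> y \<in> A" for y
      using st[of y] C[of y] A(1) by (auto simp: perm_restrict_def split: if_splits)
    then have "stable \<sigma> \<alpha> A" by (simp add: stable_def)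
    then show "A = ?C" using A by (rule component_minimal)
  qed
qed

text \<open>The two transpositions isolate \<open>r\<close>, and the rest is covered by the
  components of \<open>s\<close> and \<open>b\<close>. The cases distinguish whether both ends lie
  in one component of the rest.\<close>

lemma hypermap_delete_edge:
  assumes hyp: "hypermap E \<sigma> \<alpha>" and rE: "r \<in> E"
  obtains (Bridge) E1 E2 \<sigma>1 \<alpha>1 \<sigma>2 \<alpha>2 s b where
      "bridge E1 E2 \<sigma>1 \<alpha>1 \<sigma>2 \<alpha>2 r s b" "hypermap E1 \<sigma>1 \<alpha>1" "hypermap E2 \<sigma>2 \<alpha>2"
      "E = insert r (E1 \<union> E2)" "\<sigma> = transpose r s \<circ> (\<sigma>1 \<circ> \<sigma>2)" "\<alpha> = (\<alpha>1 \<circ> \<alpha>2) \<circ> transpose r b"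
  | (Loop) E' \<sigma>' \<alpha>' s b where
      "loop E' \<sigma>' \<alpha>' r s b" "hypermap E' \<sigma>' \<alpha>'"
      "E = insert r E'" "\<sigma> = transpose r s \<circ> \<sigma>'" "\<alpha> = \<alpha>' \<circ> transpose r b"
proof -
  note fin = hypermapD(1)[OF hyp] and perm = hypermapD(2,3)[OF hyp]
  \<comment> \<open>\<open>s\<close> follows \<open>r\<close> around its black vertex and
    \<open>b\<close> precedes \<open>r\<close> around its white vertex; either equals
    \<open>r\<close> if that vertex is a leaf.\<close>
  define s where "s = \<sigma> r"
  define b where "b = inv \<alpha> r"
  define \<sigma>' where "\<sigma>' = transpose r s \<circ> \<sigma>"
  define \<alpha>' where "\<alpha>' = \<alpha> \<circ> transpose r b"
  have \<sigma>: "\<sigma> = transpose r s \<circ> \<sigma>'" unfolding \<sigma>'_def by (simp add: comp_assoc[symmetric])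
  have \<alpha>: "\<alpha> = \<alpha>' \<circ> transpose r b" unfolding \<alpha>'_def by (simp add: comp_assoc)
  have \<alpha>b: "\<alpha> b = r" unfolding b_def using permutes_inverses(1)[OF perm(2)] .
  have sE: "s \<in> E" using rE permutes_in_image[OF perm(1)] by (simp add: s_def)
  have bE: "b \<in> E" using rE permutes_in_image[OF perm(2), of b] \<alpha>b by simp
  have "\<sigma>' permutes E" "\<alpha>' permutes E" unfolding \<sigma>'_def \<alpha>'_def
    using permutes_transpose_comp[OF perm(1) rE sE] permutes_comp_transpose[OF perm(2) rE bE] .
  moreover have fixr: "\<sigma>' r = r" "\<alpha>' r = r" by (simp_all add: \<sigma>'_def \<alpha>'_def s_def \<alpha>b)
  ultimately have perm': "\<sigma>' permutes E - {r}" "\<alpha>' permutes E - {r}"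
    by (auto intro: permutes_superset)
  let ?C = "component \<sigma>' \<alpha>'"
  have inj': "\<sigma>' y = r \<longleftrightarrow> y = r" "\<alpha>' y = r \<longleftrightarrow> y = r" for y
    using fixr permutes_inj[OF perm'(1)] permutes_inj[OF perm'(2)] by (metis injD)+
  have stE: "stable \<sigma>' \<alpha>' (E - {r})"
    using permutes_in_image[OF perm'(1)] permutes_in_image[OF perm'(2)] by (simp add: stable_def)
  have str: "stable \<sigma>' \<alpha>' {r}" using inj' by (simp add: stable_def)
  have C_r: "?C r = {r}" using component_subset[OF str] component_self[of r \<sigma>' \<alpha>'] by blast
  have C_sub: "?C x \<subseteq> E - {r}" if "x \<in> E" "x \<noteq> r" for x
    using component_subset[OF stE] that by simp
  \<comment> \<open>A set that is stable for the rest and contains \<open>r\<close>,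
    \<open>s\<close> and \<open>b\<close> is stable for the original pair too, so the connectedness
    of the original map applies.\<close>
  have whole: "A = E" if "stable \<sigma>' \<alpha>' A" "A \<subseteq> E" "r \<in> A" "s \<in> A" "b \<in> A" for A
  proof (rule hypermap_conn[OF hyp that(2)])
    show "A \<noteq> {}" using that by blast
    fix x
    show "\<sigma> x \<in> A \<longleftrightarrow> x \<in> A" unfolding \<sigma>
      using transpose_comp_stable[of r A s \<sigma>' x] that by (simp add: stable_def)
    show "\<alpha> x \<in> A \<longleftrightarrow> x \<in> A" unfolding \<alpha>
      by (rule comp_transpose_stable) (use that in \<open>simp_all add: stable_def\<close>)
  qed
  show thesis
  proof (cases "s \<noteq> r \<and> b \<noteq> r \<and> b \<in> ?C s")
    case True
    have "insert r (?C s) = E"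
    proof (rule whole)
      show "stable \<sigma>' \<alpha>' (insert r (?C s))"
        using stable_Un[OF str stable_component[of \<sigma>' \<alpha>' s]] by simp
      show "insert r (?C s) \<subseteq> E" using C_sub[OF sE] True rE by blast
    qed (use True component_self[of s \<sigma>' \<alpha>'] in simp_all)
    then have C: "?C s = E - {r}" using C_sub[OF sE] True by blast
    have "hypermap (E - {r}) \<sigma>' \<alpha>'"
      using hypermap_component[OF perm', of s] fin
      unfolding C perm_restrict_id[OF perm'(1)] perm_restrict_id[OF perm'(2)] by simp
    moreover have "loop (E - {r}) \<sigma>' \<alpha>' r s b"
      using fin perm' True sE bE by (simp add: loop_def)
    ultimately show thesis using Loop[of "E - {r}" \<sigma>' \<alpha>' s b] \<sigma> \<alpha> rE by auto
  next
    case False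
    \<comment> \<open>At a leaf end the component is \<open>{r}\<close>; removing \<open>r\<close>
      turns it into the empty part that \<open>bridge\<close> expects.\<close>
    define F where "F = (\<lambda>x. ?C x - {r})"
    have F_r: "F r = {}" using C_r by (simp add: F_def)
    have F_C: "F x = ?C x" if "x \<in> E" "x \<noteq> r" for x using C_sub[OF that] by (auto simp: F_def)
    have F_sub: "F x \<subseteq> E - {r}" if "x \<in> E" for x
      using that C_sub[of x] F_r by (cases "x = r") (auto simp: F_def)
    have F_hyp: "hypermap (F x) (perm_restrict \<sigma>' (F x)) (perm_restrict \<alpha>' (F x))" if "x \<in> E" for x
    proof (cases "x = r")
      case True
      then show ?thesis using F_r by (simp add: hypermap_def perm_restrict_def[abs_def] id_def[symmetric])
    next
      case False
      show ?thesis unfolding F_C[OF that False]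
        using hypermap_component[OF perm'] C_sub[OF that False] fin by simp
    qed
    have disj: "F s \<inter> F b = {}"
    proof (cases "s = r \<or> b = r")
      case True
      then show ?thesis using F_r by auto
    next
      case ne: False
      then have "b \<notin> ?C s" using False by simp
      then have "?C s \<inter> ?C b \<noteq> ?C b" using component_self[of b \<sigma>' \<alpha>'] by blast
      moreover have "stable \<sigma>' \<alpha>' (?C s \<inter> ?C b)" by (intro stable_Int stable_component)
      ultimately have "?C s \<inter> ?C b = {}" using component_minimal[of \<sigma>' \<alpha>' "?C s \<inter> ?C b" b] by blast
      then show ?thesis by (auto simp: F_def)
    qed
    have "?C s \<union> ?C b \<union> {r} = E"
    proof (rule whole)
      show "stable \<sigma>' \<alpha>' (?C s \<union> ?C b \<union> {r})" by (intro stable_Un stable_component str)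
      show "?C s \<union> ?C b \<union> {r} \<subseteq> E"
        using C_sub[OF sE] C_sub[OF bE] C_r rE by (cases "s = r"; cases "b = r") auto
    qed (use component_self[of s \<sigma>' \<alpha>'] component_self[of b \<sigma>' \<alpha>'] in simp_all)
    then have E: "E = insert r (F s \<union> F b)" and E': "F s \<union> F b = E - {r}" by (auto simp: F_def)
    let ?R = perm_restrict
    note hs = F_hyp[OF sE] and hb = F_hyp[OF bE]
    have br: "bridge (F s) (F b) (?R \<sigma>' (F s)) (?R \<alpha>' (F s)) (?R \<sigma>' (F b)) (?R \<alpha>' (F b)) r s b"
    proof
      show "if s = r then F s = {} else s \<in> F s" "if b = r then F b = {} else b \<in> F b"
        using F_r F_C[OF sE] F_C[OF bE] component_self[of s \<sigma>' \<alpha>'] component_self[of b \<sigma>' \<alpha>'] by auto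
      show "r \<notin> F s \<union> F b" by (simp add: F_def)
    qed (use disj hypermapD[OF hs] hypermapD[OF hb] in simp_all)
    have "?R \<sigma>' (F s) \<circ> ?R \<sigma>' (F b) = \<sigma>'"
      using perm_restrict_union[OF hypermapD(2)[OF hs] hypermapD(2)[OF hb] disj]
      unfolding E' perm_restrict_id[OF perm'(1)] .
    moreover have "?R \<alpha>' (F s) \<circ> ?R \<alpha>' (F b) = \<alpha>'"
      using perm_restrict_union[OF hypermapD(3)[OF hs] hypermapD(3)[OF hb] disj]
      unfolding E' perm_restrict_id[OF perm'(2)] .
    ultimately show thesis using Bridge[OF br hs hb E] \<sigma> \<alpha> by simp
  qed
qed

section \<open>The Euler inequality\<close>

lemma bridge_edges:
  assumes "bridge E1 E2 \<sigma>1 \<alpha>1 \<sigma>2 \<alpha>2 r s b"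
  shows "s = r \<longleftrightarrow> E1 = {}" "b = r \<longleftrightarrow> E2 = {}"
  using bridge.s[OF assms] bridge.b[OF assms] by (auto split: if_splits)

lemma cyc_empty [simp]: "cyc p {} = 0"
  by (simp add: cyc_def)

text \<open>The genus is not negative. This is what makes both parts planar when a bridge is deleted from a
  planar map, and what rules out that a planar map stays connected when its faces at \<open>r\<close> agree.\<close>

lemma euler_le:
  assumes "hypermap E \<sigma> \<alpha>" "E \<noteq> {}"
  shows "cyc \<sigma> E + cyc \<alpha> E + cyc (\<sigma> \<circ> \<alpha>) E \<le> card E + 2"
  using assms
proof (induction "card E" arbitrary: E \<sigma> \<alpha> rule: less_induct)
  case less
  obtain r where r: "r \<in> E" using less.prems by blast
  show ?case using less.prems(1) r
  proof (cases rule: hypermap_delete_edge)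
    case (Bridge E1 E2 \<sigma>1 \<alpha>1 \<sigma>2 \<alpha>2 s b)
    interpret bridge E1 E2 \<sigma>1 \<alpha>1 \<sigma>2 \<alpha>2 r s b by fact
    note eqs = Bridge(4-6)[folded E_def \<sigma>_def \<alpha>_def]
    have le: "card E1 < card E" "card E2 < card E" using card_E unfolding eqs by simp_all
    \<comment> \<open>An empty part has no cycles at all and contributes 0 instead of 2.\<close>
    have 1: "cyc \<sigma>1 E1 + cyc \<alpha>1 E1 + cyc (\<sigma>1 \<circ> \<alpha>1) E1 \<le> card E1 + (if s = r then 0 else 2)"
      using less.hyps[OF _ Bridge(2)] le bridge_edges(1)[OF Bridge(1)] unfolding eqs by (cases "s = r") simp_all
    have 2: "cyc \<sigma>2 E2 + cyc \<alpha>2 E2 + cyc (\<sigma>2 \<circ> \<alpha>2) E2 \<le> card E2 + (if b = r then 0 else 2)"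
      using less.hyps[OF _ Bridge(3)] le bridge_edges(2)[OF Bridge(1)] unfolding eqs by (cases "b = r") simp_all
    show ?thesis unfolding eqs using 1 2 cyc_\<sigma> cyc_\<alpha> cyc_face card_E by (simp split: if_splits)
  next
    case (Loop E' \<sigma>' \<alpha>' s b)
    interpret loop E' \<sigma>' \<alpha>' r s b by fact
    note eqs = Loop(3-5)[folded E_def \<sigma>_def \<alpha>_def]
    have "cyc \<sigma>' E' + cyc \<alpha>' E' + cyc (\<sigma>' \<circ> \<alpha>') E' \<le> card E' + 2"
      using less.hyps[OF _ Loop(2)] card_E s unfolding eqs by fastforce
    \<comment> \<open>The vertices do not change. A split face balances the new edge; merged faces
      leave a slack of 2.\<close>
    then show ?thesis unfolding eqs using cyc_\<sigma> cyc_\<alpha> card_E cyc_face_split cyc_face_merge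
      by (cases "b \<in> orbit \<phi>' s") simp_all
  qed
qed

section \<open>Decomposition trees and the hypermaps they represent\<close>

datatype dtree = Leaf | Bridge dtree dtree | Loop dtree nat

fun nedges :: "dtree \<Rightarrow> nat" where
  "nedges Leaf = 0"
| "nedges (Bridge T1 T2) = Suc (nedges T1 + nedges T2)"
| "nedges (Loop T j) = Suc (nedges T)"

text \<open>\<open>deg T\<close> is the outer half-degree. A tree \<open>Loop T j\<close> is meaningful only for \<open>j < deg T\<close>; the other
  end of the new edge then is the \<open>j\<close>-th corner of the outer face.\<close>

fun deg :: "dtree \<Rightarrow> nat" where
  "deg Leaf = 0"
| "deg (Bridge T1 T2) = Suc (deg T1 + deg T2)"
| "deg (Loop T j) = deg T - j"

fun valid :: "dtree \<Rightarrow> bool" where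
  "valid Leaf \<longleftrightarrow> True"
| "valid (Bridge T1 T2) \<longleftrightarrow> valid T1 \<and> valid T2"
| "valid (Loop T j) \<longleftrightarrow> valid T \<and> j < deg T"

text \<open>In the following counts \<open>Leaf\<close> is the empty hypermap, without vertices and faces. A new black vertex
  arises when the new edge is attached to \<open>Leaf\<close> on its black side, and similarly for white.\<close>

fun nblack :: "dtree \<Rightarrow> nat" where
  "nblack Leaf = 0"
| "nblack (Bridge T1 T2) = nblack T1 + nblack T2 + (if T1 = Leaf then 1 else 0)"
| "nblack (Loop T j) = nblack T"

fun nwhite :: "dtree \<Rightarrow> nat" where
  "nwhite Leaf = 0"
| "nwhite (Bridge T1 T2) = nwhite T1 + nwhite T2 + (if T2 = Leaf then 1 else 0)"
| "nwhite (Loop T j) = nwhite T"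

fun nloops :: "dtree \<Rightarrow> nat" where
  "nloops Leaf = 0"
| "nloops (Bridge T1 T2) = nloops T1 + nloops T2"
| "nloops (Loop T j) = Suc (nloops T)"

text \<open>A relation rather than a function, since a map comes with arbitrary labels. The first
  part of a \<open>Bridge\<close> hangs at the black end of the root edge, the second at the white
  end. \<open>rep_Leaf\<close> accepts any root, so the premises on \<open>Leaf\<close> pin
  \<open>s\<close> or \<open>b\<close> to \<open>r\<close>, which makes the transposition
  trivial.\<close>

inductive rep :: "dtree \<Rightarrow> 'a set \<Rightarrow> ('a \<Rightarrow> 'a) \<Rightarrow> ('a \<Rightarrow> 'a) \<Rightarrow> 'a \<Rightarrow> bool" where
  rep_Leaf: "rep Leaf {} id id r"
| rep_Bridge: "rep T1 E1 \<sigma>1 \<alpha>1 s \<Longrightarrow> rep T2 E2 \<sigma>2 \<alpha>2 b \<Longrightarrow> (T1 = Leaf \<Longrightarrow> s = r) \<Longrightarrow> (T2 = Leaf \<Longrightarrow> b = r) \<Longrightarrow>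
    E1 \<inter> E2 = {} \<Longrightarrow> r \<notin> E1 \<union> E2 \<Longrightarrow>
    rep (Bridge T1 T2) (insert r (E1 \<union> E2)) (transpose r s \<circ> (\<sigma>1 \<circ> \<sigma>2)) ((\<alpha>1 \<circ> \<alpha>2) \<circ> transpose r b) r"
| rep_Loop: "rep T E \<sigma> \<alpha> s \<Longrightarrow> j < deg T \<Longrightarrow> r \<notin> E \<Longrightarrow> b = ((\<sigma> \<circ> \<alpha>) ^^ j) s \<Longrightarrow>
    rep (Loop T j) (insert r E) (transpose r s \<circ> \<sigma>) (\<alpha> \<circ> transpose r b) r"

text \<open>The clause on \<open>deg\<close> makes \<open>j < deg T\<close> point at a corner of the
  outer face. Only a \<open>Loop\<close> creates a face, so \<open>nloops\<close> counts the faces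
  besides the outer one, and the last conjunct is Euler's relation: every represented hypermap is
  planar.\<close>

lemma rep_sound:
  assumes "rep T F \<tau> \<beta> q"
  shows "hypermap F \<tau> \<beta> \<and> valid T \<and> card F = nedges T \<and> (T = Leaf \<longleftrightarrow> F = {}) \<and>
    (T \<noteq> Leaf \<longrightarrow> q \<in> F \<and> card (orbit (\<tau> \<circ> \<beta>) q) = deg T) \<and>
    cyc \<tau> F = nblack T \<and> cyc \<beta> F = nwhite T \<and> cyc (\<tau> \<circ> \<beta>) F = (if T = Leaf then 0 else Suc (nloops T)) \<and>
    nblack T + nwhite T + (if T = Leaf then 0 else Suc (nloops T)) = nedges T + (if T = Leaf then 0 else 2)"
  using assms
proof induction
  case (rep_Leaf r)
  then show ?case by (simp add: hypermap_def id_def)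
next
  case (rep_Bridge T1 E1 \<sigma>1 \<alpha>1 s T2 E2 \<sigma>2 \<alpha>2 b r)
  note IH = rep_Bridge.IH
  interpret bridge E1 E2 \<sigma>1 \<alpha>1 \<sigma>2 \<alpha>2 r s b
    using rep_Bridge hypermapD[of E1 \<sigma>1 \<alpha>1] hypermapD[of E2 \<sigma>2 \<alpha>2] by unfold_locales auto
  have T: "T1 = Leaf \<longleftrightarrow> s = r" "T2 = Leaf \<longleftrightarrow> b = r" using IH rep_Bridge.hyps by blast+
  have 1: "hypermap E1 \<sigma>1 \<alpha>1" "valid T1" "card E1 = nedges T1" "cyc \<sigma>1 E1 = nblack T1" "cyc \<alpha>1 E1 = nwhite T1"
    "cyc (\<sigma>1 \<circ> \<alpha>1) E1 = (if s = r then 0 else Suc (nloops T1))" "s = r \<Longrightarrow> nloops T1 = 0"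
    "(if s = r then 0 else card (orbit (\<sigma>1 \<circ> \<alpha>1) s)) = deg T1"
    "nblack T1 + nwhite T1 + (if s = r then 0 else Suc (nloops T1)) = nedges T1 + (if s = r then 0 else 2)"
    using IH(1) by (auto simp: comp_def T(1)[symmetric])
  have 2: "hypermap E2 \<sigma>2 \<alpha>2" "valid T2" "card E2 = nedges T2" "cyc \<sigma>2 E2 = nblack T2" "cyc \<alpha>2 E2 = nwhite T2"
    "cyc (\<sigma>2 \<circ> \<alpha>2) E2 = (if b = r then 0 else Suc (nloops T2))" "b = r \<Longrightarrow> nloops T2 = 0"
    "(if b = r then 0 else card (orbit (\<sigma>2 \<circ> \<alpha>2) b)) = deg T2"
    "nblack T2 + nwhite T2 + (if b = r then 0 else Suc (nloops T2)) = nedges T2 + (if b = r then 0 else 2)"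
    using IH(2) by (auto simp: comp_def T(2)[symmetric])
  have b: "nblack (dtree.Bridge T1 T2) = cyc \<sigma> E" "nwhite (dtree.Bridge T1 T2) = cyc \<alpha> E"
    using cyc_\<sigma> cyc_\<alpha> 1(4,5) 2(4,5) T by (simp_all split: if_splits)
  have f: "cyc (\<sigma> \<circ> \<alpha>) E = Suc (nloops T1 + nloops T2)"
    using cyc_face 1(6,7) 2(6,7) by (simp split: if_splits)
  have "nblack (dtree.Bridge T1 T2) + nwhite (dtree.Bridge T1 T2) + Suc (nloops T1 + nloops T2) = nedges T1 + nedges T2 + 3"
    using 1(7,9) 2(7,9) T by (simp split: if_splits)
  then show ?case unfolding E_def[symmetric] \<sigma>_def[symmetric] \<alpha>_def[symmetric]
    using hypermap[OF 1(1) 2(1)] 1(2,3) 2(2,3) b f card_orbit_face[unfolded 1(8) 2(8)] card_E in_E(1)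
    by (auto simp add: comp_def simp del: nblack.simps nwhite.simps)
next
  case (rep_Loop T E' \<sigma>' \<alpha>' s j r b)
  note IH = rep_Loop.IH
  have T: "T \<noteq> Leaf" using rep_Loop.hyps by auto
  have h: "hypermap E' \<sigma>' \<alpha>'" using IH by blast
  have s: "s \<in> E'" and deg: "card (orbit (\<sigma>' \<circ> \<alpha>') s) = deg T" using IH T by blast+
  have \<phi>': "(\<sigma>' \<circ> \<alpha>') permutes E'" using hypermapD[OF h] by (simp add: permutes_compose)
  \<comment> \<open>A power of the face permutation stays on the face of \<open>s\<close>, so this
    insertion splits a face.\<close>
  have b_orb: "b \<in> orbit (\<sigma>' \<circ> \<alpha>') s"
    unfolding rep_Loop.hyps(4) using funpow_in_orbit permutation_self_in_orbit \<phi>' hypermapD(1)[OF h] permutation_permutes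
    by metis
  interpret loop E' \<sigma>' \<alpha>' r s b
    using hypermapD[OF h] rep_Loop.hyps s b_orb permutes_orbit_subset[OF \<phi>' s] by unfold_locales auto
  have 1: "cyc \<sigma>' E' = nblack T" "cyc \<alpha>' E' = nwhite T" "cyc (\<sigma>' \<circ> \<alpha>') E' = Suc (nloops T)"
    "nblack T + nwhite T + Suc (nloops T) = nedges T + 2" "valid T" "card E' = nedges T"
    using IH T by (auto simp: comp_def)
  have 2: "card (orbit (\<sigma> \<circ> \<alpha>) r) = deg T - j" "cyc (\<sigma> \<circ> \<alpha>) E = Suc (Suc (nloops T))"
    using card_orbit_face rep_Loop.hyps deg cyc_face_split[OF b_orb] 1(3) by simp_all
  then show ?case unfolding E_def[symmetric] \<sigma>_def[symmetric] \<alpha>_def[symmetric]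
    using hypermap[OF h] 1 rep_Loop.hyps(2) T cyc_\<sigma> cyc_\<alpha> card_E in_E(1) by (auto simp: comp_def)
qed

text \<open>For a bridge, the Euler sum of neither part exceeds its bound while their total reaches
  it, so both parts are planar. For any other root edge, planarity forces both ends onto one face of
  the rest, which supplies the number \<open>j\<close>.\<close>

lemma rep_complete:
  assumes "hypermap E \<sigma> \<alpha>"
    and "E = {} \<or> r \<in> E \<and> cyc \<sigma> E + cyc \<alpha> E + cyc (\<sigma> \<circ> \<alpha>) E = card E + 2"
  shows "\<exists>T. rep T E \<sigma> \<alpha> r"
  using assms
proof (induction "card E" arbitrary: E \<sigma> \<alpha> r rule: less_induct)
  case less
  show ?case
  proof (cases "E = {}")
    case True
    then have "\<sigma> = id" "\<alpha> = id" using hypermapD(2,3)[OF less.prems(1)] by simp_all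
    then show ?thesis using True rep_Leaf[of r] by auto
  next
    case False
    then have r: "r \<in> E" and euler: "cyc \<sigma> E + cyc \<alpha> E + cyc (\<sigma> \<circ> \<alpha>) E = card E + 2"
      using less.prems(2) by auto
    show ?thesis using less.prems(1) r
    proof (cases rule: hypermap_delete_edge)
      case (Bridge E1 E2 \<sigma>1 \<alpha>1 \<sigma>2 \<alpha>2 s b)
      interpret bridge E1 E2 \<sigma>1 \<alpha>1 \<sigma>2 \<alpha>2 r s b by fact
      note eqs = Bridge(4-6)[folded E_def \<sigma>_def \<alpha>_def]
      note emp = bridge_edges[OF Bridge(1)]
      have le: "card E1 < card E" "card E2 < card E" using card_E unfolding eqs by simp_all
      have 1: "cyc \<sigma>1 E1 + cyc \<alpha>1 E1 + cyc (\<sigma>1 \<circ> \<alpha>1) E1 \<le> card E1 + (if s = r then 0 else 2)"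
        using euler_le[OF Bridge(2)] emp(1) by (cases "s = r") simp_all
      have 2: "cyc \<sigma>2 E2 + cyc \<alpha>2 E2 + cyc (\<sigma>2 \<circ> \<alpha>2) E2 \<le> card E2 + (if b = r then 0 else 2)"
        using euler_le[OF Bridge(3)] emp(2) by (cases "b = r") simp_all
      have 3: "cyc \<sigma>1 E1 + cyc \<alpha>1 E1 + cyc (\<sigma>1 \<circ> \<alpha>1) E1 = card E1 + (if s = r then 0 else 2)"
        using 1 2 euler cyc_\<sigma> cyc_\<alpha> cyc_face card_E unfolding eqs by (simp split: if_splits)
      have 4: "cyc \<sigma>2 E2 + cyc \<alpha>2 E2 + cyc (\<sigma>2 \<circ> \<alpha>2) E2 = card E2 + (if b = r then 0 else 2)"
        using 1 2 euler cyc_\<sigma> cyc_\<alpha> cyc_face card_E unfolding eqs by (simp split: if_splits)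
      obtain T1 where T1: "rep T1 E1 \<sigma>1 \<alpha>1 s"
        using less.hyps[OF le(1) Bridge(2), of s] 3 emp(1) s by (auto split: if_splits)
      obtain T2 where T2: "rep T2 E2 \<sigma>2 \<alpha>2 b"
        using less.hyps[OF le(2) Bridge(3), of b] 4 emp(2) b by (auto split: if_splits)
      have "rep (dtree.Bridge T1 T2) E \<sigma> \<alpha> r" unfolding Bridge(4-6)
        using T1 T2 rep_sound[OF T1] rep_sound[OF T2] emp disj bridge.r[OF Bridge(1)]
        by (intro rep_Bridge) simp_all
      then show ?thesis ..
    next
      case (Loop E' \<sigma>' \<alpha>' s b)
      interpret loop E' \<sigma>' \<alpha>' r s b by fact
      note eqs = Loop(3-5)[folded E_def \<sigma>_def \<alpha>_def]
      have ne: "E' \<noteq> {}" using s by auto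
      have le: "cyc \<sigma>' E' + cyc \<alpha>' E' + cyc (\<sigma>' \<circ> \<alpha>') E' \<le> card E' + 2"
        using euler_le[OF Loop(2) ne] .
      \<comment> \<open>Otherwise two faces merge at \<open>r\<close>, and the rest would exceed the
        Euler bound by 2.\<close>
      have b_orb: "b \<in> orbit (\<sigma>' \<circ> \<alpha>') s"
      proof (rule ccontr)
        assume "b \<notin> orbit (\<sigma>' \<circ> \<alpha>') s"
        then show False using cyc_face_merge le euler cyc_\<sigma> cyc_\<alpha> card_E unfolding eqs by simp
      qed
      then obtain T where T: "rep T E' \<sigma>' \<alpha>' s"
        using less.hyps[OF _ Loop(2), of s] card_E cyc_face_split euler cyc_\<sigma> cyc_\<alpha> s unfolding eqs by auto
      have deg: "deg T = card (orbit (\<sigma>' \<circ> \<alpha>') s)" using rep_sound[OF T] ne by auto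
      obtain j where "j < deg T" "b = ((\<sigma>' \<circ> \<alpha>') ^^ j) s"
        using b_orb orbit_funpow_bij[OF face_permutes(2), of s] unfolding deg bij_betw_def by blast
      then have "rep (dtree.Loop T j) E \<sigma> \<alpha> r" unfolding Loop(3-5)
        using T loop.r[OF Loop(1)] by (intro rep_Loop)
      then show ?thesis ..
    qed
  qed
qed

section \<open>The tree determines the hypermap up to isomorphism\<close>

context bridge
begin

lemma comp_in_E1:
  assumes "p permutes E1" "q permutes E2"
  shows "(p \<circ> q) x \<in> E1 \<longleftrightarrow> x \<in> E1" "(p \<circ> q) x \<in> E2 \<longleftrightarrow> x \<in> E2"
proof -
  have *: "p x \<in> E1 \<longleftrightarrow> x \<in> E1" "q x \<in> E2 \<longleftrightarrow> x \<in> E2" for x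
    using permutes_in_image[OF assms(1)] permutes_in_image[OF assms(2)] by simp_all
  have "q x \<in> E1 \<longleftrightarrow> x \<in> E1" for x
    using *(2)[of x] permutes_not_in[OF assms(2), of x] disj by (cases "x \<in> E2") auto
  moreover have "p x \<in> E2 \<longleftrightarrow> x \<in> E2" for x
    using *(1)[of x] permutes_not_in[OF assms(1), of x] disj by (cases "x \<in> E1") auto
  ultimately show "(p \<circ> q) x \<in> E1 \<longleftrightarrow> x \<in> E1" "(p \<circ> q) x \<in> E2 \<longleftrightarrow> x \<in> E2"
    using * by simp_all
qed

lemma comp_restrict:
  assumes "p permutes E1" "q permutes E2"
  shows "perm_restrict (p \<circ> q) E1 = p" "perm_restrict (p \<circ> q) E2 = q"
proof -
  show "perm_restrict (p \<circ> q) E1 = p"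
  proof
    fix x show "perm_restrict (p \<circ> q) E1 x = p x"
      using permutes_not_in[OF assms(1), of x] permutes_not_in[OF assms(2), of x] disj
      by (cases "x \<in> E1") (auto simp: perm_restrict_def disjoint_iff)
  qed
  show "perm_restrict (p \<circ> q) E2 = q"
  proof
    fix x show "perm_restrict (p \<circ> q) E2 x = q x"
      using permutes_not_in[OF assms(1), of "q x"] permutes_not_in[OF assms(2), of x]
        permutes_in_image[OF assms(2), of x] disj
      by (cases "x \<in> E2") (auto simp: perm_restrict_def disjoint_iff)
  qed
qed

lemma root: "\<sigma> r = s" "\<alpha> b = r"
  using comp_r[OF perm1(1) perm2(1)] comp_r[OF perm1(2) perm2(2)] by (simp_all add: \<sigma>_def \<alpha>_def)

end

lemma (in loop) root: "\<sigma> r = s" "\<alpha> b = r"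
  using perm_r[OF perm(1)] perm_r[OF perm(2)] by (simp_all add: \<sigma>_def \<alpha>_def)

lemma rep_Leaf_iff: "rep Leaf E \<sigma> \<alpha> r \<longleftrightarrow> E = {} \<and> \<sigma> = id \<and> \<alpha> = id"
  by (auto elim: rep.cases intro: rep_Leaf)

lemma rep_BridgeE:
  assumes "rep (dtree.Bridge T1 T2) E \<sigma> \<alpha> r"
  obtains E1 \<sigma>1 \<alpha>1 s E2 \<sigma>2 \<alpha>2 b where "rep T1 E1 \<sigma>1 \<alpha>1 s" "rep T2 E2 \<sigma>2 \<alpha>2 b"
    "T1 = Leaf \<longleftrightarrow> s = r" "T2 = Leaf \<longleftrightarrow> b = r"
    "bridge E1 E2 \<sigma>1 \<alpha>1 \<sigma>2 \<alpha>2 r s b" "hypermap E1 \<sigma>1 \<alpha>1" "hypermap E2 \<sigma>2 \<alpha>2"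
    "E = insert r (E1 \<union> E2)" "\<sigma> = transpose r s \<circ> (\<sigma>1 \<circ> \<sigma>2)" "\<alpha> = (\<alpha>1 \<circ> \<alpha>2) \<circ> transpose r b"
  using assms
proof (cases rule: rep.cases)
  case (rep_Bridge E1 \<sigma>1 \<alpha>1 s E2 \<sigma>2 \<alpha>2 b)
  note h1 = rep_sound[OF rep_Bridge(4)] and h2 = rep_sound[OF rep_Bridge(5)]
  have T: "T1 = Leaf \<longleftrightarrow> s = r" "T2 = Leaf \<longleftrightarrow> b = r" using h1 h2 rep_Bridge(6-) by auto
  have "bridge E1 E2 \<sigma>1 \<alpha>1 \<sigma>2 \<alpha>2 r s b"
    using h1 h2 rep_Bridge(6-) hypermapD[of E1 \<sigma>1 \<alpha>1] hypermapD[of E2 \<sigma>2 \<alpha>2] by unfold_locales auto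
  then show thesis using that rep_Bridge h1 h2 T by blast
qed

lemma rep_LoopE:
  assumes "rep (dtree.Loop T j) E \<sigma> \<alpha> r"
  obtains E' \<sigma>' \<alpha>' s b where "rep T E' \<sigma>' \<alpha>' s" "j < deg T" "b = ((\<sigma>' \<circ> \<alpha>') ^^ j) s"
    "loop E' \<sigma>' \<alpha>' r s b" "hypermap E' \<sigma>' \<alpha>'" "card (orbit (\<sigma>' \<circ> \<alpha>') s) = deg T"
    "E = insert r E'" "\<sigma> = transpose r s \<circ> \<sigma>'" "\<alpha> = \<alpha>' \<circ> transpose r b"
  using assms
proof (cases rule: rep.cases)
  case (rep_Loop E' \<sigma>' \<alpha>' s b)
  have T: "T \<noteq> Leaf" using rep_Loop(5) by auto
  have h: "hypermap E' \<sigma>' \<alpha>'" and s: "s \<in> E'" and d: "card (orbit (\<sigma>' \<circ> \<alpha>') s) = deg T"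
    using rep_sound[OF rep_Loop(4)] T by auto
  have \<phi>': "(\<sigma>' \<circ> \<alpha>') permutes E'" using hypermapD[OF h] by (simp add: permutes_compose)
  have "b \<in> orbit (\<sigma>' \<circ> \<alpha>') s"
    unfolding rep_Loop(7) using funpow_in_orbit permutation_self_in_orbit \<phi>' hypermapD(1)[OF h] permutation_permutes
    by metis
  then have "loop E' \<sigma>' \<alpha>' r s b"
    using hypermapD[OF h] rep_Loop s permutes_orbit_subset[OF \<phi>' s] by unfold_locales auto
  then show thesis using that rep_Loop h d by blast
qed

text \<open>Both decompositions read off the same \<open>s\<close> and \<open>b\<close> and cancel
  to the same rest. In the first, \<open>E1\<close> is a stable set separating \<open>s\<close> from
  \<open>b\<close>; in the second, the rest is connected.\<close>

lemma bridge_not_loop: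
  assumes br: "bridge E1 E2 \<sigma>1 \<alpha>1 \<sigma>2 \<alpha>2 r s b"
    and lp: "loop E' \<sigma>' \<alpha>' r s' b'" "hypermap E' \<sigma>' \<alpha>'"
    and E: "insert r (E1 \<union> E2) = insert r E'"
    and \<sigma>: "transpose r s \<circ> (\<sigma>1 \<circ> \<sigma>2) = transpose r s' \<circ> \<sigma>'"
    and \<alpha>: "(\<alpha>1 \<circ> \<alpha>2) \<circ> transpose r b = \<alpha>' \<circ> transpose r b'"
  shows False
proof -
  interpret B: bridge E1 E2 \<sigma>1 \<alpha>1 \<sigma>2 \<alpha>2 r s b by fact
  interpret L: loop E' \<sigma>' \<alpha>' r s' b' by fact
  have \<sigma>': "B.\<sigma> = L.\<sigma>" and \<alpha>': "B.\<alpha> = L.\<alpha>"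
    unfolding B.\<sigma>_def B.\<alpha>_def L.\<sigma>_def L.\<alpha>_def using \<sigma> \<alpha> by simp_all
  have s: "s = s'" using B.root(1) L.root(1) unfolding \<sigma>' by simp
  have b: "b = b'" using B.root(2) L.root(2) permutes_inj[OF L.permutes(2)] unfolding \<alpha>' by (metis injD)
  have \<sigma>0: "\<sigma>1 \<circ> \<sigma>2 = \<sigma>'" using \<sigma> unfolding s by (metis comp_assoc id_comp transpose_comp_involutory)
  have \<alpha>0: "\<alpha>1 \<circ> \<alpha>2 = \<alpha>'" using \<alpha> unfolding b by (metis comp_assoc comp_id transpose_comp_involutory)
  have s1: "s \<in> E1" and b2: "b \<in> E2" using B.s B.b L.neq s b by (simp_all split: if_splits)
  have "E1 \<inter> E' = {} \<or> E1 \<inter> E' = E'"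
    using lp(2) B.comp_in_E1(1)[OF B.perm1(1) B.perm2(1), unfolded \<sigma>0]
      B.comp_in_E1(1)[OF B.perm1(2) B.perm2(2), unfolded \<alpha>0] by (rule hypermap_stable)
  then show False using s1 b2 L.s L.b s b B.disj by blast
qed

text \<open>The ends are determined by \<open>\<sigma> r = s\<close> and
  \<open>\<alpha> b = r\<close>, so the transpositions cancel. Each part is stable for the other
  decomposition and shares \<open>s\<close> or \<open>b\<close> with its counterpart, hence equals
  it by connectedness.\<close>

lemma bridge_unique:
  assumes br: "bridge E1 E2 \<sigma>1 \<alpha>1 \<sigma>2 \<alpha>2 r s b" "hypermap E1 \<sigma>1 \<alpha>1" "hypermap E2 \<sigma>2 \<alpha>2"
    and br': "bridge E1' E2' \<sigma>1' \<alpha>1' \<sigma>2' \<alpha>2' r s' b'" "hypermap E1' \<sigma>1' \<alpha>1'" "hypermap E2' \<sigma>2' \<alpha>2'"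
    and \<sigma>: "transpose r s \<circ> (\<sigma>1 \<circ> \<sigma>2) = transpose r s' \<circ> (\<sigma>1' \<circ> \<sigma>2')"
    and \<alpha>: "(\<alpha>1 \<circ> \<alpha>2) \<circ> transpose r b = (\<alpha>1' \<circ> \<alpha>2') \<circ> transpose r b'"
  shows "s = s' \<and> b = b' \<and> E1 = E1' \<and> E2 = E2' \<and> \<sigma>1 = \<sigma>1' \<and> \<sigma>2 = \<sigma>2' \<and> \<alpha>1 = \<alpha>1' \<and> \<alpha>2 = \<alpha>2'"
proof -
  interpret B: bridge E1 E2 \<sigma>1 \<alpha>1 \<sigma>2 \<alpha>2 r s b by fact
  interpret B': bridge E1' E2' \<sigma>1' \<alpha>1' \<sigma>2' \<alpha>2' r s' b' by fact
  have \<sigma>': "B.\<sigma> = B'.\<sigma>" and \<alpha>': "B.\<alpha> = B'.\<alpha>"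
    unfolding B.\<sigma>_def B.\<alpha>_def B'.\<sigma>_def B'.\<alpha>_def using \<sigma> \<alpha> by simp_all
  have s: "s = s'" using B.root(1) B'.root(1) unfolding \<sigma>' by simp
  have b: "b = b'" using B.root(2) B'.root(2) permutes_inj[OF B'.permutes(2)] unfolding \<alpha>' by (metis injD)
  have \<sigma>0: "\<sigma>1 \<circ> \<sigma>2 = \<sigma>1' \<circ> \<sigma>2'" using \<sigma> unfolding s by (metis comp_assoc id_comp transpose_comp_involutory)
  have \<alpha>0: "\<alpha>1 \<circ> \<alpha>2 = \<alpha>1' \<circ> \<alpha>2'" using \<alpha> unfolding b by (metis comp_assoc comp_id transpose_comp_involutory)
  note st = B.comp_in_E1[OF B.perm1(1) B.perm2(1)] B.comp_in_E1[OF B.perm1(2) B.perm2(2)]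
  note st' = B'.comp_in_E1[OF B'.perm1(1) B'.perm2(1)] B'.comp_in_E1[OF B'.perm1(2) B'.perm2(2)]
  have parts: "(\<forall>x. \<sigma>1 x \<in> A \<longleftrightarrow> x \<in> A) \<and> (\<forall>x. \<sigma>2 x \<in> A \<longleftrightarrow> x \<in> A)"
      "(\<forall>x. \<alpha>1 x \<in> A \<longleftrightarrow> x \<in> A) \<and> (\<forall>x. \<alpha>2 x \<in> A \<longleftrightarrow> x \<in> A)" if "A = E1' \<or> A = E2'" for A
  proof -
    have "\<forall>x. (\<sigma>1 \<circ> \<sigma>2) x \<in> A \<longleftrightarrow> x \<in> A" "\<forall>x. (\<alpha>1 \<circ> \<alpha>2) x \<in> A \<longleftrightarrow> x \<in> A"
      using that st' unfolding \<sigma>0 \<alpha>0 by auto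
    then show "(\<forall>x. \<sigma>1 x \<in> A \<longleftrightarrow> x \<in> A) \<and> (\<forall>x. \<sigma>2 x \<in> A \<longleftrightarrow> x \<in> A)"
      "(\<forall>x. \<alpha>1 x \<in> A \<longleftrightarrow> x \<in> A) \<and> (\<forall>x. \<alpha>2 x \<in> A \<longleftrightarrow> x \<in> A)"
      using B.stable_parts[OF B.perm1(1) B.perm2(1), of A] B.stable_parts[OF B.perm1(2) B.perm2(2), of A]
      by simp_all
  qed
  have parts': "(\<forall>x. \<sigma>1' x \<in> A \<longleftrightarrow> x \<in> A) \<and> (\<forall>x. \<sigma>2' x \<in> A \<longleftrightarrow> x \<in> A)"
      "(\<forall>x. \<alpha>1' x \<in> A \<longleftrightarrow> x \<in> A) \<and> (\<forall>x. \<alpha>2' x \<in> A \<longleftrightarrow> x \<in> A)" if "A = E1 \<or> A = E2" for A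
  proof -
    have "\<forall>x. (\<sigma>1' \<circ> \<sigma>2') x \<in> A \<longleftrightarrow> x \<in> A" "\<forall>x. (\<alpha>1' \<circ> \<alpha>2') x \<in> A \<longleftrightarrow> x \<in> A"
      using that st unfolding \<sigma>0[symmetric] \<alpha>0[symmetric] by auto
    then show "(\<forall>x. \<sigma>1' x \<in> A \<longleftrightarrow> x \<in> A) \<and> (\<forall>x. \<sigma>2' x \<in> A \<longleftrightarrow> x \<in> A)"
      "(\<forall>x. \<alpha>1' x \<in> A \<longleftrightarrow> x \<in> A) \<and> (\<forall>x. \<alpha>2' x \<in> A \<longleftrightarrow> x \<in> A)"
      using B'.stable_parts[OF B'.perm1(1) B'.perm2(1), of A] B'.stable_parts[OF B'.perm1(2) B'.perm2(2), of A]
      by simp_all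
  qed
  have E1: "E1 = E1'"
  proof (cases "s = r")
    case True
    then show ?thesis using B.s B'.s s by simp
  next
    case False
    have "E1' \<inter> E1 = {} \<or> E1' \<inter> E1 = E1" using parts[of E1'] by (intro hypermap_stable[OF br(2)]) simp_all
    moreover have "E1 \<inter> E1' = {} \<or> E1 \<inter> E1' = E1'" using parts'[of E1] by (intro hypermap_stable[OF br'(2)]) simp_all
    moreover have "s \<in> E1" "s \<in> E1'" using False B.s B'.s s by simp_all
    ultimately show ?thesis by blast
  qed
  have E2: "E2 = E2'"
  proof (cases "b = r")
    case True
    then show ?thesis using B.b B'.b b by simp
  next
    case False
    have "E2' \<inter> E2 = {} \<or> E2' \<inter> E2 = E2" using parts[of E2'] by (intro hypermap_stable[OF br(3)]) simp_all
    moreover have "E2 \<inter> E2' = {} \<or> E2 \<inter> E2' = E2'" using parts'[of E2] by (intro hypermap_stable[OF br'(3)]) simp_all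
    moreover have "b \<in> E2" "b \<in> E2'" using False B.b B'.b b by simp_all
    ultimately show ?thesis by blast
  qed
  show ?thesis
    using B.comp_restrict[OF B.perm1(1) B.perm2(1)] B.comp_restrict[OF B.perm1(2) B.perm2(2)]
      B'.comp_restrict[OF B'.perm1(1) B'.perm2(1)] B'.comp_restrict[OF B'.perm1(2) B'.perm2(2)]
      s b E1 E2 \<sigma>0 \<alpha>0 by simp
qed

lemma loop_unique:
  assumes lp: "loop E \<sigma> \<alpha> r s b" and lp': "loop E' \<sigma>' \<alpha>' r s' b'"
    and E: "insert r E = insert r E'"
    and \<sigma>: "transpose r s \<circ> \<sigma> = transpose r s' \<circ> \<sigma>'"
    and \<alpha>: "\<alpha> \<circ> transpose r b = \<alpha>' \<circ> transpose r b'"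
  shows "s = s' \<and> b = b' \<and> E = E' \<and> \<sigma> = \<sigma>' \<and> \<alpha> = \<alpha>'"
proof -
  interpret L: loop E \<sigma> \<alpha> r s b by fact
  interpret L': loop E' \<sigma>' \<alpha>' r s' b' by fact
  have \<sigma>': "L.\<sigma> = L'.\<sigma>" and \<alpha>': "L.\<alpha> = L'.\<alpha>"
    unfolding L.\<sigma>_def L.\<alpha>_def L'.\<sigma>_def L'.\<alpha>_def using \<sigma> \<alpha> by simp_all
  have s: "s = s'" using L.root(1) L'.root(1) unfolding \<sigma>' by simp
  have b: "b = b'" using L.root(2) L'.root(2) permutes_inj[OF L'.permutes(2)] unfolding \<alpha>' by (metis injD)
  have \<sigma>0: "\<sigma> = \<sigma>'" using \<sigma> unfolding s by (metis comp_assoc id_comp transpose_comp_involutory)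
  have \<alpha>0: "\<alpha> = \<alpha>'" using \<alpha> unfolding b by (metis comp_assoc comp_id transpose_comp_involutory)
  have "E = E'" using E L.r L'.r by (metis insert_ident)
  then show ?thesis using s b \<sigma>0 \<alpha>0 by simp
qed

lemma rep_unique:
  assumes "rep T E \<sigma> \<alpha> r" "rep T' E \<sigma> \<alpha> r"
  shows "T = T'"
  using assms
proof (induction T arbitrary: T' E \<sigma> \<alpha> r)
  case Leaf
  then show ?case using rep_sound[OF Leaf(1)] rep_sound[OF Leaf(2)] by blast
next
  case (Bridge T1 T2)
  from Bridge.prems(1) obtain E1 \<sigma>1 \<alpha>1 s E2 \<sigma>2 \<alpha>2 b where B: "rep T1 E1 \<sigma>1 \<alpha>1 s" "rep T2 E2 \<sigma>2 \<alpha>2 b"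
    "bridge E1 E2 \<sigma>1 \<alpha>1 \<sigma>2 \<alpha>2 r s b" "hypermap E1 \<sigma>1 \<alpha>1" "hypermap E2 \<sigma>2 \<alpha>2"
    "E = insert r (E1 \<union> E2)" "\<sigma> = transpose r s \<circ> (\<sigma>1 \<circ> \<sigma>2)" "\<alpha> = (\<alpha>1 \<circ> \<alpha>2) \<circ> transpose r b"
    by (rule rep_BridgeE)
  show ?case
  proof (cases T')
    case Leaf
    then show ?thesis using rep_sound[OF Bridge.prems(1)] rep_sound[OF Bridge.prems(2)] by blast
  next
    case T': (Bridge T1' T2')
    from Bridge.prems(2)[unfolded T'] obtain E1' \<sigma>1' \<alpha>1' s' E2' \<sigma>2' \<alpha>2' b' where
      B': "rep T1' E1' \<sigma>1' \<alpha>1' s'" "rep T2' E2' \<sigma>2' \<alpha>2' b'"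
      "bridge E1' E2' \<sigma>1' \<alpha>1' \<sigma>2' \<alpha>2' r s' b'" "hypermap E1' \<sigma>1' \<alpha>1'" "hypermap E2' \<sigma>2' \<alpha>2'"
      "E = insert r (E1' \<union> E2')" "\<sigma> = transpose r s' \<circ> (\<sigma>1' \<circ> \<sigma>2')" "\<alpha> = (\<alpha>1' \<circ> \<alpha>2') \<circ> transpose r b'"
      by (rule rep_BridgeE)
    have "s = s' \<and> b = b' \<and> E1 = E1' \<and> E2 = E2' \<and> \<sigma>1 = \<sigma>1' \<and> \<sigma>2 = \<sigma>2' \<and> \<alpha>1 = \<alpha>1' \<and> \<alpha>2 = \<alpha>2'"
      using bridge_unique[OF B(3-5) B'(3-5)] B(7,8) B'(7,8) by simp
    then show ?thesis using Bridge.IH B(1,2) B'(1,2) T' by blast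
  next
    case (Loop T1' j)
    from Bridge.prems(2)[unfolded Loop] obtain E' \<sigma>' \<alpha>' s' b' where
      L: "loop E' \<sigma>' \<alpha>' r s' b'" "hypermap E' \<sigma>' \<alpha>'"
      "E = insert r E'" "\<sigma> = transpose r s' \<circ> \<sigma>'" "\<alpha> = \<alpha>' \<circ> transpose r b'"
      by (rule rep_LoopE)
    show ?thesis using bridge_not_loop[OF B(3) L(1,2)] B(6-) L(3-) by simp
  qed
next
  case (Loop T j)
  from Loop.prems(1) obtain E1 \<sigma>1 \<alpha>1 s b where
    L: "rep T E1 \<sigma>1 \<alpha>1 s" "j < deg T" "b = ((\<sigma>1 \<circ> \<alpha>1) ^^ j) s"
    "loop E1 \<sigma>1 \<alpha>1 r s b" "hypermap E1 \<sigma>1 \<alpha>1" "card (orbit (\<sigma>1 \<circ> \<alpha>1) s) = deg T"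
    "E = insert r E1" "\<sigma> = transpose r s \<circ> \<sigma>1" "\<alpha> = \<alpha>1 \<circ> transpose r b"
    by (rule rep_LoopE)
  show ?case
  proof (cases T')
    case Leaf
    then show ?thesis using rep_sound[OF Loop.prems(1)] rep_sound[OF Loop.prems(2)] by blast
  next
    case (Bridge T1' T2')
    from Loop.prems(2)[unfolded Bridge] obtain E1' \<sigma>1' \<alpha>1' s' E2' \<sigma>2' \<alpha>2' b' where
      B: "bridge E1' E2' \<sigma>1' \<alpha>1' \<sigma>2' \<alpha>2' r s' b'"
      "E = insert r (E1' \<union> E2')" "\<sigma> = transpose r s' \<circ> (\<sigma>1' \<circ> \<sigma>2')" "\<alpha> = (\<alpha>1' \<circ> \<alpha>2') \<circ> transpose r b'"
      by (rule rep_BridgeE)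
    show ?thesis using bridge_not_loop[OF B(1) L(4,5)] B(2-) L(7-) by simp
  next
    case T': (Loop T1' j')
    from Loop.prems(2)[unfolded T'] obtain E' \<sigma>' \<alpha>' s' b' where
      L': "rep T1' E' \<sigma>' \<alpha>' s'" "j' < deg T1'" "b' = ((\<sigma>' \<circ> \<alpha>') ^^ j') s'"
      "loop E' \<sigma>' \<alpha>' r s' b'"
      "E = insert r E'" "\<sigma> = transpose r s' \<circ> \<sigma>'" "\<alpha> = \<alpha>' \<circ> transpose r b'"
      by (rule rep_LoopE)
    have eq: "s = s' \<and> b = b' \<and> E1 = E' \<and> \<sigma>1 = \<sigma>' \<and> \<alpha>1 = \<alpha>'"
      using loop_unique[OF L(4) L'(4)] L(7-) L'(5-) by simp
    then have T: "T = T1'" using Loop.IH L(1) L'(1) by blast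
    \<comment> \<open>Numbers below the degree name distinct corners, so \<open>b\<close> determines
      \<open>j\<close>.\<close>
    have "inj_on (\<lambda>i. ((\<sigma>1 \<circ> \<alpha>1) ^^ i) s) {..<deg T}"
      using orbit_funpow_bij[OF loop.face_permutes(2)[OF L(4)], of s] unfolding L(6) bij_betw_def by blast
    moreover have "((\<sigma>1 \<circ> \<alpha>1) ^^ j) s = ((\<sigma>1 \<circ> \<alpha>1) ^^ j') s" using L(3) L'(3) eq by simp
    ultimately have "j = j'" using L(2) L'(2) T by (auto dest: inj_onD)
    then show ?thesis using T T' by simp
  qed
qed

section \<open>Isomorphisms between hypermaps with the same tree\<close>

lemma transpose_image:
  assumes "inj_on f A" "r \<in> A" "s \<in> A" "x \<in> A"
  shows "f (transpose r s x) = transpose (f r) (f s) (f x)"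
  using assms by (auto simp: transpose_def dest: inj_onD)

text \<open>The isomorphism sends root to root and is glued from those of the parts. The root clause
  leaves out \<open>Leaf\<close>, whose root is arbitrary.\<close>

lemma rep_iso:
  assumes "rep T E \<sigma> \<alpha> r" "rep T F \<tau> \<beta> q"
  shows "\<exists>f. bij_betw f E F \<and> (T \<noteq> Leaf \<longrightarrow> f r = q) \<and> (\<forall>x\<in>E. f (\<sigma> x) = \<tau> (f x) \<and> f (\<alpha> x) = \<beta> (f x))"
  using assms
proof (induction T arbitrary: E \<sigma> \<alpha> r F \<tau> \<beta> q)
  case Leaf
  then show ?case by (auto simp: rep_Leaf_iff bij_betw_def)
next
  case (Bridge T1 T2)
  from Bridge.prems(1) obtain E1 \<sigma>1 \<alpha>1 s E2 \<sigma>2 \<alpha>2 b where B: "rep T1 E1 \<sigma>1 \<alpha>1 s" "rep T2 E2 \<sigma>2 \<alpha>2 b"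
    and T: "T1 = Leaf \<longleftrightarrow> s = r" "T2 = Leaf \<longleftrightarrow> b = r"
    and br: "bridge E1 E2 \<sigma>1 \<alpha>1 \<sigma>2 \<alpha>2 r s b"
    and eq: "E = insert r (E1 \<union> E2)" "\<sigma> = transpose r s \<circ> (\<sigma>1 \<circ> \<sigma>2)" "\<alpha> = (\<alpha>1 \<circ> \<alpha>2) \<circ> transpose r b"
    by (rule rep_BridgeE)
  from Bridge.prems(2) obtain F1 \<tau>1 \<beta>1 t F2 \<tau>2 \<beta>2 c where B': "rep T1 F1 \<tau>1 \<beta>1 t" "rep T2 F2 \<tau>2 \<beta>2 c"
    and T': "T1 = Leaf \<longleftrightarrow> t = q" "T2 = Leaf \<longleftrightarrow> c = q"
    and br': "bridge F1 F2 \<tau>1 \<beta>1 \<tau>2 \<beta>2 q t c"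
    and eq': "F = insert q (F1 \<union> F2)" "\<tau> = transpose q t \<circ> (\<tau>1 \<circ> \<tau>2)" "\<beta> = (\<beta>1 \<circ> \<beta>2) \<circ> transpose q c"
    by (rule rep_BridgeE)
  interpret X: bridge E1 E2 \<sigma>1 \<alpha>1 \<sigma>2 \<alpha>2 r s b by fact
  interpret Y: bridge F1 F2 \<tau>1 \<beta>1 \<tau>2 \<beta>2 q t c by fact
  obtain f1 where f1: "bij_betw f1 E1 F1" "T1 \<noteq> Leaf \<Longrightarrow> f1 s = t"
      "\<And>x. x \<in> E1 \<Longrightarrow> f1 (\<sigma>1 x) = \<tau>1 (f1 x) \<and> f1 (\<alpha>1 x) = \<beta>1 (f1 x)"
    using Bridge.IH(1)[OF B(1) B'(1)] by blast
  obtain f2 where f2: "bij_betw f2 E2 F2" "T2 \<noteq> Leaf \<Longrightarrow> f2 b = c"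
      "\<And>x. x \<in> E2 \<Longrightarrow> f2 (\<sigma>2 x) = \<tau>2 (f2 x) \<and> f2 (\<alpha>2 x) = \<beta>2 (f2 x)"
    using Bridge.IH(2)[OF B(2) B'(2)] by blast
  define f where "f = (\<lambda>x. if x = r then q else if x \<in> E1 then f1 x else f2 x)"
  have f_r: "f r = q" by (simp add: f_def)
  have f_E1: "f x = f1 x" if "x \<in> E1" for x using that X.r by (auto simp: f_def)
  have f_E2: "f x = f2 x" if "x \<in> E2" for x using that X.r X.disj by (auto simp: f_def)
  have "bij_betw f E1 F1" using f1(1) f_E1 by (simp cong: bij_betw_cong)
  moreover have "bij_betw f E2 F2" using f2(1) f_E2 by (simp cong: bij_betw_cong)
  ultimately have "bij_betw f (E1 \<union> E2) (F1 \<union> F2)" using Y.disj by (rule bij_betw_combine)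
  then have bij: "bij_betw f E F" unfolding eq eq'
    using X.r Y.r f_r notIn_Un_bij_betw[of r "E1 \<union> E2" f "F1 \<union> F2"] by simp
  then have inj: "inj_on f E" by (rule bij_betw_imp_inj_on)
  have f_s: "f s = t" using T T' f_r f1(2) f_E1 X.s by (cases "s = r") auto
  have f_b: "f b = c" using T T' f_r f2(2) f_E2 X.b by (cases "b = r") auto
  have comp: "f ((p1 \<circ> p2) x) = (p1' \<circ> p2') (f x)"
    if x: "x \<in> E" and p: "p1 permutes E1" "p2 permutes E2" and p': "p1' permutes F1" "p2' permutes F2"
    and 1: "\<And>x. x \<in> E1 \<Longrightarrow> f1 (p1 x) = p1' (f1 x)" and 2: "\<And>x. x \<in> E2 \<Longrightarrow> f2 (p2 x) = p2' (f2 x)"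
    for p1 p2 p1' p2' x
  proof -
    consider "x = r" | "x \<in> E1" | "x \<in> E2" using x eq by blast
    then show ?thesis
    proof cases
      case 1
      then show ?thesis using X.comp_r[OF p] Y.comp_r[OF p'] f_r by simp
    next
      case x1: 2
      then have "f1 x \<in> F1" using f1(1) by (auto simp: bij_betw_def)
      then have "p2' (f1 x) = f1 x" using Y.disj permutes_not_in[OF p'(2)] by blast
      moreover have "p2 x = x" using x1 X.disj permutes_not_in[OF p(2)] by blast
      moreover have "p1 x \<in> E1" using x1 permutes_in_image[OF p(1)] by simp
      ultimately show ?thesis using 1[OF x1] f_E1 x1 by simp
    next
      case x2: 3
      then have y: "p2 x \<in> E2" using permutes_in_image[OF p(2)] by simp
      then have "f2 (p2 x) \<in> F2" using f2(1) by (auto simp: bij_betw_def)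
      then have "p1' (f2 (p2 x)) = f2 (p2 x)" using Y.disj permutes_not_in[OF p'(1)] by blast
      moreover have "p1 (p2 x) = p2 x" using y X.disj permutes_not_in[OF p(1)] by blast
      ultimately show ?thesis using 2[OF x2] f_E2[OF x2] f_E2[OF y] by simp
    qed
  qed
  have in_E: "r \<in> E" "s \<in> E" "b \<in> E" using X.in_E unfolding X.E_def eq by simp_all
  have "f (\<sigma> x) = \<tau> (f x) \<and> f (\<alpha> x) = \<beta> (f x)" if x: "x \<in> E" for x
  proof
    have "(\<sigma>1 \<circ> \<sigma>2) x \<in> E"
      using x permutes_in_image[OF X.comp_permutes_E[OF X.perm1(1) X.perm2(1)]] unfolding X.E_def eq by blast
    then have "f (\<sigma> x) = transpose q t (f ((\<sigma>1 \<circ> \<sigma>2) x))"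
      using transpose_image[OF inj in_E(1,2), of "(\<sigma>1 \<circ> \<sigma>2) x"] f_r f_s unfolding eq(2) o_apply[of "transpose r s"]
      by simp
    also have "f ((\<sigma>1 \<circ> \<sigma>2) x) = (\<tau>1 \<circ> \<tau>2) (f x)"
      using comp[OF x X.perm1(1) X.perm2(1) Y.perm1(1) Y.perm2(1)] f1(3) f2(3) by blast
    finally show "f (\<sigma> x) = \<tau> (f x)" unfolding eq' by simp
    have x': "transpose r b x \<in> E" using x in_E by (auto simp: transpose_def)
    have "f (\<alpha> x) = (\<beta>1 \<circ> \<beta>2) (f (transpose r b x))"
      unfolding eq(3) o_apply[of "\<alpha>1 \<circ> \<alpha>2"]
      using comp[OF x' X.perm1(2) X.perm2(2) Y.perm1(2) Y.perm2(2)] f1(3) f2(3) by blast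
    also have "f (transpose r b x) = transpose q c (f x)"
      using transpose_image[OF inj in_E(1,3) x] f_r f_b by simp
    finally show "f (\<alpha> x) = \<beta> (f x)" unfolding eq' by simp
  qed
  then show ?case using bij f_r by blast
next
  case (Loop T j)
  from Loop.prems(1) obtain E1 \<sigma>1 \<alpha>1 s b where
    L: "rep T E1 \<sigma>1 \<alpha>1 s" "j < deg T" and b: "b = ((\<sigma>1 \<circ> \<alpha>1) ^^ j) s"
    and lp: "loop E1 \<sigma>1 \<alpha>1 r s b"
    and eq: "E = insert r E1" "\<sigma> = transpose r s \<circ> \<sigma>1" "\<alpha> = \<alpha>1 \<circ> transpose r b"
    by (rule rep_LoopE)
  from Loop.prems(2) obtain F1 \<tau>1 \<beta>1 t c where
    L': "rep T F1 \<tau>1 \<beta>1 t" and c: "c = ((\<tau>1 \<circ> \<beta>1) ^^ j) t"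
    and lp': "loop F1 \<tau>1 \<beta>1 q t c"
    and eq': "F = insert q F1" "\<tau> = transpose q t \<circ> \<tau>1" "\<beta> = \<beta>1 \<circ> transpose q c"
    by (rule rep_LoopE)
  interpret X: loop E1 \<sigma>1 \<alpha>1 r s b by fact
  interpret Y: loop F1 \<tau>1 \<beta>1 q t c by fact
  have T: "T \<noteq> Leaf" using L(2) by auto
  obtain f1 where f1: "bij_betw f1 E1 F1" "f1 s = t"
      "\<And>x. x \<in> E1 \<Longrightarrow> f1 (\<sigma>1 x) = \<tau>1 (f1 x) \<and> f1 (\<alpha>1 x) = \<beta>1 (f1 x)"
    using Loop.IH[OF L(1) L'(1)] T by blast
  define f where "f = (\<lambda>x. if x = r then q else f1 x)"
  have f_r: "f r = q" by (simp add: f_def)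
  have f_E1: "f x = f1 x" if "x \<in> E1" for x using that X.r by (auto simp: f_def)
  have "bij_betw f E1 F1" using f1(1) f_E1 by (simp cong: bij_betw_cong)
  then have bij: "bij_betw f E F" unfolding eq eq'
    using X.r Y.r f_r notIn_Un_bij_betw[of r E1 f F1] by simp
  then have inj: "inj_on f E" by (rule bij_betw_imp_inj_on)
  have f_s: "f s = t" using f1(2) f_E1 X.s by simp
  \<comment> \<open>\<open>f1\<close> intertwines the face permutations, so the \<open>j\<close>-th
    corner after \<open>s\<close> goes to the \<open>j\<close>-th corner after
    \<open>t\<close>.\<close>
  have pow: "((\<sigma>1 \<circ> \<alpha>1) ^^ i) s \<in> E1 \<and> f1 (((\<sigma>1 \<circ> \<alpha>1) ^^ i) s) = ((\<tau>1 \<circ> \<beta>1) ^^ i) t" for i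
  proof (induction i)
    case (Suc i)
    then show ?case using f1(3) permutes_in_image[OF X.perm(1)] permutes_in_image[OF X.perm(2)] by simp
  qed (use f1(2) X.s in simp)
  have f_b: "f b = c" using pow[of j] f_E1 unfolding b c by simp
  have comp: "f (p x) = p' (f x)"
    if x: "x \<in> E" and p: "p permutes E1" and p': "p' permutes F1" 
    and 1: "\<And>x. x \<in> E1 \<Longrightarrow> f1 (p x) = p' (f1 x)" for p p' x
    using x 1 X.perm_r[OF p] Y.perm_r[OF p'] f_r f_E1 permutes_in_image[OF p] unfolding eq by auto
  have in_E: "r \<in> E" "s \<in> E" "b \<in> E" using X.in_E unfolding X.E_def eq by simp_all
  have "f (\<sigma> x) = \<tau> (f x) \<and> f (\<alpha> x) = \<beta> (f x)" if x: "x \<in> E" for x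
  proof
    have "\<sigma>1 x \<in> E"
      using x permutes_in_image[OF X.perm_E[OF X.perm(1)]] unfolding X.E_def eq by blast
    then have "f (\<sigma> x) = transpose q t (f (\<sigma>1 x))"
      using transpose_image[OF inj in_E(1,2), of "\<sigma>1 x"] f_r f_s unfolding eq(2) o_apply by simp
    also have "f (\<sigma>1 x) = \<tau>1 (f x)"
      using comp[OF x X.perm(1) Y.perm(1)] f1(3) by blast
    finally show "f (\<sigma> x) = \<tau> (f x)" unfolding eq' by simp
    have x': "transpose r b x \<in> E" using x in_E by (auto simp: transpose_def)
    have "f (\<alpha> x) = \<beta>1 (f (transpose r b x))"
      unfolding eq(3) o_apply
      using comp[OF x' X.perm(2) Y.perm(2)] f1(3) by blast
    also have "f (transpose r b x) = transpose q c (f x)"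
      using transpose_image[OF inj in_E(1,3) x] f_r f_b by simp
    finally show "f (\<alpha> x) = \<beta> (f x)" unfolding eq' by simp
  qed
  then show ?case using bij f_r by blast
qed

section \<open>Relabelling by conjugation\<close>

lemma comp_conj:
  assumes "bij f"
  shows "(f \<circ> p \<circ> inv f) \<circ> (f \<circ> q \<circ> inv f) = f \<circ> (p \<circ> q) \<circ> inv f"
  using assms by (simp add: fun_eq_iff bij_is_inj)

lemma transpose_conj:
  assumes "bij f"
  shows "f \<circ> transpose a b \<circ> inv f = transpose (f a) (f b)"
proof -
  have "f \<circ> transpose a b \<circ> inv f = transpose (f a) (f b) \<circ> f \<circ> inv f"
    unfolding comp_transpose_eq[OF assms] ..
  then show ?thesis using surj_f_inv_f[OF bij_is_surj[OF assms]] by (simp add: fun_eq_iff)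
qed

lemma funpow_conj:
  assumes "bij f"
  shows "((f \<circ> p \<circ> inv f) ^^ k) (f x) = f ((p ^^ k) x)"
  by (induction k) (simp_all add: bij_is_inj[OF assms])

text \<open>Composition, transpositions and powers, from which \<open>rep\<close> is built, are all
  compatible with conjugation.\<close>

lemma rep_conj:
  assumes "rep T E \<sigma> \<alpha> r" and f: "bij f"
  shows "rep T (f ` E) (f \<circ> \<sigma> \<circ> inv f) (f \<circ> \<alpha> \<circ> inv f) (f r)"
  using assms(1)
proof induction
  case (rep_Leaf r)
  have "f \<circ> id \<circ> inv f = id" using surj_f_inv_f[OF bij_is_surj[OF f]] unfolding fun_eq_iff by simp
  then show ?case unfolding rep_Leaf_iff by simp
next
  case (rep_Bridge T1 E1 \<sigma>1 \<alpha>1 s T2 E2 \<sigma>2 \<alpha>2 b r)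
  have "rep (dtree.Bridge T1 T2) (insert (f r) (f ` E1 \<union> f ` E2))
     (transpose (f r) (f s) \<circ> ((f \<circ> \<sigma>1 \<circ> inv f) \<circ> (f \<circ> \<sigma>2 \<circ> inv f)))
     (((f \<circ> \<alpha>1 \<circ> inv f) \<circ> (f \<circ> \<alpha>2 \<circ> inv f)) \<circ> transpose (f r) (f b)) (f r)"
    using rep_Bridge bij_is_inj[OF f] by (intro rep.rep_Bridge) (auto simp: comp_def inj_image_mem_iff dest: injD)
  then show ?case
    unfolding transpose_conj[OF f, symmetric] comp_conj[OF f] by (simp add: image_Un comp_def)
next
  case (rep_Loop T E \<sigma> \<alpha> s j r b)
  have IH: "rep T (f ` E) (f \<circ> \<sigma> \<circ> inv f) (f \<circ> \<alpha> \<circ> inv f) (f s)"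
    using rep_Loop.IH by (simp add: comp_def)
  have "rep (dtree.Loop T j) (insert (f r) (f ` E))
     (transpose (f r) (f s) \<circ> (f \<circ> \<sigma> \<circ> inv f)) ((f \<circ> \<alpha> \<circ> inv f) \<circ> transpose (f r) (f b)) (f r)"
    using rep_Loop.hyps bij_is_inj[OF f]
    by (intro rep.rep_Loop[OF IH]) (auto simp: inj_image_mem_iff comp_conj[OF f] funpow_conj[OF f])
  then show ?case
    unfolding transpose_conj[OF f, symmetric] comp_conj[OF f] by (simp add: comp_def)
qed

lemma rep_exists:
  assumes "valid T" "finite E" "card E = nedges T"
  shows "\<exists>\<sigma> \<alpha> r. rep T E \<sigma> \<alpha> r"
  using assms
proof (induction T arbitrary: E)
  case Leaf
  then show ?case by (auto simp: rep_Leaf_iff)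
next
  case (Bridge T1 T2)
  then obtain r E0 where E: "E = insert r E0" "r \<notin> E0" "card E0 = nedges T1 + nedges T2"
    by (auto simp: card_Suc_eq)
  then have "nedges T1 \<le> card E0" by simp
  then obtain E1 where E1: "E1 \<subseteq> E0" "card E1 = nedges T1" "finite E1"
    by (meson obtain_subset_with_card_n)
  define E2 where "E2 = E0 - E1"
  have E2: "card E2 = nedges T2" "finite E2"
    using E E1 Bridge.prems by (simp_all add: E2_def card_Diff_subset)
  have "valid T1" "valid T2" using Bridge.prems by simp_all
  obtain \<sigma>1 \<alpha>1 s where 1: "rep T1 E1 \<sigma>1 \<alpha>1 s" using Bridge.IH(1)[OF \<open>valid T1\<close> E1(3,2)] by blast
  obtain \<sigma>2 \<alpha>2 b where 2: "rep T2 E2 \<sigma>2 \<alpha>2 b" using Bridge.IH(2)[OF \<open>valid T2\<close> E2(2,1)] by blast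
  \<comment> \<open>The root of an empty part is free; it is reset to \<open>r\<close>, as
    \<open>rep_Bridge\<close> demands.\<close>
  have 1: "rep T1 E1 \<sigma>1 \<alpha>1 (if T1 = Leaf then r else s)" using 1 by (auto simp: rep_Leaf_iff)
  have 2: "rep T2 E2 \<sigma>2 \<alpha>2 (if T2 = Leaf then r else b)" using 2 by (auto simp: rep_Leaf_iff)
  have "E = insert r (E1 \<union> E2)" "E1 \<inter> E2 = {}" "r \<notin> E1 \<union> E2" using E E1 by (auto simp: E2_def)
  then show ?case using rep_Bridge[OF 1 2, of r] by auto
next
  case (Loop T j)
  then obtain r E0 where E: "E = insert r E0" "r \<notin> E0" "card E0 = nedges T"
    by (auto simp: card_Suc_eq)
  have "valid T" "finite E0" using Loop.prems E by simp_all
  then obtain \<sigma> \<alpha> s where "rep T E0 \<sigma> \<alpha> s" using Loop.IH[OF _ _ E(3)] by blast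
  then show ?case using rep_Loop[of T E0 \<sigma> \<alpha> s j r] Loop.prems E by auto
qed

section \<open>Rotation systems\<close>

definition brot :: "(half_edge \<Rightarrow> half_edge) \<Rightarrow> nat \<Rightarrow> nat" where
  "brot rot e = fst (rot (e, Black))"

definition wrot :: "(half_edge \<Rightarrow> half_edge) \<Rightarrow> nat \<Rightarrow> nat" where
  "wrot rot e = fst (rot (e, White))"

locale rotation =
  fixes n :: nat and rot :: "half_edge \<Rightarrow> half_edge"
  assumes rot: "rot permutes half_edges n" and col: "\<And>h. snd (rot h) = snd h"
begin

abbreviation "\<sigma> \<equiv> brot rot"
abbreviation "\<alpha> \<equiv> wrot rot"

lemma rot_Black: "rot (e, Black) = (\<sigma> e, Black)" and rot_White: "rot (e, White) = (\<alpha> e, White)"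
  using col[of "(e, Black)"] col[of "(e, White)"] by (simp_all add: brot_def wrot_def prod_eq_iff)

lemma permutes_lift:
  assumes "\<And>e. rot (e, c) = (p e, c)"
  shows "p permutes {..<n}"
proof (rule bij_imp_permutes)
  have inj: "inj p"
    using assms permutes_inj[OF rot] by (metis Pair_inject injD injI)
  have "p ` {..<n} \<subseteq> {..<n}"
  proof
    fix y assume "y \<in> p ` {..<n}"
    then obtain e where "e < n" "y = p e" by auto
    then have "(y, c) \<in> half_edges n"
      using permutes_in_image[OF rot, of "(e, c)"] assms[of e] by (simp add: half_edges_def)
    then show "y \<in> {..<n}" by (simp add: half_edges_def)
  qed
  then have "p ` {..<n} = {..<n}"
    using inj_on_subset[OF inj subset_UNIV] by (intro endo_inj_surj) simp_all
  then show "bij_betw p {..<n} {..<n}"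
    using inj_on_subset[OF inj subset_UNIV] by (simp add: bij_betw_def)
  fix e assume "e \<notin> {..<n}"
  then show "p e = e" using permutes_not_in[OF rot, of "(e, c)"] assms[of e] by (simp add: half_edges_def)
qed

lemma perm: "\<sigma> permutes {..<n}" "\<alpha> permutes {..<n}"
  using permutes_lift rot_Black rot_White by blast+

lemma permutation: "permutation rot" "permutation \<sigma>" "permutation \<alpha>" "permutation (\<sigma> \<circ> \<alpha>)"
proof -
  have "finite (half_edges n)"
    unfolding half_edges_def using finite_subset[of "UNIV :: colour set" "{Black, White}"] colour.exhaust by auto
  then show "permutation rot" using rot permutation_permutes by blast
  have "finite {..<n}" by simp
  then show "permutation \<sigma>" "permutation \<alpha>" using perm permutation_permutes by blast+
  then show "permutation (\<sigma> \<circ> \<alpha>)" by (rule permutation_compose)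
qed

lemma orbit_rot_lift:
  assumes "\<And>e. rot (e, c) = (p e, c)" "permutation p"
  shows "orbit rot (e, c) = (\<lambda>x. (x, c)) ` orbit p e"
  using orbit_inverse[OF permutation_self_in_orbit[OF assms(2)], of e rot "\<lambda>x. (x, c)"] assms(1) by simp

lemma card_vertices_of_lift:
  assumes "\<And>e. rot (e, c) = (p e, c)" "permutation p"
  shows "card (vertices_of c n rot) = cyc p {..<n}"
proof -
  have "vertices_of c n rot = (\<lambda>S. (\<lambda>x. (x, c)) ` S) ` (orbit p ` {..<n})"
    unfolding vertices_of_def using orbit_rot_lift[OF assms] by (auto simp: image_iff)
  moreover have "inj (\<lambda>S. (\<lambda>x. (x, c)) ` S)" by (auto simp: inj_def)
  ultimately show ?thesis unfolding cyc_def using card_image[OF inj_on_subset[OF _ subset_UNIV]] by metis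
qed

lemma card_vertices_of: "card (vertices_of Black n rot) = cyc \<sigma> {..<n}" "card (vertices_of White n rot) = cyc \<alpha> {..<n}"
  using card_vertices_of_lift rot_Black rot_White permutation by blast+

lemma card_vertices: "card (vertices n rot) = cyc \<sigma> {..<n} + cyc \<alpha> {..<n}"
proof -
  have "UNIV = {Black, White}" using colour.exhaust by auto
  then have "half_edges n = {..<n} \<times> {Black} \<union> {..<n} \<times> {White}" unfolding half_edges_def by auto
  then have "vertices n rot = vertices_of Black n rot \<union> vertices_of White n rot"
    by (simp add: vertices_def vertices_of_def image_Un)
  moreover have "vertices_of Black n rot \<inter> vertices_of White n rot = {}"
  proof (rule ccontr)
    assume "vertices_of Black n rot \<inter> vertices_of White n rot \<noteq> {}"
    then obtain x y where "orbit rot (x, Black) = orbit rot (y, White)"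
      unfolding vertices_of_def by auto
    then have "(\<lambda>z. (z, Black)) ` orbit \<sigma> x = (\<lambda>z. (z, White)) ` orbit \<alpha> y"
      using orbit_rot_lift[OF rot_Black permutation(2)] orbit_rot_lift[OF rot_White permutation(3)] by simp
    then show False using orbit_nonempty[of \<sigma> x] by auto
  qed
  moreover have "finite (vertices_of c n rot)" for c by (simp add: vertices_of_def)
  ultimately show ?thesis using card_vertices_of by (simp add: card_Un_disjoint)
qed

abbreviation "\<phi> \<equiv> \<sigma> \<circ> \<alpha>"

lemma face_step: "(rot \<circ> flip) (x, Black) = (\<alpha> x, White)" "(rot \<circ> flip) (x, White) = (\<sigma> x, Black)"
  by (simp_all add: rot_Black rot_White)

text \<open>A face alternates between colours: from \<open>(x, Black)\<close> it goes to
  \<open>(\<alpha> x, White)\<close> and from there to \<open>(\<phi> x, Black)\<close>. So it is a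
  cycle of \<open>\<phi>\<close> with every element doubled.\<close>

definition corners :: "nat set \<Rightarrow> half_edge set" where
  "corners S = (\<lambda>x. (x, Black)) ` S \<union> (\<lambda>x. (\<alpha> x, White)) ` S"

lemma orbit_face_Black: "orbit (rot \<circ> flip) (e, Black) = corners (orbit \<phi> e)"
proof
  have self: "e \<in> orbit \<phi> e" using permutation(4) by (rule permutation_self_in_orbit)
  have "h \<in> corners (orbit \<phi> e)" if "h \<in> orbit (rot \<circ> flip) (e, Black)" for h
    using that
  proof induction
    case base
    then show ?case using self by (auto simp: face_step corners_def simp del: comp_apply)
  next
    case (step h)
    then consider x where "x \<in> orbit \<phi> e" "h = (x, Black)" | x where "x \<in> orbit \<phi> e" "h = (\<alpha> x, White)"
      unfolding corners_def by blast
    then show ?case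
    proof cases
      case 1
      then show ?thesis unfolding 1(2) face_step corners_def by blast
    next
      case 2
      have "\<sigma> (\<alpha> x) \<in> orbit \<phi> e" using orbit.step[OF 2(1)] by simp
      then show ?thesis unfolding 2(2) face_step corners_def by blast
    qed
  qed
  then show "orbit (rot \<circ> flip) (e, Black) \<subseteq> corners (orbit \<phi> e)" by blast
  have W: "(\<alpha> e, White) \<in> orbit (rot \<circ> flip) (e, Black)"
    using orbit.base[of "rot \<circ> flip" "(e, Black)"] unfolding face_step .
  have B: "(y, Black) \<in> orbit (rot \<circ> flip) (e, Black)" if "y \<in> orbit \<phi> e" for y
    using that
  proof induction
    case base
    show ?case using orbit.step[OF W] unfolding face_step comp_apply[of \<sigma> \<alpha>] .
  next
    case (step y)
    show ?case using orbit.step[OF orbit.step[OF step.IH]] unfolding face_step comp_apply[of \<sigma> \<alpha>] .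
  qed
  have "(\<alpha> y, White) \<in> orbit (rot \<circ> flip) (e, Black)" if "y \<in> orbit \<phi> e" for y
    using orbit.step[OF B[OF that]] unfolding face_step .
  then show "corners (orbit \<phi> e) \<subseteq> orbit (rot \<circ> flip) (e, Black)"
    using B unfolding corners_def by blast
qed

lemma inj_corners: "inj corners"
proof (rule injI)
  fix S T assume "corners S = corners T"
  then have "{x. (x, Black) \<in> corners S} = {x. (x, Black) \<in> corners T}" by simp
  moreover have "{x. (x, Black) \<in> corners A} = A" for A by (auto simp: corners_def)
  ultimately show "S = T" by simp
qed

lemma faces_eq: "faces n rot = corners ` (orbit \<phi> ` {..<n})"
proof -
  have "UNIV = {Black, White}" using colour.exhaust by auto
  then have "half_edges n = {..<n} \<times> {Black} \<union> {..<n} \<times> {White}" unfolding half_edges_def by auto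
  \<comment> \<open>Each white corner shares its face with a black one, so the black corners account
    for all faces.\<close>
  moreover have W: "orbit (rot \<circ> flip) (\<alpha> x, White) = orbit (rot \<circ> flip) (x, Black)" for x
  proof -
    have "(x, Black) \<in> orbit (rot \<circ> flip) (x, Black)"
      unfolding orbit_face_Black using permutation_self_in_orbit[OF permutation(4)] by (auto simp: corners_def)
    then show ?thesis using self_in_orbit_step[of "(x, Black)" "rot \<circ> flip"] unfolding face_step by blast
  qed
  moreover have "orbit (rot \<circ> flip) ` ({..<n} \<times> {White}) = orbit (rot \<circ> flip) ` ({..<n} \<times> {Black})"
  proof -
    have "{..<n} \<times> {White} = (\<lambda>x. (\<alpha> x, White)) ` {..<n}"
      using permutes_image[OF perm(2)] by (auto simp: image_iff)
    moreover have "{..<n} \<times> {Black} = (\<lambda>x. (x, Black)) ` {..<n}" by auto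
    ultimately show ?thesis using W by (simp only: image_image)
  qed
  ultimately have "faces n rot = orbit (rot \<circ> flip) ` ({..<n} \<times> {Black})"
    by (simp add: faces_def image_Un)
  also have "\<dots> = corners ` (orbit \<phi> ` {..<n})"
    using orbit_face_Black by (auto simp: image_iff simp del: comp_apply)
  finally show ?thesis .
qed

lemma card_faces: "card (faces n rot) = cyc \<phi> {..<n}"
  unfolding faces_eq cyc_def using inj_corners by (intro card_image) (rule inj_on_subset, auto)

lemma card_face: "card (orbit (rot \<circ> flip) (e, Black)) = 2 * card (orbit \<phi> e)"
proof -
  have "finite (orbit \<phi> e)" using permutation_self_in_orbit[OF permutation(4)] by (rule finite_orbit)
  moreover have "inj_on (\<lambda>x. (\<alpha> x, White)) S" for S
    using permutes_inj[OF perm(2)] by (auto simp: inj_on_def dest: injD)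
  moreover have "inj_on (\<lambda>x. (x, Black)) S" for S :: "nat set" by (auto simp: inj_on_def)
  ultimately show ?thesis
    unfolding orbit_face_Black corners_def by (subst card_Un_disjoint) (auto simp: card_image)
qed

lemma planar_iff: "planar_map n rot \<longleftrightarrow> cyc \<sigma> {..<n} + cyc \<alpha> {..<n} + cyc \<phi> {..<n} = n + 2"
  unfolding planar_map_def card_vertices card_faces by linarith

lemma connected_imp_hypermap:
  assumes "connected_map n rot"
  shows "hypermap {..<n} \<sigma> \<alpha>"
proof (rule hypermapI[OF _ perm])
  fix A assume A: "A \<subseteq> {..<n}" "A \<noteq> {}" and st: "\<And>x. \<sigma> x \<in> A \<longleftrightarrow> x \<in> A" "\<And>x. \<alpha> x \<in> A \<longleftrightarrow> x \<in> A"
  let ?R = "{(x, rot x) | x. x \<in> half_edges n} \<union> {(x, flip x) | x. x \<in> half_edges n}"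
  have step: "fst h' \<in> A \<longleftrightarrow> fst h \<in> A" if "(h, h') \<in> ?R" for h h'
  proof -
    obtain e c where h: "h = (e, c)" by (cases h)
    have "h' = rot h \<or> h' = flip h" using that by blast
    then show ?thesis using st rot_Black rot_White unfolding h by (cases c) auto
  qed
  have reach: "fst h' \<in> A" if "(h, h') \<in> ?R\<^sup>*" "fst h \<in> A" for h h'
    using that(1) by induction (use that(2) step in blast)+
  obtain a where a: "a \<in> A" using A by blast
  have "x \<in> A" if "x < n" for x
    using assms reach[of "(a, Black)" "(x, Black)"] a A that
    unfolding connected_map_def half_edges_def by auto
  then show "A = {..<n}" using A by auto
qed simp

text \<open>An injective map of a finite set into itself is onto, so forward invariance gives
  invariance in both directions.\<close>

lemma stable_of_image:
  assumes "p permutes {..<n}" "p ` A \<subseteq> A" "finite A"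
  shows "p x \<in> A \<longleftrightarrow> x \<in> A"
proof -
  have "p ` A = A" using assms permutes_inj_on[OF assms(1)] by (simp add: endo_inj_surj)
  then show ?thesis using inj_image_mem_iff[OF permutes_inj[OF assms(1)], of x A] by simp
qed

text \<open>Reachability only runs forwards, so the reachable edges are merely mapped into
  themselves; by finiteness they form a stable set.\<close>

lemma hypermap_imp_connected:
  assumes h: "hypermap {..<n} \<sigma> \<alpha>"
  shows "connected_map n rot"
  unfolding connected_map_def
proof (intro ballI)
  let ?R = "{(x, rot x) | x. x \<in> half_edges n} \<union> {(x, flip x) | x. x \<in> half_edges n}"
  fix h h' assume hh: "h \<in> half_edges n" "h' \<in> half_edges n"
  \<comment> \<open>Testing black ends is enough, because \<open>flip\<close> leads to the other end
    of the same edge.\<close>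
  define A where "A = {x. x < n \<and> (h, (x, Black)) \<in> ?R\<^sup>*}"
  have R: "(k, rot k) \<in> ?R" "(k, flip k) \<in> ?R" if "k \<in> half_edges n" for k using that by blast+
  have he: "(x, c) \<in> half_edges n \<longleftrightarrow> x < n" for x c by (simp add: half_edges_def)
  have mem: "x \<in> A" if "(h, (x, c)) \<in> ?R\<^sup>*" "x < n" for x c
  proof (cases c)
    case White
    then have "((x, c), (x, Black)) \<in> ?R" using R(2)[of "(x, c)"] he that(2) by simp
    from rtrancl.rtrancl_into_rtrancl[OF that(1) this] show ?thesis using that(2) by (simp add: A_def)
  qed (use that in \<open>simp add: A_def\<close>)
  have mem': "(h, (x, c)) \<in> ?R\<^sup>*" if "x \<in> A" for x c
  proof (cases c)
    case White
    have x: "x < n" "(h, (x, Black)) \<in> ?R\<^sup>*" using that by (simp_all add: A_def)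
    have "((x, Black), (x, White)) \<in> ?R" using R(2)[of "(x, Black)"] he x(1) by simp
    from rtrancl.rtrancl_into_rtrancl[OF x(2) this] show ?thesis using White by simp
  qed (use that in \<open>simp add: A_def\<close>)
  have lt: "p x < n" if "p permutes {..<n}" "x \<in> A" for p x
    using that permutes_in_image[OF that(1), of x] by (simp add: A_def)
  have img: "p ` A \<subseteq> A" if p: "p permutes {..<n}" and r: "\<And>e. rot (e, c) = (p e, c)" for p c
  proof
    fix y assume "y \<in> p ` A"
    then obtain x where x: "x \<in> A" "y = p x" by blast
    have "((x, c), (y, c)) \<in> ?R" using R(1)[of "(x, c)"] he r x by (simp add: A_def)
    then have "(h, (y, c)) \<in> ?R\<^sup>*" using mem'[OF x(1)] by (rule rtrancl.rtrancl_into_rtrancl[rotated])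
    then show "y \<in> A" using mem lt[OF p x(1)] x(2) by blast
  qed
  have "finite A" by (simp add: A_def)
  obtain e c where ec: "h = (e, c)" by (cases h)
  then have "e \<in> A" using mem[of e c] hh he by auto
  then have "A = {..<n}"
    using stable_of_image[OF perm(1) img[OF perm(1) rot_Black] \<open>finite A\<close>]
      stable_of_image[OF perm(2) img[OF perm(2) rot_White] \<open>finite A\<close>]
    by (intro hypermap_conn[OF h]) (auto simp: A_def)
  moreover obtain e' c' where "h' = (e', c')" by (cases h')
  ultimately show "(h, h') \<in> ?R\<^sup>*" using mem'[of e' c'] hh(2) he by auto
qed

end

section \<open>Trees of rooted maps\<close>

fun encodes :: "bip_map \<Rightarrow> dtree \<Rightarrow> bool" where
  "encodes Vertex_Map T \<longleftrightarrow> T = Leaf"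
| "encodes (Edge_Map n rot r) T \<longleftrightarrow> rep T {..<n} (brot rot) (wrot rot) r"

lemma labelled_Edge_Map:
  "Edge_Map k rot r \<in> labelled_maps n \<longleftrightarrow> k = n \<and> rotation n rot \<and> hypermap {..<n} (brot rot) (wrot rot) \<and>
     cyc (brot rot) {..<n} + cyc (wrot rot) {..<n} + cyc (brot rot \<circ> wrot rot) {..<n} = n + 2 \<and> r < n"
proof -
  have "is_bip_planar_map (Edge_Map n rot r) \<longleftrightarrow> rotation n rot \<and> connected_map n rot \<and> planar_map n rot \<and> r < n"
    by (auto simp: rotation_def)
  then show ?thesis
    unfolding labelled_maps_def
    using rotation.planar_iff rotation.connected_imp_hypermap rotation.hypermap_imp_connected
    by (metis (mono_tags, lifting) map_size.simps(2) mem_Collect_eq)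
qed

lemma labelled_Vertex_Map: "Vertex_Map \<in> labelled_maps n \<longleftrightarrow> n = 0"
  by (auto simp: labelled_maps_def)

lemma encodes_exists:
  assumes "M \<in> labelled_maps n"
  shows "\<exists>T. encodes M T"
proof (cases M)
  case (Edge_Map k rot r)
  then show ?thesis using assms rep_complete[of "{..<n}" "brot rot" "wrot rot" r]
    by (auto simp: labelled_Edge_Map)
qed simp

lemma encodes_sound:
  assumes "M \<in> labelled_maps n" "encodes M T"
  shows "valid T \<and> nedges T = n \<and> (T = Leaf \<longleftrightarrow> n = 0) \<and> face M = Suc (nloops T) \<and> outdeg M = deg T \<and>
    (n > 0 \<longrightarrow> black M = nblack T \<and> white M = nwhite T)"
proof (cases M)
  case Vertex_Map
  then show ?thesis using assms by (simp add: labelled_Vertex_Map)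
next
  case (Edge_Map k rot r)
  then have k: "k = n" and r: "r < n" and "rotation n rot"
    using assms(1) by (simp_all add: labelled_Edge_Map)
  then interpret rotation n rot by simp
  have rep: "rep T {..<n} \<sigma> \<alpha> r" using assms(2) Edge_Map k by simp
  have "{..<n} \<noteq> {}" using r by auto
  then show ?thesis
    using rep_sound[OF rep] r unfolding Edge_Map k face.simps outdeg.simps black.simps white.simps
      card_faces card_face card_vertices_of
    by (auto simp: comp_def)
qed

lemma conj_perm_apply:
  assumes "\<pi> permutes {..<n}"
  shows "p' = \<pi> \<circ> p \<circ> inv \<pi> \<longleftrightarrow> (\<forall>x. p' (\<pi> x) = \<pi> (p x))"
  using permutes_inverses[OF assms] by (auto simp: fun_eq_iff) metis

text \<open>A relabelling conjugates both permutations, which preserves \<open>rep\<close>, and the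
  tree is unique. Conversely, hypermaps with the same tree are isomorphic as rooted
  hypermaps.\<close>

lemma same_map_iff_encodes:
  assumes M: "M \<in> labelled_maps n" "encodes M T" and M': "M' \<in> labelled_maps n" "encodes M' T'"
  shows "same_map M M' \<longleftrightarrow> T = T'"
proof (cases "n = 0")
  case True
  then show ?thesis using M M' by (cases M; cases M') (auto simp: labelled_Edge_Map)
next
  case False
  obtain rot r where E: "M = Edge_Map n rot r" using M False by (cases M) (auto simp: labelled_Edge_Map labelled_Vertex_Map)
  obtain rot' r' where E': "M' = Edge_Map n rot' r'" using M' False by (cases M') (auto simp: labelled_Edge_Map labelled_Vertex_Map)
  have "rotation n rot" "rotation n rot'" using M M' unfolding E E' by (simp_all add: labelled_Edge_Map)
  then interpret R: rotation n rot + R': rotation n rot' by simp_all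
  have rep: "rep T {..<n} R.\<sigma> R.\<alpha> r" "rep T' {..<n} R'.\<sigma> R'.\<alpha> r'" using M(2) M'(2) E E' by simp_all
  have UN: "UNIV = {Black, White}" using colour.exhaust by auto
  have eq: "(\<forall>h\<in>half_edges n. rot' (map_prod \<pi> id h) = map_prod \<pi> id (rot h)) \<longleftrightarrow>
      (\<forall>e<n. R'.\<sigma> (\<pi> e) = \<pi> (R.\<sigma> e) \<and> R'.\<alpha> (\<pi> e) = \<pi> (R.\<alpha> e))" for \<pi>
    unfolding half_edges_def UN
    by (auto simp: R.rot_Black R.rot_White R'.rot_Black R'.rot_White)
  have same: "same_map M M' \<longleftrightarrow> (\<exists>\<pi>. \<pi> permutes {..<n} \<and> \<pi> r = r' \<and>
      (\<forall>e<n. R'.\<sigma> (\<pi> e) = \<pi> (R.\<sigma> e) \<and> R'.\<alpha> (\<pi> e) = \<pi> (R.\<alpha> e)))"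
    unfolding E E' by (simp only: same_map.simps eq simp_thms)
  show ?thesis
  proof
    assume "same_map M M'"
    then obtain \<pi> where \<pi>: "\<pi> permutes {..<n}" "\<pi> r = r'"
      "\<And>e. e < n \<Longrightarrow> R'.\<sigma> (\<pi> e) = \<pi> (R.\<sigma> e) \<and> R'.\<alpha> (\<pi> e) = \<pi> (R.\<alpha> e)"
      unfolding same by blast
    \<comment> \<open>Off the labels all permutations are the identity, so the commutation holds for
      all numbers and becomes a conjugation.\<close>
    have out: "p' (\<pi> e) = \<pi> (p e)" if "p permutes {..<n}" "p' permutes {..<n}" "\<not> e < n" for p p' e
      using permutes_not_in[OF \<pi>(1)] permutes_not_in[OF that(1)] permutes_not_in[OF that(2)] that(3) by simp
    have "R'.\<sigma> (\<pi> e) = \<pi> (R.\<sigma> e)" "R'.\<alpha> (\<pi> e) = \<pi> (R.\<alpha> e)" for e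
      using \<pi>(3)[of e] out[OF R.perm(1) R'.perm(1), of e] out[OF R.perm(2) R'.perm(2), of e] by blast+
    then have "R'.\<sigma> = \<pi> \<circ> R.\<sigma> \<circ> inv \<pi>" "R'.\<alpha> = \<pi> \<circ> R.\<alpha> \<circ> inv \<pi>"
      using conj_perm_apply[OF \<pi>(1)] by blast+
    moreover have "rep T (\<pi> ` {..<n}) (\<pi> \<circ> R.\<sigma> \<circ> inv \<pi>) (\<pi> \<circ> R.\<alpha> \<circ> inv \<pi>) (\<pi> r)"
      using rep(1) permutes_bij[OF \<pi>(1)] by (rule rep_conj)
    ultimately have "rep T {..<n} R'.\<sigma> R'.\<alpha> r'"
      using permutes_image[OF \<pi>(1)] \<pi>(2) by simp
    then show "T = T'" using rep(2) by (rule rep_unique)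
  next
    assume T: "T = T'"
    have "T \<noteq> Leaf" using encodes_sound[OF M] False by blast
    then obtain f where f: "bij_betw f {..<n} {..<n}" "f r = r'"
      "\<And>x. x < n \<Longrightarrow> f (R.\<sigma> x) = R'.\<sigma> (f x) \<and> f (R.\<alpha> x) = R'.\<alpha> (f x)"
      using rep_iso[OF rep(1)] rep(2) T by (metis lessThan_iff)
    \<comment> \<open>\<open>f\<close> is controlled only on the labels below \<open>n\<close>,
      while a permutation of these must fix every other number.\<close>
    define \<pi> where "\<pi> = (\<lambda>x. if x < n then f x else x)"
    have f\<pi>: "\<pi> x = f x" if "x < n" for x using that by (simp add: \<pi>_def)
    have "bij_betw \<pi> {..<n} {..<n}" using f(1) f\<pi> bij_betw_cong[of "{..<n}" \<pi> f] by simp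
    then have "\<pi> permutes {..<n}" by (rule bij_imp_permutes) (simp add: \<pi>_def)
    moreover have "r < n" using M(1) unfolding E by (simp add: labelled_Edge_Map)
    moreover have "R.\<sigma> e < n" "R.\<alpha> e < n" if "e < n" for e
      using that permutes_in_image[OF R.perm(1), of e] permutes_in_image[OF R.perm(2), of e] by simp_all
    ultimately show "same_map M M'"
      unfolding same using f(2,3) f\<pi> by (intro exI[of _ \<pi>]) simp
  qed
qed

lemma encodes_surj:
  assumes "valid T"
  shows "\<exists>M\<in>labelled_maps (nedges T). encodes M T"
proof (cases "T = Leaf")
  case True
  then show ?thesis by (intro bexI[of _ Vertex_Map]) (simp_all add: labelled_Vertex_Map)
next
  case False
  define n where "n = nedges T"
  obtain \<sigma> \<alpha> r where rep: "rep T {..<n} \<sigma> \<alpha> r"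
    using rep_exists[OF assms, of "{..<n}"] by (auto simp: n_def)
  note snd = rep_sound[OF rep]
  have perm: "\<sigma> permutes {..<n}" "\<alpha> permutes {..<n}" using snd hypermapD by blast+
  define rot where "rot = (\<lambda>(e, c). (case c of Black \<Rightarrow> \<sigma> e | White \<Rightarrow> \<alpha> e, c))"
  have br: "brot rot = \<sigma>" "wrot rot = \<alpha>" by (simp_all add: brot_def wrot_def rot_def fun_eq_iff)
  have "rotation n rot"
  proof
    show "rot permutes half_edges n"
    proof (rule bij_imp_permutes)
      have "inj rot"
      proof (rule injI)
        fix h h' assume "rot h = rot h'"
        then show "h = h'"
          by (cases h; cases h'; cases "snd h"; cases "snd h'")
            (auto simp: rot_def inj_eq[OF permutes_inj[OF perm(1)]] inj_eq[OF permutes_inj[OF perm(2)]])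
      qed
      moreover have "rot ` half_edges n \<subseteq> half_edges n"
      proof
        fix h assume "h \<in> rot ` half_edges n"
        then obtain e c where "e < n" "h = rot (e, c)" by (auto simp: half_edges_def)
        then show "h \<in> half_edges n"
          using permutes_in_image[OF perm(1), of e] permutes_in_image[OF perm(2), of e]
          by (cases c) (simp_all add: half_edges_def rot_def)
      qed
      moreover have "finite (half_edges n)"
        unfolding half_edges_def using finite_subset[of "UNIV :: colour set" "{Black, White}"] colour.exhaust by auto
      ultimately have "rot ` half_edges n = half_edges n" "inj_on rot (half_edges n)"
        using inj_on_subset[of rot UNIV "half_edges n"] endo_inj_surj[of "half_edges n" rot] by simp_all
      then show "bij_betw rot (half_edges n) (half_edges n)" by (simp add: bij_betw_def)
      show "rot h = h" if "h \<notin> half_edges n" for h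
      proof -
        obtain e c where h: "h = (e, c)" by (cases h)
        then have "e \<notin> {..<n}" using that by (simp add: half_edges_def)
        then show ?thesis using permutes_not_in[OF perm(1)] permutes_not_in[OF perm(2)]
          by (cases c) (simp_all add: h rot_def)
      qed
    qed
    show "snd (rot h) = snd h" for h by (cases h) (simp add: rot_def)
  qed
  then have "Edge_Map n rot r \<in> labelled_maps n"
    using snd False unfolding labelled_Edge_Map br by (auto simp: n_def comp_def)
  then show ?thesis using rep unfolding n_def[symmetric] by (intro bexI[of _ "Edge_Map n rot r"]) (simp_all add: br)
qed

section \<open>Dyck paths and new intervals\<close>

text \<open>\<open>Tree l r\<close> is a plane forest whose first tree has the children \<open>l\<close>, followed by the trees \<open>r\<close>.\<close>

datatype forest = Empty | Tree forest forest

fun word :: "forest \<Rightarrow> step list" where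
  "word Empty = []"
| "word (Tree l r) = U # word l @ D # word r"

fun fsize :: "forest \<Rightarrow> nat" where
  "fsize Empty = 0"
| "fsize (Tree l r) = Suc (fsize l + fsize r)"

fun brackets :: "forest \<Rightarrow> nat list" where
  "brackets Empty = []"
| "brackets (Tree l r) = fsize l # brackets l @ brackets r"

fun ntrees :: "forest \<Rightarrow> nat" where
  "ntrees Empty = 0"
| "ntrees (Tree l r) = Suc (ntrees r)"

fun fappend :: "forest \<Rightarrow> forest \<Rightarrow> forest" where
  "fappend Empty u = u"
| "fappend (Tree l r) u = Tree l (fappend r u)"

fun take_trees :: "nat \<Rightarrow> forest \<Rightarrow> forest" where
  "take_trees (Suc k) (Tree l r) = Tree l (take_trees k r)"
| "take_trees _ _ = Empty"

fun drop_trees :: "nat \<Rightarrow> forest \<Rightarrow> forest" where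
  "drop_trees (Suc k) (Tree l r) = drop_trees k r"
| "drop_trees _ t = t"

lemma length_word [simp]: "length (word t) = 2 * fsize t"
  by (induction t) auto

lemma semilength_word [simp]: "semilength (word t) = fsize t"
  by (simp add: semilength_def)

lemma length_brackets [simp]: "length (brackets t) = fsize t"
  by (induction t) auto

lemma height_0 [simp]: "height P 0 = 0"
  by (simp add: height_def)

lemma height_Cons_Suc [simp]: "height (x # P) (Suc k) = rise x + height P k"
  by (simp add: height_def)

lemma height_append: "height (P @ Q) k = (if k \<le> length P then height P k else height P (length P) + height Q (k - length P))"
  by (simp add: height_def)

lemma dyck_word: "dyck (word t)"
proof (induction t)
  case Empty
  then show ?case by (simp add: dyck_def)
next
  case (Tree l r)
  have l: "height (word l) k \<ge> 0" "height (word l) (length (word l)) = 0" if "k \<le> length (word l)" for k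
    using Tree.IH(1) that unfolding dyck_def by blast+
  have r: "height (word r) k \<ge> 0" "height (word r) (length (word r)) = 0" if "k \<le> length (word r)" for k
    using Tree.IH(2) that unfolding dyck_def by blast+
  have h: "height (word l @ D # word r) k =
      (if k \<le> length (word l) then height (word l) k else - 1 + height (word r) (k - Suc (length (word l))))" for k
  proof (cases "k \<le> length (word l)")
    case False
    then have "k - length (word l) = Suc (k - Suc (length (word l)))" by simp
    then show ?thesis using False l(2)[of 0] by (simp add: height_append)
  qed (simp add: height_append)
  show ?case
    unfolding dyck_def
  proof (intro conjI allI impI)
    fix k assume k: "k \<le> length (word (Tree l r))"
    show "0 \<le> height (word (Tree l r)) k"
    proof (cases k)
      case (Suc k')
      then show ?thesis using l(1)[of k'] r(1)[of "k' - Suc (length (word l))"] k h[of k'] by (auto split: if_splits)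
    qed simp
  qed (use h r(2)[of 0] in simp)
qed

text \<open>A nonnegative path from height \<open>h\<close> to 0 splits at its first visits to the
  heights \<open>h - 1, ..., 0\<close> into \<open>h + 1\<close> Dyck words separated by
  \<open>h\<close> down steps.\<close>

fun join_down :: "forest list \<Rightarrow> step list" where
  "join_down [] = []"
| "join_down [t] = word t"
| "join_down (t # u # ts) = word t @ D # join_down (u # ts)"

text \<open>Dyck paths are the case \<open>h = 0\<close>; the generalisation makes induction on the first step possible.\<close>

lemma path_decomp:
  assumes "\<And>k. k \<le> length P \<Longrightarrow> height P k + int h \<ge> 0" "height P (length P) + int h = 0"
  shows "\<exists>ts. length ts = Suc h \<and> P = join_down ts"
  using assms
proof (induction P arbitrary: h)
  case Nil
  then show ?case by (intro exI[of _ "[Empty]"]) simp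
next
  case (Cons x P)
  have step: "height P k + (rise x + int h) \<ge> 0" if "k \<le> length P" for k
    using Cons.prems(1)[of "Suc k"] that by simp
  show ?case
  proof (cases x)
    case U
    \<comment> \<open>After an up step the rest starts one higher. Its first two factors become the
      children of a new first tree and the trees following it.\<close>
    obtain ts where ts: "length ts = Suc (Suc h)" "P = join_down ts"
      using Cons.IH[of "Suc h"] step Cons.prems(2) unfolding U by (auto simp: algebra_simps)
    then obtain t u us where tu: "ts = t # u # us" by (auto simp: length_Suc_conv)
    show ?thesis
    proof (cases us)
      case Nil
      then show ?thesis using ts tu U by (intro exI[of _ "[Tree t u]"]) simp
    next
      case (Cons v vs)
      then show ?thesis using ts tu U by (intro exI[of _ "Tree t u # us"]) simp
    qed
  next
    case D
    have "h \<ge> 1" using step[of 0] unfolding D by simp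
    then obtain h' where h': "h = Suc h'" by (cases h) auto
    obtain ts where ts: "length ts = Suc h'" "P = join_down ts"
      using Cons.IH[of h'] step Cons.prems(2) unfolding D h' by auto
    then obtain t us where "ts = t # us" by (auto simp: length_Suc_conv)
    then show ?thesis using ts D h' by (intro exI[of _ "Empty # ts"]) simp
  qed
qed

lemma dyck_iff_word: "dyck P \<longleftrightarrow> (\<exists>t. P = word t)"
proof
  assume "dyck P"
  then obtain ts where "length ts = Suc 0" "P = join_down ts"
    using path_decomp[of P 0] unfolding dyck_def by auto
  then show "\<exists>t. P = word t" by (auto simp: length_Suc_conv)
qed (use dyck_word in auto)

text \<open>The displayed \<open>D\<close> is the first step below the starting height, hence
  determined by the word. The free tails let the induction treat \<open>word l\<close>, which is
  itself followed by \<open>D\<close>, in the same way.\<close>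

lemma word_D_unique: "word t @ D # x = word t' @ D # y \<Longrightarrow> t = t' \<and> x = y"
proof (induction t arbitrary: t' x y)
  case Empty
  then show ?case by (cases t') auto
next
  case (Tree l r)
  from Tree.prems obtain l' r' where t': "t' = Tree l' r'" by (cases t') simp_all
  then have "word l @ D # (word r @ D # x) = word l' @ D # (word r' @ D # y)" using Tree.prems by simp
  then have l: "l = l' \<and> word r @ D # x = word r' @ D # y" by (rule Tree.IH(1))
  then have "r = r' \<and> x = y" by (intro Tree.IH(2)) (rule conjunct2)
  then show ?case using l t' by simp
qed

lemma word_inj: "word t = word t' \<longleftrightarrow> t = t'"
  using word_D_unique[of t "[]" t' "[]"] by auto

section \<open>Bracket vector, type and contacts of the path of a forest\<close>

definition inner_size :: "step list \<Rightarrow> nat \<Rightarrow> nat" where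
  "inner_size P k = semilength (factor_between P k (matching_down P k))"

lemma inner_size_word:
  assumes P: "P = X @ U # word l @ D # Y"
  shows "inner_size P (length X) = fsize l"
proof -
  let ?k = "length X"
  have drop: "drop (Suc ?k) P = word l @ D # Y" unfolding P by simp
  have m: "matching_down P ?k = Suc (?k + length (word l))"
    unfolding matching_down_def
  proof (rule the_equality)
    let ?j = "Suc (?k + length (word l))"
    have "factor_between P ?k ?j = word l" unfolding factor_between_def drop by simp
    moreover have "P ! ?j = D" unfolding P by (simp add: nth_append)
    ultimately show "?k < ?j \<and> ?j < length P \<and> P ! ?j = D \<and> dyck (factor_between P ?k ?j)"
      using dyck_word by (simp add: P)
  next
    fix j assume j: "?k < j \<and> j < length P \<and> P ! j = D \<and> dyck (factor_between P ?k j)"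
    define m where "m = j - Suc ?k"
    have j_eq: "j = Suc ?k + m" using j by (simp add: m_def)
    let ?Q = "word l @ D # Y"
    obtain t where t: "take m ?Q = word t" using j unfolding factor_between_def drop m_def dyck_iff_word by blast
    have "?Q ! m = D" using j unfolding j_eq drop[symmetric] by (subst nth_drop) (auto simp: P)
    moreover have mQ: "m < length ?Q" using j unfolding j_eq P by simp
    \<comment> \<open>A second candidate for the match also cuts off a Dyck word followed by
      \<open>D\<close>, and such a cut is unique.\<close>
    ultimately have "?Q = word t @ D # drop (Suc m) ?Q" using t by (metis id_take_nth_drop)
    then have "l = t" using word_D_unique by blast
    then have "length (take m ?Q) = length (word l)" using t by simp
    then show "j = Suc (?k + length (word l))" using mQ j_eq by simp
  qed
  have "factor_between P ?k (matching_down P ?k) = word l" unfolding m factor_between_def drop by simp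
  then show ?thesis by (simp add: inner_size_def)
qed

definition rise_type :: "step list \<Rightarrow> nat \<Rightarrow> nat" where
  "rise_type P k = (if Suc k < length P \<and> P ! Suc k = U then 1 else 0)"

text \<open>An up step is followed by an up step exactly if it encloses a nonempty factor, so types
  can be read from bracket values.\<close>

abbreviation pos :: "nat \<Rightarrow> nat" where
  "pos v \<equiv> if v = 0 then 0 else 1"

lemma upt_split3:
  assumes "b = Suc (Suc (a + m)) + k"
  shows "[a..<b] = [a..<Suc a] @ [Suc a..<Suc a + m] @ [Suc a + m..<Suc (Suc a + m)] @ [Suc (Suc (a + m))..<Suc (Suc (a + m)) + k]"
  unfolding assms using upt_add_eq_append[of a "Suc (Suc (a + m))" k] upt_add_eq_append[of "Suc a" "Suc a" m]
  by (simp add: upt_rec[of a])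

text \<open>Matches and types refer to the whole word, so \<open>P\<close> stays fixed in the
  induction while the window occupied by \<open>word t\<close> moves.\<close>

lemma up_steps_word:
  assumes "P = X @ word t @ Y"
  shows "map (\<lambda>k. (inner_size P k, rise_type P k))
     (filter (\<lambda>k. P ! k = U) [length X..<length X + length (word t)]) = map (\<lambda>v. (v, pos v)) (brackets t)"
  using assms
proof (induction t arbitrary: X Y)
  case (Tree l r)
  let ?f = "\<lambda>k. (inner_size P k, rise_type P k)" and ?a = "length X"
  have P: "P = X @ U # word l @ D # (word r @ Y)" using Tree.prems by simp
  have l: "map ?f (filter (\<lambda>k. P ! k = U) [Suc ?a..<Suc ?a + length (word l)]) = map (\<lambda>v. (v, pos v)) (brackets l)"
    using Tree.IH(1)[of "X @ [U]" "D # word r @ Y"] Tree.prems by simp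
  have r: "map ?f (filter (\<lambda>k. P ! k = U) [Suc (Suc (?a + length (word l)))..<Suc (Suc (?a + length (word l))) + length (word r)]) =
      map (\<lambda>v. (v, pos v)) (brackets r)"
    using Tree.IH(2)[of "X @ U # word l @ [D]" Y] Tree.prems by simp
  have "[?a..<?a + length (word (Tree l r))] =
      [?a..<Suc ?a] @ [Suc ?a..<Suc ?a + length (word l)] @
      [Suc ?a + length (word l)..<Suc (Suc ?a + length (word l))] @
      [Suc (Suc (?a + length (word l)))..<Suc (Suc (?a + length (word l))) + length (word r)]"
    by (rule upt_split3) simp
  moreover have "P ! ?a = U" "P ! (Suc ?a + length (word l)) = D"
    unfolding P by (simp_all add: nth_append)
  moreover have "rise_type P ?a = pos (fsize l)"
    unfolding rise_type_def P by (cases l) (simp_all add: nth_append)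
  ultimately show ?case
    using l r inner_size_word[OF P] by simp
qed simp

lemma up_positions_word:
  "map (\<lambda>k. (inner_size (word t) k, rise_type (word t) k)) (up_positions (word t)) = map (\<lambda>v. (v, pos v)) (brackets t)"
  using up_steps_word[of "word t" "[]" t "[]"] by (simp add: up_positions_def)

lemma length_up_positions: "length (up_positions (word t)) = fsize t"
  using arg_cong[OF up_positions_word[of t], of length] by simp

lemma bracket_word:
  assumes "i < fsize t"
  shows "bracket (word t) (Suc i) = brackets t ! i"
  using arg_cong[OF up_positions_word[of t], of "\<lambda>xs. fst (xs ! i)"] assms
  by (simp add: bracket_def up_pos_def inner_size_def length_up_positions Let_def)

lemma type_word_word: "type_word (word t) = map pos (brackets t)"
  using arg_cong[OF up_positions_word[of t], of "map snd"]
  by (simp add: type_word_def rise_type_def comp_def)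

lemma rising_contacts_word: "rising_contacts (word t) = ntrees t"
proof (induction t)
  case Empty
  then show ?case by (simp add: rising_contacts_def)
next
  case (Tree l r)
  let ?S = "\<lambda>P. {k. k < length P \<and> P ! k = U \<and> height P k = 0}"
  let ?P = "U # word l @ D # word r" and ?m = "Suc (Suc (length (word l)))"
  have l: "height (word l) k \<ge> 0" "height (word l) (length (word l)) = 0" if "k \<le> length (word l)" for k
    using dyck_word[of l] that unfolding dyck_def by blast+
  have "k \<in> ?S ?P \<longleftrightarrow> k \<in> insert 0 ((\<lambda>k. ?m + k) ` ?S (word r))" for k
  proof -
    consider "k = 0" | k' where "k = Suc k'" "k' \<le> length (word l)" | k' where "k = ?m + k'"
      by (metis Suc_le_mono add_Suc le_Suc_ex not_less_eq_eq old.nat.exhaust)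
    then show ?thesis
    proof cases
      case 2
      \<comment> \<open>Every step inside the first tree starts at height at least 1, including its
        closing step.\<close>
      then have "height ?P k \<ge> 1" using l(1)[of k'] by (simp add: height_append)
      then show ?thesis using 2 by auto
    next
      case 3
      have "height ?P k = height (word r) k'" unfolding 3 using l(2)[of 0]
        by (simp add: height_append)
      moreover have "?P ! k = word r ! k'" unfolding 3 by (simp add: nth_append)
      ultimately show ?thesis unfolding 3 by auto
    qed simp
  qed
  then have "?S ?P = insert 0 ((\<lambda>k. ?m + k) ` ?S (word r))" by blast
  moreover have "card (insert 0 ((\<lambda>k. ?m + k) ` ?S (word r))) = Suc (card (?S (word r)))"
    using card_image[of "\<lambda>k. ?m + k" "?S (word r)"] by (subst card_insert_disjoint) (auto simp: inj_on_def)
  ultimately show ?case using Tree.IH(2) unfolding rising_contacts_def by simp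
qed


text \<open>The order \<open>V\<^sub>P(i) \<le> V\<^sub>Q(i)\<close> and the second condition on new intervals in a single recursion.\<close>

fun dominated :: "nat list \<Rightarrow> nat list \<Rightarrow> bool" where
  "dominated [] [] \<longleftrightarrow> True"
| "dominated (v # vs) (w # ws) \<longleftrightarrow> v \<le> w \<and> (w > 0 \<longrightarrow> ws \<noteq> [] \<and> v \<le> hd ws) \<and> dominated vs ws"
| "dominated _ _ \<longleftrightarrow> False"

lemma dominated_iff:
  "dominated vs ws \<longleftrightarrow> length vs = length ws \<and>
     (\<forall>i<length ws. vs ! i \<le> ws ! i \<and> (ws ! i > 0 \<longrightarrow> Suc i < length ws \<and> vs ! i \<le> ws ! Suc i))"
proof (induction vs ws rule: dominated.induct)
  case (2 v vs w ws)
  have "(\<forall>i<length (w # ws). Q i) \<longleftrightarrow> Q 0 \<and> (\<forall>i<length ws. Q (Suc i))" for Q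
    by (auto simp: less_Suc_eq_0_disj)
  then show ?case unfolding dominated.simps(2) 2 by (cases ws) auto
qed auto

lemma dominated_length: "dominated vs ws \<Longrightarrow> length vs = length ws"
  by (simp add: dominated_iff)

text \<open>Only a positive entry of \<open>ws\<close> looks at its successor; a final 0 keeps this
  comparison from crossing the seam.\<close>

lemma dominated_append:
  assumes "length vs = length ws" "ws = [] \<or> last ws = 0"
  shows "dominated (vs @ vs') (ws @ ws') \<longleftrightarrow> dominated vs ws \<and> dominated vs' ws'"
  using assms
proof (induction vs ws rule: list_induct2)
  case (Cons v vs w ws)
  then show ?case by (cases ws) auto
qed simp

lemma last_brackets: "t \<noteq> Empty \<Longrightarrow> last (brackets t) = 0"
proof (induction t)
  case (Tree l r)
  then show ?case by (cases "r = Empty"; cases "l = Empty"; cases l; cases r) (auto simp: last_append)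
qed simp

lemma brackets_nonempty: "brackets t = [] \<longleftrightarrow> t = Empty"
  by (cases t) auto

lemma brackets_bound: "i < fsize t \<Longrightarrow> i + brackets t ! i < fsize t"
proof (induction t arbitrary: i)
  case (Tree l r)
  show ?case
  proof (cases i)
    case (Suc i')
    show ?thesis
    proof (cases "i' < fsize l")
      case True
      then show ?thesis using Tree.IH(1)[OF True] Suc by (simp add: nth_append)
    next
      case False
      then have "i' - fsize l < fsize r" using Suc Tree.prems by simp
      then show ?thesis using Tree.IH(2)[of "i' - fsize l"] Suc False by (simp add: nth_append)
    qed
  qed simp
qed simp

lemma brackets_append [simp]: "brackets (fappend t u) = brackets t @ brackets u"
  by (induction t) auto

lemma fsize_append [simp]: "fsize (fappend t u) = fsize t + fsize u"
  by (induction t) auto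

lemma ntrees_append [simp]: "ntrees (fappend t u) = ntrees t + ntrees u"
  by (induction t) auto

lemma fappend_inj:
  "fappend t u = fappend t' u' \<Longrightarrow> fsize t = fsize t' \<Longrightarrow> t = t' \<and> u = u'"
proof (induction t arbitrary: t')
  case Empty
  then show ?case by (cases t') auto
next
  case (Tree l r)
  from Tree.prems obtain l' r' where t': "t' = Tree l' r'" by (cases t') simp_all
  then have "fappend r u = fappend r' u'" "fsize r = fsize r'" "l = l'" using Tree.prems by simp_all
  then show ?case using Tree.IH(2)[of r'] t' by simp
qed

lemma fappend_last_inj:
  "fappend t (Tree x Empty) = fappend t' (Tree x' Empty) \<Longrightarrow> t = t' \<and> x = x'"
proof (induction t arbitrary: t')
  case Empty
  then show ?case by (cases t'; cases "case t' of Tree l r \<Rightarrow> r") (auto split: forest.splits)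
next
  case (Tree l r)
  have "t' \<noteq> Empty"
  proof
    assume "t' = Empty"
    then have "fappend r (Tree x Empty) = Empty" using Tree.prems by simp
    then show False by (cases r) simp_all
  qed
  then obtain l' r' where t': "t' = Tree l' r'" by (cases t') simp_all
  then have "fappend r (Tree x Empty) = fappend r' (Tree x' Empty)" "l = l'" using Tree.prems by simp_all
  then show ?case using Tree.IH(2)[of r'] t' by simp
qed

lemma fappend_last_exists: "t \<noteq> Empty \<Longrightarrow> \<exists>u x. t = fappend u (Tree x Empty)"
proof (induction t)
  case (Tree l r)
  show ?case
  proof (cases "r = Empty")
    case True
    then show ?thesis by (intro exI[of _ Empty] exI[of _ l]) simp
  next
    case False
    then obtain u x where "r = fappend u (Tree x Empty)" using Tree.IH(2) by blast
    then show ?thesis by (intro exI[of _ "Tree l u"] exI[of _ x]) simp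
  qed
qed simp

lemma fappend_take_drop [simp]: "fappend (take_trees k t) (drop_trees k t) = t"
  by (induction k t rule: drop_trees.induct) auto

lemma ntrees_take: "ntrees (take_trees k t) = min k (ntrees t)"
  by (induction k t rule: take_trees.induct) auto

lemma take_trees_append [simp]: "take_trees (ntrees t) (fappend t u) = t"
  by (induction t) auto

lemma drop_trees_append [simp]: "drop_trees (ntrees t) (fappend t u) = u"
  by (induction t) auto

lemma fsize_eq_0 [simp]: "fsize t = 0 \<longleftrightarrow> t = Empty" "0 < fsize t \<longleftrightarrow> t \<noteq> Empty"
  by (cases t; simp)+

lemma ntrees_eq_0 [simp]: "ntrees t = 0 \<longleftrightarrow> t = Empty" "0 < ntrees t \<longleftrightarrow> t \<noteq> Empty"
  by (cases t; simp)+

text \<open>The first \<open>k\<close> up steps form whole trees if none of them encloses an up step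
  after them. This cuts \<open>p\<close> at the place where \<open>q\<close> loses its last
  subtree.\<close>

lemma split_forest:
  "k \<le> fsize t \<Longrightarrow> (\<And>i. i < k \<Longrightarrow> i + brackets t ! i < k) \<Longrightarrow> \<exists>t1 t2. t = fappend t1 t2 \<and> fsize t1 = k"
proof (induction t arbitrary: k)
  case Empty
  then show ?case by simp
next
  case (Tree l r)
  show ?case
  proof (cases k)
    case 0
    then show ?thesis by (intro exI[of _ Empty] exI[of _ "Tree l r"]) simp
  next
    case (Suc k')
    have l: "fsize l < k" using Tree.prems(2)[of 0] Suc by simp
    define m where "m = k' - fsize l"
    have k: "k = Suc (fsize l + m)" using l Suc by (simp add: m_def)
    have "i + brackets r ! i < m" if "i < m" for i
      using Tree.prems(2)[of "Suc (fsize l + i)"] that unfolding k by (simp add: nth_append)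
    moreover have "m \<le> fsize r" using Tree.prems(1) k by simp
    ultimately obtain r1 r2 where "r = fappend r1 r2" "fsize r1 = m" using Tree.IH(2) by blast
    then show ?thesis using k by (intro exI[of _ "Tree l r1"] exI[of _ r2]) simp
  qed
qed

text \<open>The interval of \<open>T\<close> consists of \<open>P = lower T\<close> and \<open>Q = U (upper T) D\<close>.\<close>

fun lower :: "dtree \<Rightarrow> forest" where
  "lower Leaf = Tree Empty Empty"
| "lower (Bridge T1 T2) = fappend (lower T1) (lower T2)"
| "lower (Loop T j) = Tree (take_trees (Suc j) (lower T)) (drop_trees (Suc j) (lower T))"

fun upper :: "dtree \<Rightarrow> forest" where
  "upper Leaf = Empty"
| "upper (Bridge T1 T2) = fappend (upper T1) (Tree (upper T2) Empty)"
| "upper (Loop T j) = Tree (upper T) Empty"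

lemma fsize_take_drop: "fsize (take_trees k t) + fsize (drop_trees k t) = fsize t"
  using arg_cong[OF fappend_take_drop[of k t], of fsize] unfolding fsize_append .

lemma brackets_take_drop: "brackets (take_trees k t) @ brackets (drop_trees k t) = brackets t"
  using arg_cong[OF fappend_take_drop[of k t], of brackets] unfolding brackets_append .

lemma fsize_lower [simp]: "fsize (lower T) = Suc (nedges T)"
  by (induction T) (auto simp: fsize_take_drop)

lemma fsize_upper [simp]: "fsize (upper T) = nedges T"
  by (induction T) auto

lemma lower_nonempty [simp]: "lower T \<noteq> Empty"
  using fsize_lower[of T] by (metis fsize.simps(1) nat.simps(3))

lemma upper_eq_Empty [simp]: "upper T = Empty \<longleftrightarrow> T = Leaf"
proof -
  have "nedges T = 0 \<longleftrightarrow> upper T = Empty" using fsize_eq_0(1)[of "upper T"] unfolding fsize_upper .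
  moreover have "nedges T = 0 \<longleftrightarrow> T = Leaf" by (cases T) simp_all
  ultimately show ?thesis by simp
qed

lemma ntrees_drop: "ntrees (drop_trees k t) = ntrees t - k"
  using arg_cong[OF fappend_take_drop[of k t], of ntrees] unfolding ntrees_append ntrees_take by simp

text \<open>One tree more than the degree: a \<open>Loop\<close> encloses at least one and at most
  \<open>deg T\<close> of the \<open>deg T + 1\<close> trees, in accordance with
  \<open>j < deg T\<close>.\<close>

lemma ntrees_lower: "valid T \<Longrightarrow> ntrees (lower T) = Suc (deg T)"
  by (induction T) (auto simp: ntrees_drop)

lemma dominated_lower_upper:
  "valid T \<Longrightarrow> dominated (brackets (lower T)) (nedges T # brackets (upper T))"
proof (induction T)
  case (Bridge T1 T2)
  let ?w1 = "brackets (upper T1)" and ?w2 = "nedges T2 # brackets (upper T2)"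
  obtain v vs where v: "brackets (lower T1) = v # vs" using lower_nonempty brackets_nonempty by (metis list.exhaust)
  have 1: "dominated (v # vs) (nedges T1 # ?w1)" using Bridge v by simp
  have len: "length vs = length ?w1" using dominated_length[OF 1] by simp
  have last: "?w1 = [] \<or> last ?w1 = 0" using last_brackets brackets_nonempty by metis
  have d: "dominated vs ?w1" "dominated (brackets (lower T2)) ?w2" using 1 Bridge by simp_all
  have "dominated (vs @ brackets (lower T2)) (?w1 @ ?w2)"
    unfolding dominated_append[OF len last] using d by simp
  \<comment> \<open>The root bracket grows from \<open>nedges T1\<close> to \<open>nedges T\<close>
    and is now positive, so the next entry counts. For an empty first part, \<open>v\<close> is
    0.\<close>
  moreover have "v \<le> hd (?w1 @ ?w2)"
  proof (cases "?w1 = []")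
    case True
    then have "nedges T1 = 0" by (metis fsize_upper length_brackets list.size(3))
    then show ?thesis using 1 by simp
  next
    case False
    then have "nedges T1 > 0" by (metis fsize_upper length_brackets length_greater_0_conv)
    then show ?thesis using 1 False by simp
  qed
  ultimately show ?case using 1 v by simp
next
  case (Loop T j)
  \<comment> \<open>At least one tree stays outside, so at most \<open>nedges T\<close> of the
    \<open>nedges T + 1\<close> up steps are enclosed: newness at the first step.\<close>
  have "drop_trees (Suc j) (lower T) \<noteq> Empty"
    using ntrees_drop[of "Suc j" "lower T"] ntrees_lower[of T] Loop.prems by (metis Suc_diff_Suc Zero_not_Suc diff_Suc_Suc ntrees.simps(1) valid.simps(3))
  then have "fsize (take_trees (Suc j) (lower T)) \<le> nedges T"
    using fsize_take_drop[of "Suc j" "lower T"] fsize_eq_0(2)[of "drop_trees (Suc j) (lower T)"]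
    by (simp del: fsize_eq_0)
  then show ?case using Loop brackets_take_drop[of "Suc j" "lower T"] by simp
qed simp

lemma lower_upper_surj:
  "dominated (brackets p) (fsize q # brackets q) \<Longrightarrow> \<exists>T. valid T \<and> lower T = p \<and> upper T = q"
proof (induction "fsize q" arbitrary: p q rule: less_induct)
  case less
  have size_p: "fsize p = Suc (fsize q)" using dominated_length[OF less.prems] by simp
  show ?case
  proof (cases "q = Empty")
    case True
    then obtain l r where "p = Tree l r" "fsize l + fsize r = 0" using size_p by (cases p) auto
    then show ?thesis using True by (intro exI[of _ Leaf]) simp
  next
    case False
    then obtain q1 q2 where q: "q = fappend q1 (Tree q2 Empty)" using fappend_last_exists by blast
    define w where "w = fsize q # brackets q"
    have w: "w = Suc (fsize q1 + fsize q2) # brackets q1 @ fsize q2 # brackets q2" by (simp add: w_def q)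
    have len_w: "length w = Suc (fsize q)" by (simp add: w_def)
    have dom: "brackets p ! i \<le> w ! i" "w ! i > 0 \<Longrightarrow> brackets p ! i \<le> w ! Suc i" if "i \<le> fsize q" for i
      using less.prems that unfolding w_def[symmetric] dominated_iff len_w by simp_all
    have w_q1: "w ! Suc i = brackets q1 ! i" if "i < fsize q1" for i
      using that by (simp add: w nth_append)
    show ?thesis
    \<comment> \<open>A single tree \<open>q\<close> together with a \<open>p\<close> that does not
      start with \<open>U D\<close> comes from a \<open>Loop\<close>, everything else from a
      \<open>Bridge\<close>.\<close>
    proof (cases "q1 = Empty \<and> brackets p ! 0 > 0")
      case True
      from size_p obtain l r where p: "p = Tree l r" by (cases p) auto
      have l: "l \<noteq> Empty" using True p by simp
      \<comment> \<open>Erasing the first up step of \<open>p\<close> and its match deletes the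
        first entry of both vectors.\<close>
      have "dominated (brackets (fappend l r)) (fsize q2 # brackets q2)"
        using less.prems True unfolding p q by simp
      moreover have "fsize q2 < fsize q" using q by simp
      ultimately obtain T where T: "valid T" "lower T = fappend l r" "upper T = q2"
        using less.hyps by blast
      \<comment> \<open>Newness at the first step bounds the enclosed size by
        \<open>fsize q2 = fsize p - 2\<close>, so some tree remains outside.\<close>
      have "brackets p ! 0 \<le> fsize q2" using dom(2)[of 0] True by (simp add: w)
      then have r: "r \<noteq> Empty" using size_p True unfolding p q by auto
      define j where "j = ntrees l - 1"
      have j: "Suc j = ntrees l" using l ntrees_eq_0(2)[of l] by (simp add: j_def del: ntrees_eq_0)
      have "Suc (deg T) = ntrees l + ntrees r" using ntrees_lower[OF T(1)] T(2) by simp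
      then have "j < deg T" using j r ntrees_eq_0(2)[of r] by (simp del: ntrees_eq_0)
      moreover have "lower (Loop T j) = p" using T(2) by (simp add: j p del: take_trees.simps drop_trees.simps)
      moreover have "upper (Loop T j) = q" using T(3) True by (simp add: q)
      ultimately show ?thesis using T(1) by (intro exI[of _ "Loop T j"]) simp
    next
      case no_loop: False
      \<comment> \<open>The first \<open>fsize q1 + 1\<close> up steps of \<open>p\<close> face the
        root of \<open>Q\<close> and the trees of \<open>q1\<close>. The bracket of the root is too
        large to bound the first of them; newness compares it with the first bracket of
        \<open>q1\<close> instead. For the others domination suffices.\<close>
      have "i + brackets p ! i < Suc (fsize q1)" if i: "i < Suc (fsize q1)" for i
      proof (cases i)
        case 0
        show ?thesis
        proof (cases "q1 = Empty")
          case True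
          then show ?thesis using no_loop 0 by simp
        next
          case ne: False
          then have "0 < fsize q1" by simp
          moreover have "brackets p ! 0 \<le> w ! Suc 0" using dom(2)[of 0] by (simp add: w)
          ultimately show ?thesis using brackets_bound[of 0 q1] w_q1[of 0] 0 by (simp del: fsize_eq_0)
        qed
      next
        case (Suc i')
        then have i': "i' < fsize q1" using i by simp
        then have "brackets p ! i \<le> brackets q1 ! i'" using dom(1)[of i] w_q1 Suc by (simp add: q)
        then show ?thesis using brackets_bound[OF i'] Suc by simp
      qed
      moreover have "Suc (fsize q1) \<le> fsize p" using size_p by (simp add: q)
      ultimately obtain p1 p2 where p: "p = fappend p1 p2" and size_p1: "fsize p1 = Suc (fsize q1)"
        using split_forest[of "Suc (fsize q1)" p] by blast
      obtain v vs where v: "brackets p1 = v # vs" using size_p1 by (cases p1) auto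
      have len: "length vs = length (brackets q1)" using size_p1 v by (metis length_brackets length_Cons nat.inject)
      have last: "brackets q1 = [] \<or> last (brackets q1) = 0" using last_brackets brackets_nonempty by metis
      have "dominated (vs @ brackets p2) (brackets q1 @ fsize q2 # brackets q2)"
        using less.prems unfolding p q by (simp add: v)
      then have d: "dominated vs (brackets q1)" "dominated (brackets p2) (fsize q2 # brackets q2)"
        unfolding dominated_append[OF len last] by simp_all
      have v_p: "brackets p ! 0 = v" unfolding p by (simp add: v)
      have "v \<le> fsize q1 \<and> (fsize q1 > 0 \<longrightarrow> brackets q1 \<noteq> [] \<and> v \<le> hd (brackets q1))"
      proof (cases "q1 = Empty")
        case True
        then show ?thesis using no_loop v_p by simp
      next
        case ne: False
        then have "0 < fsize q1" by simp
        moreover have "v \<le> w ! Suc 0" using dom(2)[of 0] v_p by (simp add: w)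
        ultimately have "v \<le> brackets q1 ! 0" using w_q1[of 0] by simp
        then show ?thesis using brackets_bound[of 0 q1] \<open>0 < fsize q1\<close> brackets_nonempty[of q1] ne
          by (simp add: hd_conv_nth del: fsize_eq_0)
      qed
      then have d1: "dominated (brackets p1) (fsize q1 # brackets q1)" using d(1) v by simp
      have "fsize q1 < fsize q" "fsize q2 < fsize q" using q by simp_all
      then obtain T1 T2 where "valid T1" "lower T1 = p1" "upper T1 = q1" "valid T2" "lower T2 = p2" "upper T2 = q2"
        using less.hyps[OF _ d1] less.hyps[OF _ d(2)] by blast
      then show ?thesis using p q by (intro exI[of _ "Bridge T1 T2"]) simp
    qed
  qed
qed

text \<open>Equal upper forests force \<open>T1 = Leaf\<close>; then one lower path starts with
  \<open>U D\<close>, whereas a \<open>Loop\<close> always encloses a tree.\<close>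

lemma lower_upper_not_Loop:
  assumes "upper (Bridge T1 T2) = upper (Loop T j)"
  shows "lower (Bridge T1 T2) \<noteq> lower (Loop T j)"
proof
  assume lo: "lower (Bridge T1 T2) = lower (Loop T j)"
  have "upper T1 = Empty"
    using fappend_last_inj[of "upper T1" "upper T2" Empty "upper T"] assms by simp
  then have "T1 = Leaf" by simp
  then have "Tree Empty (lower T2) = lower (Loop T j)" using lo by simp
  moreover obtain l r where "lower T = Tree l r" using lower_nonempty by (metis forest.exhaust)
  ultimately show False by simp
qed

lemma lower_upper_inj:
  "valid T \<Longrightarrow> valid T' \<Longrightarrow> lower T = lower T' \<Longrightarrow> upper T = upper T' \<Longrightarrow> T = T'"
proof (induction T arbitrary: T')
  case Leaf
  then show ?case by (metis upper_eq_Empty)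
next
  case (Bridge T1 T2)
  show ?case
  proof (cases T')
    case Leaf
    then show ?thesis using Bridge.prems(4) upper_eq_Empty by (metis upper.simps(1))
  next
    case T': (Bridge T1' T2')
    have up: "upper T1 = upper T1'" "upper T2 = upper T2'"
      using fappend_last_inj[of "upper T1" "upper T2" "upper T1'" "upper T2'"] Bridge.prems(4) T' by simp_all
    then have "nedges T1 = nedges T1'" using fsize_upper by metis
    then have lo: "lower T1 = lower T1'" "lower T2 = lower T2'"
      using fappend_inj[of "lower T1" "lower T2" "lower T1'" "lower T2'"] Bridge.prems(3) T' by simp_all
    show ?thesis using Bridge.IH(1)[of T1'] Bridge.IH(2)[of T2'] up lo Bridge.prems(1,2) T' by simp
  next
    case (Loop T j)
    then show ?thesis using lower_upper_not_Loop Bridge.prems(3,4) by metis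
  qed
next
  case (Loop T j)
  show ?case
  proof (cases T')
    case Leaf
    then show ?thesis using Loop.prems(4) upper_eq_Empty by (metis upper.simps(1))
  next
    case (Bridge T1' T2')
    then show ?thesis using lower_upper_not_Loop Loop.prems(3,4) by metis
  next
    case T': (Loop T1 k)
    have eq: "take_trees (Suc j) (lower T) = take_trees (Suc k) (lower T1)"
      "drop_trees (Suc j) (lower T) = drop_trees (Suc k) (lower T1)" "upper T = upper T1"
      using Loop.prems(3,4) unfolding T' lower.simps upper.simps by simp_all
    then have "lower T = lower T1" using fappend_take_drop by metis
    then have T: "T = T1" using Loop.IH[of T1] Loop.prems(1,2) eq(3) T' by simp
    \<comment> \<open>The number of enclosed trees recovers \<open>j\<close>; by validity the
      minimum is \<open>Suc j\<close>.\<close>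
    have "min (Suc j) (Suc (deg T)) = min (Suc k) (Suc (deg T1))"
      using arg_cong[OF eq(1), of ntrees] ntrees_lower[of T] ntrees_lower[of T1] Loop.prems(1,2) T'
      by (simp add: ntrees_take del: take_trees.simps)
    then have "j = k" using Loop.prems(1,2) T T' by simp
    then show ?thesis using T T' by simp
  qed
qed

definition interval_of :: "dtree \<Rightarrow> step list \<times> step list" where
  "interval_of T = (word (lower T), word (Tree (upper T) Empty))"

lemma mem_new_intervals_iff:
  "(word p, word q) \<in> new_intervals (Suc n) \<longleftrightarrow>
     fsize q = Suc n \<and> brackets q ! 0 = n \<and> dominated (brackets p) (brackets q)"
proof (cases "fsize p = Suc n \<and> fsize q = Suc n")
  case True
  have all: "(\<forall>i\<in>{1..Suc n}. R i) \<longleftrightarrow> (\<forall>i<Suc n. R (Suc i))" for R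
    by (auto simp: Ball_def) (metis Suc_le_eq Suc_pred le_imp_less_Suc less_Suc_eq_le)
  have bP: "bracket (word p) (Suc i) = brackets p ! i" and bQ: "bracket (word q) (Suc i) = brackets q ! i"
    if "i < Suc n" for i
    using that True bracket_word by simp_all
  \<comment> \<open>The last up step has bracket 0, so the range condition built into
    \<open>dominated\<close> holds automatically.\<close>
  have lt: "Suc i < Suc n" if "i < Suc n" "0 < brackets q ! i" for i
    using brackets_bound[of i q] that True by simp
  have "(word p, word q) \<in> new_intervals (Suc n) \<longleftrightarrow> bracket (word q) 1 = n \<and>
      (\<forall>i\<in>{1..Suc n}. bracket (word p) i \<le> bracket (word q) i) \<and>
      (\<forall>i\<in>{1..Suc n}. bracket (word q) i > 0 \<longrightarrow> bracket (word p) i \<le> bracket (word q) (i + 1))"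
    using True dyck_word unfolding new_intervals_def tamari_intervals_def dyck_paths_def tamari_le_def
    by auto
  also have "\<dots> \<longleftrightarrow> bracket (word q) 1 = n \<and>
      (\<forall>i<Suc n. bracket (word p) (Suc i) \<le> bracket (word q) (Suc i)) \<and>
      (\<forall>i<Suc n. bracket (word q) (Suc i) > 0 \<longrightarrow> bracket (word p) (Suc i) \<le> bracket (word q) (Suc (Suc i)))"
    unfolding all by simp
  also have "\<dots> \<longleftrightarrow> brackets q ! 0 = n \<and> dominated (brackets p) (brackets q)"
    using True bP bQ lt unfolding dominated_iff by (auto simp: One_nat_def)
  finally show ?thesis using True by simp
next
  case False
  then have "(word p, word q) \<notin> new_intervals (Suc n)"
    unfolding new_intervals_def tamari_intervals_def dyck_paths_def tamari_le_def by auto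
  moreover have "\<not> (fsize q = Suc n \<and> dominated (brackets p) (brackets q))"
    using False dominated_length[of "brackets p" "brackets q"] by auto
  ultimately show ?thesis by blast
qed

lemma interval_of_bij:
  "bij_betw interval_of {T. valid T \<and> nedges T = n} (new_intervals (Suc n))"
proof (rule bij_betw_imageI)
  show "inj_on interval_of {T. valid T \<and> nedges T = n}"
    by (rule inj_onI) (simp add: interval_of_def word_inj lower_upper_inj del: word.simps)
  show "interval_of ` {T. valid T \<and> nedges T = n} = new_intervals (Suc n)"
  proof
    show "interval_of ` {T. valid T \<and> nedges T = n} \<subseteq> new_intervals (Suc n)"
      using dominated_lower_upper by (auto simp: interval_of_def mem_new_intervals_iff simp del: word.simps)
    show "new_intervals (Suc n) \<subseteq> interval_of ` {T. valid T \<and> nedges T = n}"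
    proof
      fix I assume I: "I \<in> new_intervals (Suc n)"
      then obtain P Q where "I = (P, Q)" "dyck P" "dyck Q"
        unfolding new_intervals_def tamari_intervals_def dyck_paths_def by auto
      then obtain p q where pq: "I = (word p, word q)" unfolding dyck_iff_word by auto
      have q: "fsize q = Suc n" "brackets q ! 0 = n" "dominated (brackets p) (brackets q)"
        using I unfolding pq mem_new_intervals_iff by blast+
      then obtain q' where q': "q = Tree q' Empty" by (cases q) auto
      then obtain T where T: "valid T" "lower T = p" "upper T = q'"
        using lower_upper_surj[of p q'] q(3) by auto
      have "nedges T = n" using q(2) T(3) q' fsize_upper[of T] by simp
      then show "I \<in> interval_of ` {T. valid T \<and> nedges T = n}"
        using T q' pq by (auto simp: interval_of_def)
    qed
  qed
qed

section \<open>Pairs of types\<close>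

definition type_pairs :: "nat \<Rightarrow> nat \<Rightarrow> nat list \<Rightarrow> nat list \<Rightarrow> nat" where
  "type_pairs a b vs ws = length (filter (\<lambda>(v, w). pos v = a \<and> pos w = b) (zip vs ws))"

lemma type_pairs_Cons [simp]:
  "type_pairs a b (v # vs) (w # ws) = (if pos v = a \<and> pos w = b then 1 else 0) + type_pairs a b vs ws"
  by (simp add: type_pairs_def)

lemma type_pairs_Nil [simp]: "type_pairs a b [] [] = 0"
  by (simp add: type_pairs_def)

lemma type_pairs_append:
  "length vs = length ws \<Longrightarrow> type_pairs a b (vs @ vs') (ws @ ws') = type_pairs a b vs ws + type_pairs a b vs' ws'"
  by (simp add: type_pairs_def)

lemma type_count_word:
  assumes "fsize p = fsize q"
  shows "type_count a b (word p, word q) = type_pairs a b (brackets p) (brackets q)"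
proof -
  have "i < semilength (word p) \<and> map pos (brackets p) ! i = a \<and> map pos (brackets q) ! i = b \<longleftrightarrow>
      i < length (zip (brackets p) (brackets q)) \<and>
      (case zip (brackets p) (brackets q) ! i of (v, w) \<Rightarrow> pos v = a \<and> pos w = b)" for i
    using assms by (cases "i < fsize p") simp_all
  then show ?thesis
    unfolding type_count_def type_pairs_def length_filter_conv_card type_word_word prod.case by simp
qed

text \<open>A \<open>Bridge\<close> keeps the pairs of both parts except the first, whose upper
  entry becomes positive: for \<open>T1 = Leaf\<close> its (0,0) turns into (0,1), a new black
  vertex, and otherwise its types are the same as before. A \<open>Loop\<close> adds one pair (1,1).
  The extra (0,0) of \<open>Leaf\<close> turns into a white vertex when the leaf is a second
  part.\<close>

lemma type_pairs_lower_upper: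
  assumes "valid T"
  defines "tp \<equiv> \<lambda>a b. type_pairs a b (brackets (lower T)) (nedges T # brackets (upper T))"
  shows "tp 0 0 = nwhite T + (if T = Leaf then 1 else 0) \<and> tp 0 1 = nblack T \<and> tp 1 1 = nloops T"
  using assms(1) unfolding tp_def
proof (induction T)
  case (Bridge T1 T2)
  obtain v vs where v: "brackets (lower T1) = v # vs" using lower_nonempty brackets_nonempty by (metis list.exhaust)
  have len: "length vs = length (brackets (upper T1))"
    using arg_cong[OF v, of length] by simp
  have T1: "nedges T1 = 0 \<longleftrightarrow> T1 = Leaf" by (cases T1) simp_all
  have 1: "v = 0" if "T1 = Leaf" using v that by simp
  show ?case
  proof (cases "T1 = Leaf")
    case True
    then show ?thesis using Bridge by simp
  next
    case False
    then show ?thesis using Bridge v type_pairs_append[OF len] T1 by simp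
  qed
next
  case (Loop T j)
  obtain l r where "lower T = Tree l r" using lower_nonempty by (metis forest.exhaust)
  then have "fsize (take_trees (Suc j) (lower T)) \<noteq> 0" by simp
  moreover have "T \<noteq> Leaf" using Loop.prems by auto
  ultimately show ?case using Loop brackets_take_drop[of "Suc j" "lower T"] by (simp del: take_trees.simps drop_trees.simps fsize_eq_0)
qed simp

lemma interval_of_stats:
  assumes "valid T"
  shows "c00 (interval_of T) = nwhite T + (if T = Leaf then 1 else 0)" "c01 (interval_of T) = nblack T"
    "c11 (interval_of T) = nloops T" "rcont (interval_of T) = Suc (deg T)"
proof -
  have "type_count a b (interval_of T) = type_pairs a b (brackets (lower T)) (nedges T # brackets (upper T))" for a b
    unfolding interval_of_def by (subst type_count_word) simp_all
  then show "c00 (interval_of T) = nwhite T + (if T = Leaf then 1 else 0)" "c01 (interval_of T) = nblack T"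
    "c11 (interval_of T) = nloops T"
    using type_pairs_lower_upper[OF assms] by (simp_all add: c00_def c01_def c11_def)
  show "rcont (interval_of T) = Suc (deg T)"
    using ntrees_lower[OF assms] by (simp add: rcont_def interval_of_def rising_contacts_word)
qed

section \<open>The bijection on classes of labelled maps\<close>

theorem theorem1p1:
  fixes n :: nat
  shows "\<exists>\<I>. bij_betw \<I> (rooted_maps n) (new_intervals (n + 1)) \<and>
    (\<forall>C\<in>rooted_maps n. \<forall>M\<in>C.
       (n > 0 \<longrightarrow> white M = c00 (\<I> C) \<and> black M = c01 (\<I> C)) \<and>
       face M = 1 + c11 (\<I> C) \<and>
       int (outdeg M) = int (rcont (\<I> C)) - 1)"
proof -
  let ?L = "labelled_maps n" and ?V = "{T. valid T \<and> nedges T = n}"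
  define R where "R = {(M, M'). M \<in> ?L \<and> M' \<in> ?L \<and> same_map M M'}"
  \<comment> \<open>The choice is harmless: the tree is unique and common to all representatives of
    a class.\<close>
  define tree where "tree M = (SOME T. encodes M T)" for M
  have tree: "encodes M (tree M)" if "M \<in> ?L" for M
    unfolding tree_def using encodes_exists[OF that] by (rule someI_ex)
  have sound: "tree M \<in> ?V" if "M \<in> ?L" for M
    using encodes_sound[OF that tree[OF that]] by simp
  have same: "(M, M') \<in> R \<longleftrightarrow> M \<in> ?L \<and> M' \<in> ?L \<and> tree M = tree M'" for M M'
    unfolding R_def using same_map_iff_encodes tree by blast
  have equiv: "equiv ?L R"
    by (rule equivI) (auto simp: refl_on_def sym_def trans_def same)
  define classtree where "classtree C = the_elem (tree ` C)" for C
  have rooted: "rooted_maps n = ?L // R" unfolding rooted_maps_def R_def ..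
  have class_eq: "classtree C = tree M" if C: "C \<in> rooted_maps n" and M: "M \<in> C" for C M
  proof -
    have "C = R `` {M}" using C M unfolding rooted by (metis Image_singleton_iff equiv equiv_class_eq quotientE)
    then have "tree ` C = {tree M}" using M by (auto simp: same)
    then show ?thesis by (simp add: classtree_def)
  qed
  have in_L: "M \<in> ?L" if "C \<in> rooted_maps n" "M \<in> C" for C M
    using that equiv Union_quotient unfolding rooted by blast
  have nonempty: "\<exists>M. M \<in> C" if "C \<in> rooted_maps n" for C
    using that equiv in_quotient_imp_non_empty unfolding rooted by blast
  have "bij_betw classtree (rooted_maps n) ?V"
  proof (rule bij_betw_imageI)
    show "inj_on classtree (rooted_maps n)"
    proof (rule inj_onI)
      fix C C' assume C: "C \<in> rooted_maps n" "C' \<in> rooted_maps n" "classtree C = classtree C'"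
      obtain M M' where M: "M \<in> C" "M' \<in> C'" using C nonempty by blast
      then have "(M, M') \<in> R" using C class_eq in_L same by metis
      then show "C = C'" using quotient_eqI[OF equiv] C M unfolding rooted by blast
    qed
    show "classtree ` rooted_maps n = ?V"
    proof
      show "classtree ` rooted_maps n \<subseteq> ?V"
      proof
        fix T assume "T \<in> classtree ` rooted_maps n"
        then obtain C where C: "C \<in> rooted_maps n" "T = classtree C" by blast
        then obtain M where "M \<in> C" using nonempty by blast
        then show "T \<in> ?V" using C class_eq in_L sound by metis
      qed
      show "?V \<subseteq> classtree ` rooted_maps n"
      proof
        fix T assume "T \<in> ?V"
        then obtain M where M: "M \<in> ?L" "encodes M T" using encodes_surj by blast
        have "same_map M M" using same_map_iff_encodes[OF M M] by simp
        then have "tree M = T" using same_map_iff_encodes[OF M M(1) tree[OF M(1)]] by simp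
        moreover have "M \<in> R `` {M}" using M same by blast
        moreover have "R `` {M} \<in> rooted_maps n" unfolding rooted using M(1) by (rule quotientI)
        ultimately show "T \<in> classtree ` rooted_maps n"
          using class_eq[of "R `` {M}" M] by (metis imageI)
      qed
    qed
  qed
  then have bij: "bij_betw (interval_of \<circ> classtree) (rooted_maps n) (new_intervals (n + 1))"
    using interval_of_bij[of n] by (simp add: bij_betw_trans)
  show ?thesis
  proof (intro exI[of _ "interval_of \<circ> classtree"] conjI bij ballI)
    fix C M assume C: "C \<in> rooted_maps n" "M \<in> C"
    have M: "M \<in> ?L" using in_L C by blast
    have eq: "(interval_of \<circ> classtree) C = interval_of (tree M)" using class_eq[OF C] by simp
    note snd = encodes_sound[OF M tree[OF M]]
    have v: "valid (tree M)" using snd by blast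
    show "n > 0 \<longrightarrow> white M = c00 ((interval_of \<circ> classtree) C) \<and> black M = c01 ((interval_of \<circ> classtree) C)"
      "face M = 1 + c11 ((interval_of \<circ> classtree) C)"
      "int (outdeg M) = int (rcont ((interval_of \<circ> classtree) C)) - 1"
      unfolding eq interval_of_stats[OF v] using snd by auto
  qed
qed

end
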